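(* Let $n\ge 2$, $\beta\in(0,1)$, and let $\Omega$ be a uniformly $C^{2+\beta}$ domain in $\mathbf{R}^n$ with boundary $\Gamma$. Let $\mu,\nu,\delta\in(0,\infty]$. Then there is a constant $C=C(\mu,\nu,\delta,\Omega)$ such that $$\| v\cdot\mathbf{n} \|_{L^\infty(\Gamma)} \le C \left( \| v \|_{vbmo^{\mu,\nu}_\delta(\Omega)} + \|\operatorname{div} v \|_{L^n_{\mathrm{ul}}(\Gamma_\delta)} \right)$$ for all vector fields $v \in vbmo^{\mu,\nu}_\delta(\Omega)$ with $\operatorname{div} v\in L^n_{\mathrm{ul}}(\Gamma_\delta)$, where $v\cdot\mathbf{n}$ is the normal trace of $v$ on $\Gamma$.
   Context: For a domain $\Omega\subset\mathbf{R}^n$ with boundary $\Gamma=\partial\Omega$: $d_\Omega(x)=\inf_{y\in\Gamma}|x-y|$; $\Gamma_\delta=\{x\in\Omega : d_\Omega(x)<\delta\}$ for $0<\delta<\infty$, and $\Gamma_\infty=\Omega$; $\mathbf{n}$ is the exterior unit normal on $\Gamma$; $B_r(x)$ is the closed ball of radius $r$ centered at $x$; $f_B=\frac1{|B|}\int_B f\,dy$. The function $d_\Omega$ is Lipschitz, so $\nabla d_\Omega$ is defined a.e. Uniformly $C^{2+\beta}$ domain: there exist $r_*,\delta_*,L>0$ such that for each $z_0\in\Gamma$, up to translation and rotation (placing $z_0$ at the origin), there is $h_{z_0}\in C^{2+\beta}(B_{r_*}(0'))$, $B_{r_*}(0')\subset\mathbf{R}^{n-1}$, with $|\nabla^k h_{z_0}|\le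 L$ for $k=0,1,2$, $[\nabla^2h_{z_0}]_{C^\beta(B_{r_*}(0'))}\le L$, $\nabla' h_{z_0}(0')=0'$, $h_{z_0}(0')=0$, such that the neighborhood $U=\{(x',x_n): h_{z_0}(x')-\delta_*<x_n<h_{z_0}(x')+\delta_*,\ |x'|<r_*\}$ satisfies $\Omega\cap U=\{(x',x_n): h_{z_0}(x')<x_n<h_{z_0}(x')+\delta_*,\ |x'|<r_*\}$ and $\partial\Omega\cap U=\{(x',x_n): x_n=h_{z_0}(x'),\ |x'|<r_*\}$. For $f\in L^1_{\mathrm{loc}}(\Omega)$ and $\mu,\nu\in(0,\infty]$: $$[f]_{BMO^\mu}=\sup\Big\{\tfrac1{|B_r(x)|}\int_{B_r(x)}|f-f_{B_r(x)}|\,dy : B_r(x)\subset\Omega,\ r<\mu\Big\},$$ $$[f]_{b^\nu}=\sup\Big\{r^{-n}\int_{\Omega\cap B_r(x)}|f|\,dy : x\in\Gamma,\ 0<r<\nu\Big\}.$$ For a fixed $r_0>0$ (different choices give equivalent norms), an open set $D\subset\mathbf{R}^n$ and $1\le p<\infty$, $L^p_{\mathrm{ul}}(D)$ is the space of $f\in L^p_{\mathrm{loc}}(D)$ with $\|f\|_{L^p_{\mathrm{ul}}(D)}=\sup_{x\in\mathbf{R}^n}\|f\|_{L^p(B_{r_0}(x)\cap D)}<\infty$. For a vector field $v=(v_1,\dots,v_n)$ the seminorm $[v]_{BMO^\mu}$ and the norm $\|v\|_{L^1_{\mathrm{ul}}(\Gamma_\delta)}$ are taken componentwise. The space $vbmo^{\mu,\nu}_\delta(\Omega)$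 consists of all vector fields $v\in L^1_{\mathrm{loc}}(\Omega)^n$ with finite norm $$\|v\|_{vbmo^{\mu,\nu}_\delta}=[v]_{BMO^\mu}+\|v\|_{L^1_{\mathrm{ul}}(\Gamma_\delta)}+[\nabla d_\Omega\cdot v]_{b^\nu}.$$ Normal trace: $v\cdot\mathbf{n}$ on $\Gamma$ is understood in the weak sense through integration by parts, i.e. $\int_\Gamma (v\cdot\mathbf{n})\varphi\,d\mathcal{H}^{n-1}=\int_\Omega(\operatorname{div}v)\varphi\,dx+\int_\Omega v\cdot\nabla\varphi\,dx$ for all $\varphi\in C^1_c(\mathbf{R}^n)$ vanishing on $\Omega\setminus\Gamma_{\delta'}$ for some $\delta'<\delta$, where $\operatorname{div} v$ is the distributional divergence. *)

theory Defs
  imports "HOL-Analysis.Analysis" "HOL-Probability.Essential_Supremum"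
begin

section \<open>Domains\<close>

text \<open>
  The space $\mathbf{R}^n$ with $n \ge 2$ is rendered as \<^typ>\<open>'m::euclidean_space \<times> real\<close>, that
  is as $\mathbf{R}^{n-1} \times \mathbf{R}$ with coordinates $(x', x_n)$ and the Euclidean product
  norm. Every euclidean space has positive dimension, so each $n \ge 2$ occurs and no other $n$ does.
  Notions which do not use the splitting are defined on an arbitrary euclidean space.
\<close>

text \<open>
  In the next definition \<^term>\<open>h1\<close> is the gradient and \<^term>\<open>h2\<close> the Hessian of \<^term>\<open>h\<close>.
  Derivatives are taken within the closed ball, i.e. one-sided at its boundary, where they are still
  unique. The norm of the Hessian is the operator norm; its continuity follows from the Hoelder bound.
\<close>

definition C2_holder_graph :: "real \<Rightarrow> real \<Rightarrow> real \<Rightarrow> ('m::euclidean_space \<Rightarrow> real) \<Rightarrow> bool" where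
  "C2_holder_graph \<beta> r L h \<longleftrightarrow>
     (\<exists>(h1 :: 'm \<Rightarrow> 'm) (h2 :: 'm \<Rightarrow> 'm \<Rightarrow>\<^sub>L 'm).
        (\<forall>x\<in>cball 0 r.
           (h has_derivative (\<lambda>y. h1 x \<bullet> y)) (at x within cball 0 r) \<and>
           (h1 has_derivative blinfun_apply (h2 x)) (at x within cball 0 r) \<and>
           \<bar>h x\<bar> \<le> L \<and> norm (h1 x) \<le> L \<and> norm (h2 x) \<le> L) \<and>
        (\<forall>x\<in>cball 0 r. \<forall>y\<in>cball 0 r. norm (h2 x - h2 y) \<le> L * norm (x - y) powr \<beta>) \<and>
        h1 0 = 0 \<and> h 0 = 0)"

text \<open>
  The rigid motion placing \<^term>\<open>z0\<close> at the origin is the inverse of \<^term>\<open>\<lambda>y. z0 + T y\<close>. Orthogonal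
  maps of determinant $-1$ may be admitted for \<^term>\<open>T\<close>: composing with a reflection in the $x'$
  variables makes \<^term>\<open>T\<close> a rotation and preserves all the bounds on \<^term>\<open>h\<close>.
\<close>

definition uniformly_C2_holder_domain :: "real \<Rightarrow> ('m::euclidean_space \<times> real) set \<Rightarrow> bool" where
  "uniformly_C2_holder_domain \<beta> \<Omega> \<longleftrightarrow>
     open \<Omega> \<and> connected \<Omega> \<and> \<Omega> \<noteq> {} \<and>
     (\<exists>r>0. \<exists>\<eta>>0. \<exists>L>0. \<forall>z0\<in>frontier \<Omega>.
        \<exists>(T :: 'm \<times> real \<Rightarrow> 'm \<times> real) (h :: 'm \<Rightarrow> real).
          orthogonal_transformation T \<and> C2_holder_graph \<beta> r L h \<and>
          (let \<Phi> = (\<lambda>y. z0 + T y);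
               U = {(x', t). norm x' < r \<and> h x' - \<eta> < t \<and> t < h x' + \<eta>}
           in \<Omega> \<inter> \<Phi> ` U = \<Phi> ` {(x', t). norm x' < r \<and> h x' < t \<and> t < h x' + \<eta>} \<and>
              frontier \<Omega> \<inter> \<Phi> ` U = \<Phi> ` {(x', t). norm x' < r \<and> t = h x'}))"

definition bdry_strip :: "'a::euclidean_space set \<Rightarrow> ereal \<Rightarrow> 'a set" where
  "bdry_strip \<Omega> \<delta> = {x \<in> \<Omega>. ereal (infdist x (frontier \<Omega>)) < \<delta>}"

definition grad :: "('a::euclidean_space \<Rightarrow> real) \<Rightarrow> 'a \<Rightarrow> 'a" where
  "grad f x = (\<Sum>i\<in>Basis. frechet_derivative f (at x) i *\<^sub>R i)"


section \<open>Function spaces\<close>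

definition L1_loc :: "'a::euclidean_space set \<Rightarrow> ('a \<Rightarrow> 'b::euclidean_space) \<Rightarrow> bool" where
  "L1_loc D f \<longleftrightarrow> (\<forall>K. compact K \<and> K \<subseteq> D \<longrightarrow> f absolutely_integrable_on K)"

definition Lp_loc :: "real \<Rightarrow> 'a::euclidean_space set \<Rightarrow> ('a \<Rightarrow> real) \<Rightarrow> bool" where
  "Lp_loc p D f \<longleftrightarrow>
     (\<forall>K. compact K \<and> K \<subseteq> D \<longrightarrow>
        f \<in> borel_measurable (lebesgue_on K) \<and>
        (\<lambda>x. \<bar>f x\<bar> powr p) absolutely_integrable_on K)"

definition Lp_norm :: "real \<Rightarrow> 'a::euclidean_space set \<Rightarrow> ('a \<Rightarrow> real) \<Rightarrow> ennreal" where
  "Lp_norm p A f =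
     (let I = (\<integral>\<^sup>+ x\<in>A. ennreal (\<bar>f x\<bar> powr p) \<partial>lebesgue)
      in if I = \<infinity> then \<infinity> else ennreal (enn2real I powr (1 / p)))"

definition Lp_ul_norm :: "real \<Rightarrow> real \<Rightarrow> 'a::euclidean_space set \<Rightarrow> ('a \<Rightarrow> real) \<Rightarrow> ennreal" where
  "Lp_ul_norm r0 p D f = (SUP x. Lp_norm p (cball x r0 \<inter> D) f)"

definition Lp_ul :: "real \<Rightarrow> real \<Rightarrow> 'a::euclidean_space set \<Rightarrow> ('a \<Rightarrow> real) \<Rightarrow> bool" where
  "Lp_ul r0 p D f \<longleftrightarrow> Lp_loc p D f \<and> Lp_ul_norm r0 p D f < \<infinity>"

definition ball_avg :: "('a::euclidean_space \<Rightarrow> real) \<Rightarrow> 'a \<Rightarrow> real \<Rightarrow> real" where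
  "ball_avg f x r = (LINT y:cball x r|lebesgue. f y) / measure lebesgue (cball x r)"

definition bmo_seminorm :: "ereal \<Rightarrow> 'a::euclidean_space set \<Rightarrow> ('a \<Rightarrow> real) \<Rightarrow> ennreal" where
  "bmo_seminorm \<mu> \<Omega> f =
     (SUP (x, r)\<in>{(x, r). 0 < r \<and> ereal r < \<mu> \<and> cball x r \<subseteq> \<Omega>}.
        (\<integral>\<^sup>+ y\<in>cball x r. ennreal \<bar>f y - ball_avg f x r\<bar> \<partial>lebesgue) / emeasure lebesgue (cball x r))"

definition b_seminorm :: "ereal \<Rightarrow> 'a::euclidean_space set \<Rightarrow> ('a \<Rightarrow> real) \<Rightarrow> ennreal" where
  "b_seminorm \<nu> \<Omega> f =
     (SUP (x, r)\<in>{(x, r). x \<in> frontier \<Omega> \<and> 0 < r \<and> ereal r < \<nu>}.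
        ennreal (1 / r ^ DIM('a)) * (\<integral>\<^sup>+ y\<in>\<Omega> \<inter> cball x r. ennreal \<bar>f y\<bar> \<partial>lebesgue))"

text \<open>
  Seminorms of a vector field taken componentwise are summed over the components. The gradient of
  the distance function is meaningful almost everywhere only, which suffices for the integrals.
\<close>

definition vbmo_norm ::
  "real \<Rightarrow> ereal \<Rightarrow> ereal \<Rightarrow> ereal \<Rightarrow> 'a::euclidean_space set \<Rightarrow> ('a \<Rightarrow> 'a) \<Rightarrow> ennreal" where
  "vbmo_norm r0 \<mu> \<nu> \<delta> \<Omega> v =
     (\<Sum>i\<in>Basis. bmo_seminorm \<mu> \<Omega> (\<lambda>x. v x \<bullet> i)) +
     (\<Sum>i\<in>Basis. Lp_ul_norm r0 1 (bdry_strip \<Omega> \<delta>) (\<lambda>x. v x \<bullet> i)) +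
     b_seminorm \<nu> \<Omega> (\<lambda>x. grad (\<lambda>y. infdist y (frontier \<Omega>)) x \<bullet> v x)"

definition vbmo ::
  "real \<Rightarrow> ereal \<Rightarrow> ereal \<Rightarrow> ereal \<Rightarrow> 'a::euclidean_space set \<Rightarrow> ('a \<Rightarrow> 'a) \<Rightarrow> bool" where
  "vbmo r0 \<mu> \<nu> \<delta> \<Omega> v \<longleftrightarrow> L1_loc \<Omega> v \<and> vbmo_norm r0 \<mu> \<nu> \<delta> \<Omega> v < \<infinity>"


section \<open>Weak divergence\<close>

primrec Ck :: "nat \<Rightarrow> ('a::euclidean_space \<Rightarrow> real) \<Rightarrow> bool" where
  "Ck 0 f \<longleftrightarrow> continuous_on UNIV f"
| "Ck (Suc k) f \<longleftrightarrow>
     (\<forall>x. f differentiable at x) \<and> (\<forall>i\<in>Basis. Ck k (\<lambda>x. frechet_derivative f (at x) i))"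

definition supp :: "('a::euclidean_space \<Rightarrow> real) \<Rightarrow> 'a set" where
  "supp f = closure {x. f x \<noteq> 0}"

text \<open>\<^term>\<open>w\<close> represents on the open set \<^term>\<open>D\<close> the distributional divergence of \<^term>\<open>v\<close>.\<close>

definition weak_divergence_on ::
  "'a::euclidean_space set \<Rightarrow> ('a \<Rightarrow> 'a) \<Rightarrow> ('a \<Rightarrow> real) \<Rightarrow> bool" where
  "weak_divergence_on D v w \<longleftrightarrow>
     L1_loc D w \<and>
     (\<forall>\<psi>. (\<forall>k. Ck k \<psi>) \<and> compact (supp \<psi>) \<and> supp \<psi> \<subseteq> D \<longrightarrow>
        (LINT x:D|lebesgue. w x * \<psi> x) = - (LINT x:D|lebesgue. v x \<bullet> grad \<psi> x))"


section \<open>Surface measure and normal trace\<close>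

definition hausdorff_content :: "nat \<Rightarrow> real \<Rightarrow> 'a::euclidean_space set \<Rightarrow> ennreal" where
  "hausdorff_content s \<epsilon> A =
     (INF C\<in>{C :: nat \<Rightarrow> 'a set. A \<subseteq> (\<Union>j. C j) \<and> (\<forall>j. bounded (C j) \<and> diameter (C j) \<le> \<epsilon>)}.
        \<Sum>j. if C j = {} then 0 else ennreal (unit_ball_vol (real s) * (diameter (C j) / 2) ^ s))"

definition hausdorff_outer :: "nat \<Rightarrow> 'a::euclidean_space set \<Rightarrow> ennreal" where
  "hausdorff_outer s A = (SUP \<epsilon>\<in>{0<..}. hausdorff_content s \<epsilon> A)"

text \<open>
  The outer measure is a metric outer measure, hence countably additive on Borel sets, so that
  \<^const>\<open>measure_of\<close> does not fall back to the zero measure here. The factor \<^const>\<open>unit_ball_vol\<close>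
  is the normalisation under which it is surface area, as needed in the divergence theorem.
\<close>

definition hausdorff_measure :: "nat \<Rightarrow> 'a::euclidean_space measure" where
  "hausdorff_measure s = measure_of UNIV (sets borel) (hausdorff_outer s)"

definition surface_measure :: "'a::euclidean_space set \<Rightarrow> 'a measure" where
  "surface_measure \<Omega> = restrict_space (hausdorff_measure (DIM('a) - 1)) (frontier \<Omega>)"

definition trace_test :: "ereal \<Rightarrow> 'a::euclidean_space set \<Rightarrow> ('a \<Rightarrow> real) \<Rightarrow> bool" where
  "trace_test \<delta> \<Omega> \<phi> \<longleftrightarrow>
     Ck 1 \<phi> \<and> compact (supp \<phi>) \<and>
     (\<exists>\<delta>'>0. ereal \<delta>' < \<delta> \<and> (\<forall>x\<in>\<Omega> - bdry_strip \<Omega> (ereal \<delta>'). \<phi> x = 0))"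

text \<open>
  \<^term>\<open>g\<close>, locally integrable on the boundary, is the normal trace of a field \<^term>\<open>v\<close> with divergence
  \<^term>\<open>w\<close>. Only the values of \<^term>\<open>w\<close> on \<^term>\<open>bdry_strip \<Omega> \<delta>\<close> matter, since test functions vanish on
  the rest of \<^term>\<open>\<Omega>\<close>.
\<close>

definition normal_trace ::
  "ereal \<Rightarrow> 'a::euclidean_space set \<Rightarrow> ('a \<Rightarrow> 'a) \<Rightarrow> ('a \<Rightarrow> real) \<Rightarrow> ('a \<Rightarrow> real) \<Rightarrow> bool" where
  "normal_trace \<delta> \<Omega> v w g \<longleftrightarrow>
     g \<in> borel_measurable (surface_measure \<Omega>) \<and>
     (\<forall>K. compact K \<longrightarrow> set_integrable (surface_measure \<Omega>) (K \<inter> frontier \<Omega>) g) \<and>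
     (\<forall>\<phi>. trace_test \<delta> \<Omega> \<phi> \<longrightarrow>
        (LINT x|surface_measure \<Omega>. g x * \<phi> x) =
        (LINT x:\<Omega>|lebesgue. w x * \<phi> x) + (LINT x:\<Omega>|lebesgue. v x \<bullet> grad \<phi> x))"

definition Linf_bdry_norm :: "'a::euclidean_space set \<Rightarrow> ('a \<Rightarrow> real) \<Rightarrow> ennreal" where
  "Linf_bdry_norm \<Omega> g = esssup (surface_measure \<Omega>) (\<lambda>x. ennreal \<bar>g x\<bar>)"

end

theory Submission
  imports Defs
begin

text \<open>
  Only the term \<open>[\<nabla>d \<cdot> v]\<close> of the norm is needed for the estimate. Write \<open>F(\<phi>)\<close> for the right-hand side of
  the integration by parts formula and \<open>s\<close> for a \<open>C\<^sup>1\<close> step function. For \<open>\<epsilon>\<close> below the reach of the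
  boundary, \<open>\<phi> s(d/\<epsilon>)\<close> is an admissible test function for the weak divergence, so \<open>F(\<phi>)\<close> equals
  \<open>F(\<phi> (1 - s(d/\<epsilon>)))\<close>. There the terms in which the cutoff is not differentiated vanish in the limit, and
  \<open>F(\<phi>) = - lim \<epsilon>\<inverse> \<integral> \<phi> s'(d/\<epsilon>) \<nabla>d \<cdot> v\<close>.

  A boundary ball of radius \<open>\<epsilon>\<close> has surface measure at least \<open>c \<epsilon>\<^sup>n / \<epsilon>\<close>. Distributing the mass of
  the integrand at \<open>x\<close> evenly over the boundary points within \<open>2\<epsilon>\<close> of \<open>x\<close> therefore yields functions on
  the boundary that are bounded by \<open>C [\<nabla>d \<cdot> v]\<close>, and by Fubini their integrals against \<open>\<phi>\<close> converge to
  \<open>F(\<phi>)\<close> as well. The trace is their weak limit, produced by the Radon-Nikodym theorem. A second trace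
  differs from it only on a null set, since the test functions determine a locally integrable function.

  Because the trace is obtained as a density, surface measure enters only through countable additivity
  and bounds up to constants; its exact normalisation plays no role.
\<close>

section \<open>Smooth approximation\<close>

text \<open>The obstacle is that \<open>v\<close> has no pointwise boundary values: near the
  boundary only averages of its normal component over balls centred there are under control. This
  forces a weak limit, and it is why mass is moved to the boundary over distances of order
  \<epsilon> without any tubular coordinates. Dropping the undifferentiated terms rests on the
  uniformly local norms: they make \<open>v\<close> and its divergence integrable on bounded pieces
  of the strip right up to the boundary, so dominated convergence applies. The cutoff is known to
  have one continuous derivative only: the distance is shown to be C1 through continuity of the
  nearest point, and the step is C1. The weak divergence is tested with smooth functions, which is
  what the mollification is for. The powers of \<epsilon> balance because a ball about a boundary
  point carries normal mass of order \<epsilon>^n, the cutoff contributes 1/\<epsilon>, and the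
  spreading divides by \<epsilon>^(n-1). The uniform bound survives the limit since the limiting set
  function is dominated by a multiple of surface measure.\<close>

lemma has_derivative_gradI:
  fixes f :: "'a::euclidean_space \<Rightarrow> real"
  assumes "(f has_derivative (\<lambda>u. G \<bullet> u)) (at x)"
  shows "grad f x = G" "frechet_derivative f (at x) = (\<lambda>u. G \<bullet> u)" "f differentiable at x"
proof -
  show *: "frechet_derivative f (at x) = (\<lambda>u. G \<bullet> u)"
    using frechet_derivative_at[OF assms] by simp
  show "grad f x = G"
    unfolding grad_def * by (rule euclidean_representation)
  show "f differentiable at x"
    using assms differentiable_def by blast
qed

lemma differentiable_has_derivative_grad:
  fixes f :: "'a::euclidean_space \<Rightarrow> real"
  assumes "f differentiable at x"
  shows "(f has_derivative (\<lambda>u. grad f x \<bullet> u)) (at x)"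
proof -
  let ?D = "frechet_derivative f (at x)"
  have D: "(f has_derivative ?D) (at x)"
    using assms frechet_derivative_works by blast
  then have lin: "linear ?D"
    using has_derivative_linear by blast
  have "?D u = grad f x \<bullet> u" for u
  proof -
    have "?D u = ?D (\<Sum>i\<in>Basis. (u \<bullet> i) *\<^sub>R i)"
      by (simp add: euclidean_representation)
    also have "\<dots> = (\<Sum>i\<in>Basis. (u \<bullet> i) * ?D i)"
      using lin by (simp add: linear_sum linear_scale)
    also have "\<dots> = grad f x \<bullet> u"
      unfolding grad_def by (simp add: inner_sum_left inner_sum_right inner_commute mult.commute)
    finally show ?thesis .
  qed
  then have "?D = (\<lambda>u. grad f x \<bullet> u)" by blast
  with D show ?thesis by simp
qed

lemma frechet_derivative_Basis_eq_grad:
  assumes "i \<in> Basis"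
  shows "frechet_derivative f (at x) i = grad f x \<bullet> i"
  unfolding grad_def using assms by (simp add: inner_sum_left inner_Basis if_distrib cong: if_cong)

section \<open>Calculus of functions of class \<open>Ck\<close>\<close>

text \<open>The recursion for \<open>Ck (Suc k) f\<close> speaks of the partial derivatives and not
  of \<open>Ck k f\<close>, so lowering the order takes an induction; its base is that
  differentiability implies continuity.\<close>

lemma Ck_SucD: "Ck (Suc k) f \<Longrightarrow> Ck k f"
proof (induction k arbitrary: f)
  case 0
  then show ?case
    by (auto intro!: continuous_at_imp_continuous_on differentiable_imp_continuous_within)
next
  case (Suc k)
  then show ?case by (metis Ck.simps(2))
qed

text \<open>\<open>Ck\<close> is built from partial derivatives, whereas all later estimates use the
  gradient vector; this is the bridge between the two.\<close>

lemma Ck_1_iff: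
  "Ck 1 f \<longleftrightarrow> (\<forall>x. (f has_derivative (\<lambda>u. grad f x \<bullet> u)) (at x)) \<and> continuous_on UNIV (grad f)"
proof -
  have "Ck 1 f \<longleftrightarrow> (\<forall>x. f differentiable at x) \<and> (\<forall>i\<in>Basis. continuous_on UNIV (\<lambda>x. grad f x \<bullet> i))"
    by (simp add: frechet_derivative_Basis_eq_grad cong: ball_cong)
  also have "(\<forall>i\<in>Basis. continuous_on UNIV (\<lambda>x. grad f x \<bullet> i)) \<longleftrightarrow> continuous_on UNIV (grad f)"
    using continuous_on_componentwise[of UNIV "grad f"] by auto
  finally show ?thesis
    using differentiable_has_derivative_grad has_derivative_gradI(3) by blast
qed

lemma Ck_1I:
  assumes "\<And>x. (f has_derivative (\<lambda>u. G x \<bullet> u)) (at x)" "continuous_on UNIV G"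
  shows "Ck 1 f" "grad f = G"
proof -
  show *: "grad f = G"
    using has_derivative_gradI(1)[OF assms(1)] by blast
  show "Ck 1 f"
    unfolding Ck_1_iff * using assms by blast
qed

lemma Ck_1_continuous: "Ck 1 f \<Longrightarrow> continuous_on S f"
  using Ck_SucD[of 0 f] by (auto intro: continuous_on_subset)

lemma Ck_const: "Ck k (\<lambda>x. c)"
  by (induction k arbitrary: c) (auto simp: frechet_derivative_const)

lemma Ck_SucI:
  assumes "\<And>x. (f has_derivative f' x) (at x)" "\<And>i. i \<in> Basis \<Longrightarrow> Ck k (\<lambda>x. f' x i)"
  shows "Ck (Suc k) f"
proof -
  have "frechet_derivative f (at x) = f' x" for x
    using frechet_derivative_at[OF assms(1)] by simp
  then show ?thesis using assms by (auto simp: differentiable_def)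
qed

lemma Ck_SucE:
  assumes "Ck (Suc k) f"
  shows "(f has_derivative frechet_derivative f (at x)) (at x)"
    "i \<in> Basis \<Longrightarrow> Ck k (\<lambda>x. frechet_derivative f (at x) i)"
  using assms frechet_derivative_works by auto

lemma Ck_add: "Ck k f \<Longrightarrow> Ck k g \<Longrightarrow> Ck k (\<lambda>x. f x + g x)"
proof (induction k arbitrary: f g)
  case 0 then show ?case by (auto intro: continuous_intros)
next
  case (Suc k)
  show ?case
    by (rule Ck_SucI[OF has_derivative_add[OF Ck_SucE(1) Ck_SucE(1)]])
       (use Suc in \<open>auto intro!: Suc.IH\<close>)
qed

lemma Ck_mult: "Ck k f \<Longrightarrow> Ck k g \<Longrightarrow> Ck k (\<lambda>x. f x * g x)"
proof (induction k arbitrary: f g)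
  case 0 then show ?case by (auto intro: continuous_intros)
next
  case (Suc k)
  show ?case
    by (rule Ck_SucI[OF has_derivative_mult[OF Ck_SucE(1) Ck_SucE(1)]])
       (use Suc Ck_SucD in \<open>auto intro!: Suc.IH Ck_add\<close>)
qed

lemma Ck_inner_const: "Ck k (\<lambda>x. x \<bullet> c)"
proof (cases k)
  case (Suc j)
  show ?thesis unfolding Suc
    by (rule Ck_SucI[where f' = "\<lambda>x u. u \<bullet> c"]) (auto intro!: derivative_eq_intros Ck_const)
qed (auto intro!: continuous_intros)

section \<open>A smooth bump and the mollifier\<close>

text \<open>Inner function of the bump. The squared norm is used because \<open>norm\<close> is not
  differentiable at the origin.\<close>

lemma Ck_norm_sq: "Ck k (\<lambda>x::'a::euclidean_space. c - x \<bullet> x)"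
proof (cases k)
  case (Suc j)
  have "Ck j (\<lambda>x::'a. (- 2) * (x \<bullet> i))" for i
    by (rule Ck_mult[OF Ck_const Ck_inner_const])
  then show ?thesis unfolding Suc
    by (intro Ck_SucI[where f' = "\<lambda>x u. (-2) * (x \<bullet> u)"])
       (auto intro!: derivative_eq_intros simp: inner_commute)
qed (auto intro!: continuous_intros)

text \<open>Admitting the negative powers makes the family closed under differentiation, so that smoothness of
  \<open>flat_exp 0\<close> at \<open>0\<close> is an induction over all \<open>m\<close>.\<close>

definition flat_exp :: "nat \<Rightarrow> real \<Rightarrow> real" where
  "flat_exp m t = (if t \<le> 0 then 0 else exp (- 1 / t) / t ^ m)"

text \<open>With \<open>u = 1 / t\<close> the expression becomes \<open>u ^ m / exp u\<close>, and
  the exponential beats every power.\<close>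

lemma flat_exp_tendsto_0: "(flat_exp m \<longlongrightarrow> 0) (at 0)"
proof -
  have "((\<lambda>t::real. exp (- 1 / t) / t ^ m) \<longlongrightarrow> 0) (at_right 0)"
  proof -
    have "((\<lambda>t::real. (inverse t) ^ m / exp (inverse t)) \<longlongrightarrow> 0) (at_right 0)"
      by (rule filterlim_compose[OF tendsto_power_div_exp_0 filterlim_inverse_at_top_right])
    then show ?thesis
      by (simp add: exp_minus field_simps power_inverse inverse_eq_divide)
  qed
  then have R: "(flat_exp m \<longlongrightarrow> 0) (at_right 0)"
    by (rule Lim_transform_eventually) (auto simp: flat_exp_def eventually_at_right_field intro: gt_ex)
  have L: "(flat_exp m \<longlongrightarrow> 0) (at_left 0)"
    by (rule tendsto_eventually)
       (auto simp: flat_exp_def eventually_at_left_field intro: lt_ex)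
  show ?thesis using R L by (simp add: filterlim_at_split)
qed

lemma flat_exp_deriv:
  "(flat_exp m has_real_derivative (- real m * flat_exp (m + 1) t + flat_exp (m + 2) t)) (at t)"
proof -
  consider "t < 0" | "t = 0" | "t > 0" by linarith
  then show ?thesis
  proof cases
    case 1
    have "((\<lambda>t. 0) has_real_derivative 0) (at t)" by simp
    then have "(flat_exp m has_real_derivative 0) (at t)"
      by (rule DERIV_cong_ev[THEN iffD1, OF refl _ refl, rotated])
         (use 1 in \<open>auto simp: flat_exp_def intro!: eventually_mono[OF order_tendstoD(2)[OF tendsto_ident_at, of t 0]]
            eventually_mono[OF eventually_nhds_in_open[of "{..<0}" t]]\<close>)
    then show ?thesis using 1 by (simp add: flat_exp_def)
  next
    case 2
    \<comment> \<open>Since \<open>flat_exp m 0 = 0\<close>, the difference quotient at 0 is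
      \<open>flat_exp (m + 1) h\<close>: dividing by \<open>h\<close> raises the power by
      one.\<close>
    have "((\<lambda>h. flat_exp (m+1) h) \<longlongrightarrow> 0) (at 0)" by (rule flat_exp_tendsto_0)
    then have "((\<lambda>h. (flat_exp m (0 + h) - flat_exp m 0) / h) \<longlongrightarrow> 0) (at 0)"
      by (rule Lim_transform_eventually)
         (auto simp: flat_exp_def field_simps eventually_at intro!: exI[of _ 1])
    then show ?thesis using 2 by (simp add: DERIV_def flat_exp_def)
  next
    case 3
    have "((\<lambda>t. exp (- 1 / t) / t ^ m) has_real_derivative
        (- real m * (exp (- 1 / t) / t ^ (m+1)) + exp (- 1 / t) / t ^ (m+2))) (at t)"
    proof (cases m)
      case 0
      then show ?thesis using 3 by (auto intro!: derivative_eq_intros simp: power2_eq_square field_simps)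
    next
      case (Suc j)
      then show ?thesis using 3
        apply (auto intro!: derivative_eq_intros)
        apply (cases j; simp add: field_simps power2_eq_square)
        done
    qed
    then have "(flat_exp m has_real_derivative
        (- real m * (exp (- 1 / t) / t ^ (m+1)) + exp (- 1 / t) / t ^ (m+2))) (at t)"
      by (rule DERIV_cong_ev[THEN iffD1, OF refl _ refl, rotated])
         (use 3 in \<open>auto simp: flat_exp_def
            intro!: eventually_mono[OF eventually_nhds_in_open[of "{0<..}" t]]\<close>)
    then show ?thesis using 3 by (simp add: flat_exp_def)
  qed
qed

lemma Ck_flat_exp:
  assumes "\<And>k. Ck k q"
  shows "Ck k (\<lambda>x. flat_exp m (q x))"
proof (induction k arbitrary: m)
  case 0
  have "continuous_on UNIV (flat_exp m)"
    by (intro continuous_at_imp_continuous_on ballI DERIV_isCont[OF flat_exp_deriv])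
  moreover have "continuous_on UNIV q" using assms[of 0] by simp
  ultimately show ?case
    by (auto intro: continuous_on_compose2)
next
  case (Suc k)
  have q: "(q has_derivative frechet_derivative q (at x)) (at x)" for x
    by (rule Ck_SucE(1)[OF assms])
  show ?case
  proof (rule Ck_SucI)
    fix x
    show "((\<lambda>x. flat_exp m (q x)) has_derivative (\<lambda>u. frechet_derivative q (at x) u *
      (- real m * flat_exp (m + 1) (q x) + flat_exp (m + 2) (q x)))) (at x)"
      using has_derivative_compose[OF q flat_exp_deriv[unfolded has_field_derivative_def]]
      by (simp add: mult.commute)
  next
    fix i :: 'a assume "i \<in> Basis"
    then show "Ck k (\<lambda>x. frechet_derivative q (at x) i *
      (- real m * flat_exp (m + 1) (q x) + flat_exp (m + 2) (q x)))"
      by (intro Ck_mult Ck_add Suc.IH Ck_const Ck_SucE(2)[OF assms])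
  qed
qed

lemma integrable_lborel_compact_support:
  fixes f :: "'a::euclidean_space \<Rightarrow> 'b::euclidean_space"
  assumes "continuous_on UNIV f" "compact K" "\<And>x. x \<notin> K \<Longrightarrow> f x = 0"
  shows "integrable lborel f"
proof -
  have "integrable lborel (\<lambda>x. indicator K x *\<^sub>R f x)"
    by (rule borel_integrable_compact[unfolded set_integrable_def])
       (use assms in \<open>auto intro: continuous_on_subset\<close>)
  also have "(\<lambda>x. indicator K x *\<^sub>R f x) = f"
    using assms(3) by (auto simp: indicator_def)
  finally show ?thesis .
qed

lemma mollifier_exists:
  assumes "0 < e"
  obtains \<rho> :: "'a::euclidean_space \<Rightarrow> real" where "\<And>k. Ck k \<rho>" "\<And>x. 0 \<le> \<rho> x"
    "\<And>x. e \<le> norm x \<Longrightarrow> \<rho> x = 0" "integrable lborel \<rho>" "(LINT x|lborel. \<rho> x) = 1"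
proof -
  \<comment> \<open>The classical bump exp(-1/(e^2 - |x|^2)), extended by zero; it is normalised at
    the end.\<close>
  define b where "b = (\<lambda>x::'a. flat_exp 0 (e\<^sup>2 - x \<bullet> x))"
  have b: "Ck k b" for k
    unfolding b_def by (rule Ck_flat_exp[OF Ck_norm_sq])
  have b0: "0 \<le> b x" for x by (simp add: b_def flat_exp_def)
  have bz: "b x = 0" if "e \<le> norm x" for x
    using that assms by (simp add: b_def flat_exp_def dot_square_norm)
  have bp: "b x > 0" if "norm x < e" for x
    using that by (simp add: b_def flat_exp_def dot_square_norm abs_square_less_1 power_strict_mono not_le)
  have cb: "continuous_on UNIV b" using b[of 0] by simp
  have ib: "integrable lborel b"
    by (rule integrable_lborel_compact_support[OF cb compact_cball[of 0 e]]) (use bz in auto)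
  have pos: "(LINT x|lborel. b x) > 0"
  proof -
    \<comment> \<open>A zero integral would make the nonnegative \<open>b\<close> vanish almost
      everywhere, but it is positive on an open ball.\<close>
    have "(LINT x|lborel. b x) \<noteq> 0"
    proof
      assume "(LINT x|lborel. b x) = 0"
      then have "AE x in lborel. b x = 0"
        using integral_nonneg_eq_0_iff_AE[OF ib] b0 by simp
      then have "AE x in lborel. x \<notin> ball (0::'a) e"
      proof (rule eventually_mono)
        fix x assume "b x = 0"
        then show "x \<notin> ball 0 e" using bp[of x] by auto
      qed
      then have "emeasure lborel (ball (0::'a) e) = 0"
        using AE_iff_measurable[of "ball (0::'a) e" lborel "\<lambda>x. x \<notin> ball (0::'a) e"] by (auto simp: ball_def)
      moreover have "\<not> negligible (ball (0::'a) e)"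
        using assms open_not_negligible by (metis centre_in_ball empty_iff open_ball)
      ultimately show False
        by (simp add: negligible_iff_emeasure0)
    qed
    moreover have "(LINT x|lborel. b x) \<ge> 0" by (simp add: b0)
    ultimately show ?thesis by simp
  qed
  show thesis
  proof (rule that[of "\<lambda>x. inverse (LINT x|lborel. b x) * b x"])
    show "Ck k (\<lambda>x. inverse (LINT x|lborel. b x) * b x)" for k
      by (intro Ck_mult Ck_const b)
  qed (use pos b0 bz ib in auto)
qed

section \<open>Convolution\<close>

definition conv :: "('a::euclidean_space \<Rightarrow> real) \<Rightarrow> ('a \<Rightarrow> real) \<Rightarrow> 'a \<Rightarrow> real" where
  "conv f \<rho> x = (LINT y|lborel. f y * \<rho> (x - y))"

text \<open>The reflection \<open>y \<mapsto> x - y\<close> preserves Lebesgue measure. No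
  integrability is assumed: if the integrand is not measurable, both integrals are 0 by
  default.\<close>

lemma conv_commute: "conv f \<rho> x = conv \<rho> f x"
proof -
  have "conv f \<rho> x = (LINT y|lborel. f (x - y) * \<rho> y)"
  proof -
    have "(lborel::'a measure) = distr lborel borel (\<lambda>y. x - y)"
    proof -
      show ?thesis
        using lborel_affine[of "-1" x] by (simp add: density_1 flip: one_ennreal_def)
    qed
    then have "(LINT y|lborel. f y * \<rho> (x - y)) = (LINT y|distr lborel borel (\<lambda>y. x - y). f y * \<rho> (x - y))"
      by (rule arg_cong)
    also have "\<dots> = (LINT y|lborel. f (x - y) * \<rho> (x - (x - y)))"
    proof (cases "(\<lambda>y. f y * \<rho> (x - y)) \<in> borel_measurable borel")
      case True then show ?thesis by (intro integral_distr) auto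
    next
      case False
      have "\<not> integrable lborel (\<lambda>y. f y * \<rho> (x - y))"
        using False borel_measurable_integrable by force
      moreover have "\<not> integrable lborel (\<lambda>y. f (x - y) * \<rho> (x - (x - y)))"
      proof
        assume "integrable lborel (\<lambda>y. f (x - y) * \<rho> (x - (x - y)))"
        then have "(\<lambda>y. f (x - y) * \<rho> (x - (x - y))) \<in> borel_measurable borel"
          using borel_measurable_integrable by force
        then have "(\<lambda>y. f (x - y) * \<rho> (x - (x - y))) \<circ> (\<lambda>y. x - y) \<in> borel_measurable borel"
          by (rule measurable_comp[rotated]) simp
        then show False using False by (simp add: o_def)
      qed
      moreover have "distr lborel borel (\<lambda>y. x - y) = (lborel::'a measure)"
        using \<open>lborel = distr lborel borel (\<lambda>y. x - y)\<close> by (rule sym)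
      ultimately show ?thesis by (simp add: not_integrable_integral_eq)
    qed
    finally show ?thesis unfolding conv_def by simp
  qed
  then show ?thesis unfolding conv_def by (simp add: mult.commute)
qed

text \<open>Only the factor \<open>\<rho> (x - y)\<close> depends on \<open>x\<close>, so the
  derivative falls on \<open>\<rho>\<close>; the bounded support of \<open>f\<close> confines the
  integral to a fixed box, where the Leibniz rule applies.\<close>

lemma conv_has_derivative:
  fixes f \<rho> :: "'a::euclidean_space \<Rightarrow> real"
  assumes f: "continuous_on UNIV f" "bounded {x. f x \<noteq> 0}"
    and \<rho>: "\<And>x. (\<rho> has_derivative (\<lambda>u. G x \<bullet> u)) (at x)" "continuous_on UNIV G"
  shows "(conv f \<rho> has_derivative (\<lambda>u. conv f (\<lambda>y. G y \<bullet> u) x)) (at x)"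
proof -
  obtain a where "{x. f x \<noteq> 0} \<subseteq> cbox (-a) a"
    using bounded_subset_cbox_symmetric[OF f(2)] by blast
  then have z: "f y = 0" if "y \<notin> cbox (-a) a" for y using that by blast
  have c\<rho>: "continuous_on UNIV \<rho>"
    using \<rho>(1) by (intro continuous_at_imp_continuous_on) (blast intro: has_derivative_continuous)
  have eq: "conv f \<sigma> y = integral (cbox (-a) a) (\<lambda>t. f t * \<sigma> (y - t))"
    if "continuous_on UNIV \<sigma>" for \<sigma> y
  proof -
    have c: "continuous_on UNIV (\<lambda>t. f t * \<sigma> (y - t))"
      by (intro continuous_intros f continuous_on_compose2[OF that]) auto
    have "integrable lborel (\<lambda>t. f t * \<sigma> (y - t))"
      by (rule integrable_lborel_compact_support[OF c compact_cbox[of "-a" a]]) (use z in auto)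
    then have "conv f \<sigma> y = integral UNIV (\<lambda>t. f t * \<sigma> (y - t))"
      unfolding conv_def using integral_lborel by metis
    also have "\<dots> = integral UNIV (\<lambda>t. if t \<in> cbox (-a) a then f t * \<sigma> (y - t) else 0)"
      using z by (intro arg_cong[of _ _ "integral UNIV"]) auto
    also have "\<dots> = integral (cbox (-a) a) (\<lambda>t. f t * \<sigma> (y - t))"
      by (simp add: integral_restrict_UNIV)
    finally show ?thesis .
  qed
  \<comment> \<open>The derivative of the integrand in \<open>x\<close>, packaged as a bounded
    linear map, which is the form taken by the Leibniz rule.\<close>
  let ?H = "\<lambda>x t. f t *\<^sub>R blinfun_inner_right (G (x - t))"
  have cH: "continuous_on (UNIV \<times> cbox (-a) a) (\<lambda>(x, t). ?H x t)"
    unfolding split_beta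
    by (intro continuous_intros continuous_on_compose2[OF f(1)] continuous_on_compose2[OF \<rho>(2)]
        bounded_linear.continuous_on[OF bounded_linear_blinfun_inner_right]) auto
  have "((\<lambda>x. integral (cbox (-a) a) (\<lambda>t. f t * \<rho> (x - t))) has_derivative
     blinfun_apply (integral (cbox (-a) a) (?H x))) (at x within UNIV)"
  proof (rule leibniz_rule[OF _ _ cH])
    fix y t
    have "((\<lambda>y. \<rho> (y - t)) has_derivative (\<lambda>u. G (y - t) \<bullet> u)) (at y)"
      by (rule has_derivative_compose[OF _ \<rho>(1), of "\<lambda>y. y - t" "\<lambda>u. u" y UNIV])
         (auto intro!: derivative_eq_intros)
    from has_derivative_mult_right[OF this, of "f t"]
    show "((\<lambda>y. f t * \<rho> (y - t)) has_derivative blinfun_apply (?H y t)) (at y within UNIV)"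
      by (simp add: scaleR_blinfun.rep_eq)
  next
    fix y
    show "(\<lambda>t. f t * \<rho> (y - t)) integrable_on cbox (-a) a"
      by (intro integrable_continuous continuous_intros continuous_on_compose2[OF f(1)]
         continuous_on_compose2[OF c\<rho>]) auto
  qed auto
  moreover have "conv f \<rho> = (\<lambda>x. integral (cbox (-a) a) (\<lambda>t. f t * \<rho> (x - t)))"
    using eq[OF c\<rho>] by blast
  moreover have "blinfun_apply (integral (cbox (-a) a) (?H x)) = (\<lambda>u. conv f (\<lambda>y. G y \<bullet> u) x)"
  proof
    fix u
    have "?H x integrable_on cbox (-a) a"
      by (intro integrable_continuous continuous_on_compose2[OF cH, of _ "\<lambda>t. (x, t)", simplified split_conv])
         (auto intro!: continuous_intros)
    from blinfun_apply_integral[OF this]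
    have "blinfun_apply (integral (cbox (-a) a) (?H x)) u = integral (cbox (-a) a) (\<lambda>t. f t * (G (x - t) \<bullet> u))"
      by (simp add: blinfun.scaleR_left)
    also have "\<dots> = conv f (\<lambda>y. G y \<bullet> u) x"
      by (subst eq) (auto intro!: continuous_intros \<rho>(2))
    finally show "blinfun_apply (integral (cbox (-a) a) (?H x)) u = conv f (\<lambda>y. G y \<bullet> u) x" .
  qed
  ultimately show ?thesis by simp
qed

text \<open>One order is lost in the base case, where continuity of the convolution is read off from
  its differentiability. With a mollifier of every order the loss is invisible.\<close>

lemma Ck_conv:
  assumes f: "continuous_on UNIV f" "bounded {x. f x \<noteq> 0}"
  shows "Ck (Suc k) \<rho> \<Longrightarrow> Ck k (conv f \<rho>)"
proof (induction k arbitrary: \<rho>)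
  case 0
  then have "Ck 1 \<rho>" by simp
  then have "(conv f \<rho> has_derivative (\<lambda>u. conv f (\<lambda>y. grad \<rho> y \<bullet> u) x)) (at x)" for x
    by (intro conv_has_derivative f) (use Ck_1_iff in blast)+
  then show ?case
    by (auto intro!: continuous_at_imp_continuous_on intro: has_derivative_continuous)
next
  case (Suc k)
  have "Ck 1 \<rho>" using Suc.prems
    by (induction k) (use Ck_SucD in \<open>auto simp del: Ck.simps\<close>)
  then have D: "(conv f \<rho> has_derivative (\<lambda>u. conv f (\<lambda>y. grad \<rho> y \<bullet> u) x)) (at x)" for x
    by (intro conv_has_derivative f) (use Ck_1_iff in blast)+
  show ?case
  proof (rule Ck_SucI[OF D])
    fix i :: 'a assume i: "i \<in> Basis"
    have "Ck (Suc k) (\<lambda>y. grad \<rho> y \<bullet> i)"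
      using Ck_SucE(2)[OF Suc.prems i] by (simp add: frechet_derivative_Basis_eq_grad[OF i])
    from Suc.IH[OF this] show "Ck k (\<lambda>x. conv f (\<lambda>y. grad \<rho> y \<bullet> i) x)" by simp
  qed
qed

text \<open>The convolution is an average of \<open>f\<close> over a ball of radius \<open>e\<close>
  with weights \<open>\<rho>\<close>, so a bound on the distance of \<open>f\<close> from a constant
  there passes to the average. The constant \<open>c\<close> is free because different reference
  values are inserted later.\<close>

lemma conv_approx:
  fixes f :: "'a::euclidean_space \<Rightarrow> real"
  assumes f: "continuous_on UNIV f" "bounded {x. f x \<noteq> 0}"
    and \<rho>: "\<And>x. 0 \<le> \<rho> x" "\<And>x. e \<le> norm x \<Longrightarrow> \<rho> x = 0" "integrable lborel \<rho>"
      "(LINT x|lborel. \<rho> x) = 1" "continuous_on UNIV \<rho>"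
    and x: "\<And>y. norm y < e \<Longrightarrow> \<bar>f (x - y) - c\<bar> \<le> d"
  shows "\<bar>conv f \<rho> x - c\<bar> \<le> d"
proof -
  have i: "integrable lborel (\<lambda>y. \<rho> y * f (x - y))"
    by (rule integrable_lborel_compact_support[OF _ compact_cball[of 0 e]])
       (use \<rho> in \<open>auto intro!: continuous_intros continuous_on_compose2[OF f(1)]\<close>)
  have "conv f \<rho> x - c = (LINT y|lborel. \<rho> y * f (x - y)) - (LINT y|lborel. \<rho> y * c)"
    using \<rho> by (subst conv_commute) (simp add: conv_def)
  also have "\<dots> = (LINT y|lborel. \<rho> y * (f (x - y) - c))"
    using i \<rho> by (subst Bochner_Integration.integral_diff[symmetric]) (auto simp: algebra_simps)
  also have "\<bar>\<dots>\<bar> \<le> (LINT y|lborel. \<bar>\<rho> y * (f (x - y) - c)\<bar>)"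
    using integral_norm_bound[of lborel "\<lambda>y. \<rho> y * (f (x - y) - c)"] by simp
  also have "\<dots> \<le> (LINT y|lborel. \<rho> y * d)"
  proof (rule integral_mono)
    show "integrable lborel (\<lambda>y. \<bar>\<rho> y * (f (x - y) - c)\<bar>)"
    proof -
      have "integrable lborel (\<lambda>y. \<rho> y * f (x - y) - \<rho> y * c)"
        using i \<rho> by (intro Bochner_Integration.integrable_diff) auto
      then show ?thesis by (intro integrable_abs) (simp add: algebra_simps)
    qed
    show "\<bar>\<rho> y * (f (x - y) - c)\<bar> \<le> \<rho> y * d" for y
      using \<rho>(1)[of y] \<rho>(2)[of y] x[of y]
      by (cases "norm y < e") (auto simp: abs_mult intro: mult_left_mono)
  qed (use \<rho> in auto)
  also have "\<dots> = d" using \<rho> by simp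
  finally show ?thesis .
qed

lemma uniform_continuity_compact_support:
  fixes f :: "'a::euclidean_space \<Rightarrow> 'b::euclidean_space"
  assumes "continuous_on UNIV f" "bounded {x. f x \<noteq> 0}" "0 < e"
  obtains d where "0 < d" "\<And>x y. norm y < d \<Longrightarrow> norm (f (x - y) - f x) < e"
proof -
  obtain R where R: "\<And>x. f x \<noteq> 0 \<Longrightarrow> norm x \<le> R"
    using assms(2) by (auto simp: bounded_iff)
  \<comment> \<open>The ball exceeds the support by one unit: for shifts shorter than 1, if either
    of the two points lies outside it, both values are zero.\<close>
  have "uniformly_continuous_on (cball 0 (R + 1)) f"
    using assms by (intro compact_uniformly_continuous continuous_on_subset[OF assms(1)]) auto
  then obtain d where d: "0 < d"
    "\<And>x y. x \<in> cball 0 (R+1) \<Longrightarrow> y \<in> cball 0 (R+1) \<Longrightarrow> dist y x < d \<Longrightarrow> dist (f y) (f x) < e"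
    using assms(3) unfolding uniformly_continuous_on_def by metis
  show thesis
  proof (rule that[of "min d 1"])
    fix x y :: 'a assume y: "norm y < min d 1"
    show "norm (f (x - y) - f x) < e"
    proof (cases "norm x \<le> R + 1 \<and> norm (x - y) \<le> R + 1")
      case True
      then show ?thesis using d(2)[of x "x - y"] y by (simp add: dist_norm norm_minus_commute)
    next
      case False
      have "f x = 0"
      proof (rule ccontr)
        assume "f x \<noteq> 0" then have "norm x \<le> R" using R by blast
        then show False using False y norm_triangle_ineq4[of x y] by auto
      qed
      moreover have "f (x - y) = 0"
      proof (rule ccontr)
        assume "f (x - y) \<noteq> 0" then have "norm (x - y) \<le> R" using R by blast
        then show False using False y norm_triangle_ineq[of "x - y" y] by auto
      qed
      ultimately show ?thesis using assms by simp
    qed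
  qed (use d in auto)
qed

section \<open>Supports, and smooth approximation in the C1 norm\<close>

lemma supp_zero: "x \<notin> supp f \<Longrightarrow> f x = 0"
  unfolding supp_def using closure_subset[of "{x. f x \<noteq> 0}"] by auto

lemma grad_zero_outside_supp: "x \<notin> supp f \<Longrightarrow> grad f x = 0"
proof -
  assume x: "x \<notin> supp f"
  have "((\<lambda>x. 0) has_derivative (\<lambda>u. 0)) (at x)" by simp
  then have "(f has_derivative (\<lambda>u. 0)) (at x)"
    by (rule has_derivative_transform_within_open[where s = "- supp f"])
       (use x supp_zero in \<open>auto simp: supp_def\<close>)
  then show "grad f x = 0" using has_derivative_gradI(1)[of f 0 x] by simp
qed

lemma bounded_supp_iff: "compact (supp f) \<longleftrightarrow> bounded {x. f x \<noteq> 0}"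
  unfolding supp_def by (auto simp: compact_closure)

text \<open>Mollification at a scale given by the moduli of continuity of \<open>\<psi>\<close> and
  of its gradient. Both are uniform because the support is compact.\<close>

lemma smooth_approximation:
  fixes \<psi> :: "'a::euclidean_space \<Rightarrow> real"
  assumes \<psi>: "Ck 1 \<psi>" "compact (supp \<psi>)" and e: "0 < e"
  obtains \<eta> where "\<And>k. Ck k \<eta>" "\<And>x. \<eta> x \<noteq> 0 \<Longrightarrow> \<exists>y. \<psi> y \<noteq> 0 \<and> dist x y < e"
    "\<And>x. \<bar>\<eta> x - \<psi> x\<bar> \<le> e" "\<And>x. norm (grad \<eta> x - grad \<psi> x) \<le> e"
proof -
  have c: "continuous_on UNIV \<psi>" using Ck_1_continuous[OF \<psi>(1)] .
  have cg: "continuous_on UNIV (grad \<psi>)" using \<psi>(1)[unfolded Ck_1_iff] by simp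
  have b: "bounded {x. \<psi> x \<noteq> 0}" using \<psi>(2) by (simp add: bounded_supp_iff)
  have bg: "bounded {x. grad \<psi> x \<noteq> 0}"
    by (rule bounded_subset[OF compact_imp_bounded[OF \<psi>(2)]]) (use grad_zero_outside_supp in blast)
  define n where "n = real DIM('a)"
  have n: "n > 0" by (simp add: n_def)
  obtain d1 where d1: "0 < d1" "\<And>x y. norm y < d1 \<Longrightarrow> norm (\<psi> (x - y) - \<psi> x) < e"
    by (rule uniform_continuity_compact_support[OF c b e]) (rule that)
  \<comment> \<open>Accuracy \<open>e / n\<close> per component, since the norm of the gradient
    error is bounded by the sum of its \<open>n\<close> components.\<close>
  obtain d2 where d2: "0 < d2" "\<And>x y. norm y < d2 \<Longrightarrow> norm (grad \<psi> (x - y) - grad \<psi> x) < e / n"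
    by (rule uniform_continuity_compact_support[OF cg bg divide_pos_pos[OF e n]]) (rule that)
  \<comment> \<open>The bound by \<open>e\<close> keeps the support of the mollified function within
    distance \<open>e\<close> of the original one.\<close>
  define d where "d = min e (min d1 d2)"
  have d: "0 < d" using d1 d2 e by (simp add: d_def)
  obtain \<rho> :: "'a \<Rightarrow> real" where \<rho>: "\<And>k. Ck k \<rho>" "\<And>x. 0 \<le> \<rho> x"
    "\<And>x. d \<le> norm x \<Longrightarrow> \<rho> x = 0" "integrable lborel \<rho>" "(LINT x|lborel. \<rho> x) = 1"
    by (rule mollifier_exists[OF d]) (rule that)
  have c\<rho>: "continuous_on UNIV \<rho>" using \<rho>(1)[of 0] by simp
  have b\<rho>: "bounded {x. \<rho> x \<noteq> 0}"
  proof (rule boundedI)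
    fix x assume "x \<in> {x. \<rho> x \<noteq> 0}"
    then show "norm x \<le> d" using \<rho>(3)[of x] by (cases "d \<le> norm x") auto
  qed
  show thesis
  proof (rule that[of "conv \<psi> \<rho>"])
    show "Ck k (conv \<psi> \<rho>)" for k by (rule Ck_conv[OF c b \<rho>(1)])
    show "\<exists>y. \<psi> y \<noteq> 0 \<and> dist x y < e" if "conv \<psi> \<rho> x \<noteq> 0" for x
    proof (rule ccontr)
      assume neg: "\<not> ?thesis"
      have "\<psi> y * \<rho> (x - y) = 0" for y
      proof (cases "\<psi> y = 0")
        case False
        then have "e \<le> dist x y" using neg not_le by blast
        then have "d \<le> norm (x - y)" unfolding dist_norm d_def by simp
        then show ?thesis using \<rho>(3) by simp
      qed simp
      then have "(\<lambda>y. \<psi> y * \<rho> (x - y)) = (\<lambda>y. 0)" by blast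
      then have "conv \<psi> \<rho> x = 0" unfolding conv_def by simp
      with that show False by simp
    qed
    show "\<bar>conv \<psi> \<rho> x - \<psi> x\<bar> \<le> e" for x
    proof (rule conv_approx[OF c b \<rho>(2-5) c\<rho>])
      fix y :: 'a assume "norm y < d"
      then have "norm y < d1" by (simp add: d_def)
      from d1(2)[OF this, of x] show "\<bar>\<psi> (x - y) - \<psi> x\<bar> \<le> e" by simp
    qed
    show "norm (grad (conv \<psi> \<rho>) x - grad \<psi> x) \<le> e" for x
    proof -
      \<comment> \<open>Exchanging the factors puts the derivative on \<open>\<psi>\<close>: the
        gradient of the mollified function is the mollified gradient.\<close>
      have "(conv \<rho> \<psi> has_derivative (\<lambda>u. conv \<rho> (\<lambda>y. grad \<psi> y \<bullet> u) x)) (at x)"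
        by (rule conv_has_derivative[OF c\<rho> b\<rho>]) (use \<psi>(1)[unfolded Ck_1_iff] in simp_all)
      moreover have "conv \<rho> \<psi> = conv \<psi> \<rho>" by (rule ext) (rule conv_commute)
      moreover have "conv \<rho> (\<lambda>y. grad \<psi> y \<bullet> u) x = conv (\<lambda>y. grad \<psi> y \<bullet> u) \<rho> x" for u
        by (rule conv_commute)
      ultimately have D: "(conv \<psi> \<rho> has_derivative (\<lambda>u. conv (\<lambda>y. grad \<psi> y \<bullet> u) \<rho> x)) (at x)"
        by (simp only:)
      have comp: "\<bar>(grad (conv \<psi> \<rho>) x - grad \<psi> x) \<bullet> i\<bar> \<le> e / n" if i: "i \<in> Basis" for i
      proof -
        have "grad (conv \<psi> \<rho>) x \<bullet> i = conv (\<lambda>y. grad \<psi> y \<bullet> i) \<rho> x"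
          unfolding frechet_derivative_Basis_eq_grad[OF i, of "conv \<psi> \<rho>" x, symmetric]
            frechet_derivative_at[OF D, symmetric] ..
        moreover have "\<bar>conv (\<lambda>y. grad \<psi> y \<bullet> i) \<rho> x - grad \<psi> x \<bullet> i\<bar> \<le> e / n"
        proof (rule conv_approx[OF _ _ \<rho>(2-5) c\<rho>])
          show "continuous_on UNIV (\<lambda>y. grad \<psi> y \<bullet> i)" by (intro continuous_intros cg)
          show "bounded {x. grad \<psi> x \<bullet> i \<noteq> 0}" by (rule bounded_subset[OF bg]) auto
          fix y :: 'a assume "norm y < d"
          then have "norm (grad \<psi> (x - y) - grad \<psi> x) < e / n" using d2(2) by (simp add: d_def)
          then show "\<bar>grad \<psi> (x - y) \<bullet> i - grad \<psi> x \<bullet> i\<bar> \<le> e / n"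
            using Basis_le_norm[OF i, of "grad \<psi> (x - y) - grad \<psi> x"] by (simp add: inner_diff_left)
        qed auto
        ultimately show ?thesis by (simp add: inner_diff_left)
      qed
      have "norm (grad (conv \<psi> \<rho>) x - grad \<psi> x) \<le> (\<Sum>i\<in>Basis. \<bar>(grad (conv \<psi> \<rho>) x - grad \<psi> x) \<bullet> i\<bar>)"
        by (rule norm_le_l1)
      also have "\<dots> \<le> (\<Sum>i\<in>(Basis::'a set). e / n)" by (intro sum_mono comp)
      also have "\<dots> = e" using n by (simp add: n_def)
      finally show ?thesis .
    qed
  qed
qed

section \<open>Bump functions for a compact set in an open set\<close>

lemma C1_bump:
  fixes K U :: "'a::euclidean_space set"
  assumes K: "compact K" and U: "open U" "K \<subseteq> U"
  obtains \<phi> :: "'a \<Rightarrow> real" where "Ck 1 \<phi>" "compact (supp \<phi>)" "supp \<phi> \<subseteq> U"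
    "\<And>x. 0 \<le> \<phi> x" "\<And>x. \<phi> x \<le> 1" "\<And>x. x \<in> K \<Longrightarrow> \<phi> x = 1"
proof -
  obtain e where e: "e > 0" "(\<Union>x\<in>K. cball x e) \<subseteq> U"
    using compact_subset_open_imp_cball_epsilon_subset[OF K U] by blast
  define d where "d = e / 4"
  have d: "d > 0" using e by (simp add: d_def)
  \<comment> \<open>A Lipschitz profile, 1 up to distance \<open>2 * d\<close> from \<open>K\<close>
    and 0 beyond \<open>3 * d\<close>; mollifying at scale \<open>d\<close> keeps the value 1 on
    \<open>K\<close> and the support within \<open>4 * d = e\<close>. Empty \<open>K\<close> is
    singled out because \<open>infdist x {}\<close> is 0, which would give the constant 1.\<close>
  define f where "f = (\<lambda>x. if K = {} then 0 else max 0 (min 1 (3 - infdist x K / d)) :: real)"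
  have cf: "continuous_on UNIV f" unfolding f_def using d by (cases "K = {}") (auto intro!: continuous_intros)
  have f01: "0 \<le> f x" "f x \<le> 1" for x by (auto simp: f_def)
  have fK: "f x = 1" if "y \<in> K" "dist x y \<le> 2 * d" for x y
  proof -
    have "infdist x K \<le> 2 * d" using infdist_le2[OF that] .
    then show ?thesis using that d by (auto simp: f_def field_simps)
  qed
  have fz: "\<exists>y\<in>K. dist x y < 3 * d" if "f x \<noteq> 0" for x
  proof -
    have "infdist x K < 3 * d" "K \<noteq> {}" using that d by (auto simp: f_def field_simps split: if_splits)
    moreover obtain y where "y \<in> K" "infdist x K = dist x y"
      using infdist_attains_inf[OF compact_imp_closed[OF K] \<open>K \<noteq> {}\<close>] by metis
    ultimately show ?thesis by auto
  qed
  have bf: "bounded {x. f x \<noteq> 0}"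
  proof -
    obtain R where R: "\<And>x. x \<in> K \<Longrightarrow> norm x \<le> R"
      using compact_imp_bounded[OF K] by (auto simp: bounded_iff)
    show ?thesis
    proof (rule boundedI[of _ "R + 3 * d"])
      fix x assume "x \<in> {x. f x \<noteq> 0}"
      then obtain y where "y \<in> K" "dist x y < 3 * d" using fz by blast
      then show "norm x \<le> R + 3 * d" using R[of y] norm_triangle_ineq[of "x - y" y]
        by (simp add: dist_norm)
    qed
  qed
  obtain \<rho> :: "'a \<Rightarrow> real" where \<rho>: "\<And>k. Ck k \<rho>" "\<And>x. 0 \<le> \<rho> x"
    "\<And>x. d \<le> norm x \<Longrightarrow> \<rho> x = 0" "integrable lborel \<rho>" "(LINT x|lborel. \<rho> x) = 1"
    by (rule mollifier_exists[OF d]) (rule that)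
  have c\<rho>: "continuous_on UNIV \<rho>" using \<rho>(1)[of 0] by simp
  have s: "{x. conv f \<rho> x \<noteq> 0} \<subseteq> (\<Union>x\<in>K. cball x e)"
  proof
    fix x assume x: "x \<in> {x. conv f \<rho> x \<noteq> 0}"
    have "\<exists>y. f y * \<rho> (x - y) \<noteq> 0"
    proof (rule ccontr)
      assume "\<not> ?thesis"
      then have "(\<lambda>y. f y * \<rho> (x - y)) = (\<lambda>y. 0)" by blast
      then show False using x unfolding conv_def by simp
    qed
    then obtain y where y: "f y \<noteq> 0" "\<rho> (x - y) \<noteq> 0" by auto
    then have "dist x y < d" using \<rho>(3)[of "x - y"] by (force simp: dist_norm)
    moreover obtain z where "z \<in> K" "dist y z < 3 * d" using fz[OF y(1)] by blast
    ultimately have "dist x z \<le> e" using dist_triangle[of x z y] by (simp add: d_def)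
    then show "x \<in> (\<Union>x\<in>K. cball x e)" using \<open>z \<in> K\<close> by (auto simp: dist_commute)
  qed
  have cK: "compact (\<Union>x\<in>K. cball x e)"
  proof -
    have "z \<in> (\<Union>x\<in>K. cball x e) \<longleftrightarrow> (\<exists>x y. z = x + y \<and> x \<in> K \<and> y \<in> cball 0 e)" for z
    proof
      assume "z \<in> (\<Union>x\<in>K. cball x e)"
      then obtain x where "x \<in> K" "dist x z \<le> e" by auto
      then show "\<exists>x y. z = x + y \<and> x \<in> K \<and> y \<in> cball 0 e"
        by (intro exI[of _ x] exI[of _ "z - x"]) (auto simp: dist_norm norm_minus_commute)
    next
      assume "\<exists>x y. z = x + y \<and> x \<in> K \<and> y \<in> cball 0 e"
      then obtain x y where "z = x + y" "x \<in> K" "norm y \<le> e" by auto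
      then show "z \<in> (\<Union>x\<in>K. cball x e)" by (intro UN_I[of x]) (auto simp: dist_norm)
    qed
    then have "(\<Union>x\<in>K. cball x e) = {x + y |x y. x \<in> K \<and> y \<in> cball 0 e}" by blast
    then show ?thesis using compact_sums[OF K compact_cball[of 0 e]] by simp
  qed
  have sub: "supp (conv f \<rho>) \<subseteq> (\<Union>x\<in>K. cball x e)"
    unfolding supp_def by (rule closure_minimal[OF s compact_imp_closed[OF cK]])
  show thesis
  proof (rule that[of "conv f \<rho>"])
    show "Ck 1 (conv f \<rho>)" by (rule Ck_conv[OF cf bf \<rho>(1)])
    show "compact (supp (conv f \<rho>))"
      unfolding bounded_supp_iff by (rule bounded_subset[OF compact_imp_bounded[OF cK] s])
    show "supp (conv f \<rho>) \<subseteq> U" using sub e by blast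
    \<comment> \<open>The midpoint as reference value turns the range between 0 and 1 into a single
      approximation estimate.\<close>
    have "\<bar>conv f \<rho> x - 1/2\<bar> \<le> 1/2" for x
      by (rule conv_approx[OF cf bf \<rho>(2-5) c\<rho>]) (use f01 in \<open>auto simp: abs_le_iff field_simps\<close>)
    then have "0 \<le> conv f \<rho> x \<and> conv f \<rho> x \<le> 1" for x
      by (smt (verit, best) field_sum_of_halves)
    then show "0 \<le> conv f \<rho> x" "conv f \<rho> x \<le> 1" for x by blast+
    show "conv f \<rho> x = 1" if "x \<in> K" for x
    proof -
      \<comment> \<open>Error 0, because \<open>f\<close> is identically 1 on the ball of radius
        \<open>d\<close> over which it is averaged.\<close>
      have "\<bar>conv f \<rho> x - 1\<bar> \<le> 0"
        by (rule conv_approx[OF cf bf \<rho>(2-5) c\<rho>])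
           (use that d in \<open>auto simp: fK dist_norm\<close>)
      then show ?thesis by simp
    qed
  qed
qed

section \<open>Hausdorff measure\<close>

text \<open>The empty set costs 0 even for \<open>s = 0\<close>, where \<open>0 ^ 0 = 1\<close>; so
  covers may be padded with empty sets.\<close>

definition diam_gauge :: "nat \<Rightarrow> 'a::euclidean_space set \<Rightarrow> ennreal" where
  "diam_gauge s C = (if C = {} then 0 else ennreal (unit_ball_vol (real s) * (diameter C / 2) ^ s))"

definition fine_covers :: "real \<Rightarrow> 'a::euclidean_space set \<Rightarrow> (nat \<Rightarrow> 'a set) set" where
  "fine_covers e A = {C. A \<subseteq> (\<Union>j. C j) \<and> (\<forall>j. bounded (C j) \<and> diameter (C j) \<le> e)}"

lemma hausdorff_content_eq: "hausdorff_content s e A = (INF C\<in>fine_covers e A. \<Sum>j. diam_gauge s (C j))"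
  unfolding hausdorff_content_def diam_gauge_def fine_covers_def ..

lemma hausdorff_content_mono: "A \<subseteq> B \<Longrightarrow> hausdorff_content s e A \<le> hausdorff_content s e B"
  unfolding hausdorff_content_eq by (rule INF_superset_mono) (auto simp: fine_covers_def)

lemma hausdorff_content_antimono: "e \<le> e' \<Longrightarrow> hausdorff_content s e' A \<le> hausdorff_content s e A"
  unfolding hausdorff_content_eq
  by (rule INF_superset_mono) (auto simp: fine_covers_def intro: order_trans)

lemma hausdorff_content_le: "C \<in> fine_covers e A \<Longrightarrow> hausdorff_content s e A \<le> (\<Sum>j. diam_gauge s (C j))"
  unfolding hausdorff_content_eq by (rule INF_lower)

lemma hausdorff_content_empty: "0 < e \<Longrightarrow> hausdorff_content s e {} = 0"
  using hausdorff_content_le[of "\<lambda>_. {}" e "{}" s] by (simp add: fine_covers_def diam_gauge_def)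

text \<open>Near-optimal covers with errors \<open>r * (1/2) ^ Suc i\<close> are merged into one
  sequence along \<open>prod_decode\<close>; the errors add up to \<open>r\<close>.\<close>

lemma hausdorff_content_countably_subadditive:
  "hausdorff_content s e (\<Union>i. A i) \<le> (\<Sum>i::nat. hausdorff_content s e (A i))"
proof (rule ennreal_le_epsilon)
  fix r :: real assume fin: "(\<Sum>i. hausdorff_content s e (A i)) < top" and r: "0 < r"
  have "\<exists>C\<in>fine_covers e (A i). (\<Sum>j. diam_gauge s (C j)) \<le> hausdorff_content s e (A i) + ennreal (r * (1/2) ^ Suc i)" for i
  proof -
    have "hausdorff_content s e (A i) < top"
      by (rule ennreal_suminf_lessD[OF fin])
    then have "hausdorff_content s e (A i) < hausdorff_content s e (A i) + ennreal (r * (1/2) ^ Suc i)"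
      using r by (auto simp: ennreal_add_left_cancel_less less_top[symmetric])
    then show ?thesis
      unfolding hausdorff_content_eq[of s e "A i"] INF_less_iff by (auto intro!: bexI less_imp_le)
  qed
  then obtain C where C: "\<And>i. C i \<in> fine_covers e (A i)"
    "\<And>i. (\<Sum>j. diam_gauge s (C i j)) \<le> hausdorff_content s e (A i) + ennreal (r * (1/2) ^ Suc i)"
    by metis
  define D where "D = (\<lambda>n. case prod_decode n of (i, j) \<Rightarrow> C i j)"
  have D: "D \<in> fine_covers e (\<Union>i. A i)"
    unfolding fine_covers_def
  proof (intro CollectI conjI allI subsetI)
    fix x assume "x \<in> (\<Union>i. A i)"
    then obtain i where "x \<in> A i" by blast
    then obtain j where "x \<in> C i j" using C(1)[of i] by (auto simp: fine_covers_def)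
    then show "x \<in> (\<Union>j. D j)"
      by (intro UN_I[of "prod_encode (i, j)"]) (auto simp: D_def)
  next
    fix n
    obtain i j where "prod_decode n = (i, j)" by force
    then show "bounded (D n)" "diameter (D n) \<le> e" using C(1)[of i] by (auto simp: D_def fine_covers_def)
  qed
  have "hausdorff_content s e (\<Union>i. A i) \<le> (\<Sum>n. diam_gauge s (D n))"
    by (rule hausdorff_content_le[OF D])
  also have "\<dots> = (\<Sum>n. case prod_decode n of (i, j) \<Rightarrow> diam_gauge s (C i j))"
    by (intro suminf_cong) (auto simp: D_def split: prod.splits)
  also have "\<dots> = (\<Sum>i. \<Sum>j. diam_gauge s (C i j))"
    using suminf_ennreal_2dimen[of "\<lambda>i. \<Sum>j. diam_gauge s (C i j)" "\<lambda>(i, j). diam_gauge s (C i j)"]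
    by (simp add: comp_def)
  also have "\<dots> \<le> (\<Sum>i. hausdorff_content s e (A i) + ennreal (r * (1/2) ^ Suc i))"
    by (intro suminf_le C) auto
  also have "\<dots> = (\<Sum>i. hausdorff_content s e (A i)) + (\<Sum>i. ennreal (r * (1/2) ^ Suc i))"
    by (intro suminf_add[symmetric]) auto
  also have "(\<Sum>i. ennreal (r * (1/2) ^ Suc i)) = ennreal r"
  proof -
    have "(\<lambda>i. r * (1/2) ^ Suc i) sums (r * 1)"
      by (intro sums_mult power_half_series)
    then show ?thesis using r by (intro sums_unique[symmetric] sums_ennreal[THEN iffD2]) auto
  qed
  finally show "hausdorff_content s e (\<Union>i. A i) \<le> (\<Sum>i. hausdorff_content s e (A i)) + ennreal r" .
qed

lemma hausdorff_content_le_outer: "0 < e \<Longrightarrow> hausdorff_content s e A \<le> hausdorff_outer s A"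
  unfolding hausdorff_outer_def by (rule SUP_upper) auto

lemma hausdorff_outer_mono: "A \<subseteq> B \<Longrightarrow> hausdorff_outer s A \<le> hausdorff_outer s B"
  unfolding hausdorff_outer_def by (intro SUP_subset_mono order_refl hausdorff_content_mono)

lemma hausdorff_outer_countably_subadditive:
  "hausdorff_outer s (\<Union>i. A i) \<le> (\<Sum>i::nat. hausdorff_outer s (A i))"
  unfolding hausdorff_outer_def[of s "\<Union>i. A i"]
proof (rule SUP_least)
  fix e :: real assume "e \<in> {0<..}"
  then have "(\<Sum>i. hausdorff_content s e (A i)) \<le> (\<Sum>i. hausdorff_outer s (A i))"
    by (intro suminf_le hausdorff_content_le_outer) auto
  with hausdorff_content_countably_subadditive
  show "hausdorff_content s e (\<Union>i. A i) \<le> (\<Sum>i. hausdorff_outer s (A i))"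
    by (rule order_trans)
qed

lemma hausdorff_outer_space: "outer_measure_space UNIV (hausdorff_outer s)"
proof -
  have "hausdorff_outer s {} = 0"
    unfolding hausdorff_outer_def by (simp add: hausdorff_content_empty cong: SUP_cong_simp)
  then show ?thesis
    by (simp add: outer_measure_space_def positive_def increasing_def countably_subadditive_def
        hausdorff_outer_mono hausdorff_outer_countably_subadditive)
qed

section \<open>Separated sets and the Caratheodory criterion\<close>

text \<open>A covering set of diameter at most \<open>e < d\<close> cannot meet both
  \<open>A\<close> and \<open>B\<close>, so every cover of the union splits into one of
  each.\<close>

lemma hausdorff_content_separated:
  assumes "e < d" and sep: "\<And>x y. x \<in> A \<Longrightarrow> y \<in> B \<Longrightarrow> d \<le> dist x y"
  shows "hausdorff_content s e A + hausdorff_content s e B \<le> hausdorff_content s e (A \<union> B)"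
  unfolding hausdorff_content_eq[of s e "A \<union> B"]
proof (rule INF_greatest)
  fix C assume C: "C \<in> fine_covers e (A \<union> B)"
  define C1 where "C1 = (\<lambda>j::nat. if C j \<inter> A \<noteq> {} then C j else {})"
  define C2 where "C2 = (\<lambda>j::nat. if C j \<inter> A = {} then C j else {})"
  have e: "0 \<le> e"
  proof -
    have "diameter (C 0) \<le> e" "bounded (C 0)" using C by (auto simp: fine_covers_def)
    then show ?thesis using diameter_ge_0 by fastforce
  qed
  have C1: "C1 \<in> fine_covers e A"
    unfolding fine_covers_def
  proof (intro CollectI conjI allI subsetI)
    fix x assume x: "x \<in> A"
    then obtain j where "x \<in> C j" using C by (auto simp: fine_covers_def)
    then show "x \<in> (\<Union>j. C1 j)" using x by (intro UN_I[of j]) (auto simp: C1_def)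
  qed (use C e in \<open>auto simp: fine_covers_def C1_def\<close>)
  have C2: "C2 \<in> fine_covers e B"
    unfolding fine_covers_def
  proof (intro CollectI conjI allI subsetI)
    fix y assume y: "y \<in> B"
    then obtain j where j: "y \<in> C j" using C by (auto simp: fine_covers_def)
    have "C j \<inter> A = {}"
    proof (rule ccontr)
      assume "C j \<inter> A \<noteq> {}"
      then obtain x where x: "x \<in> C j" "x \<in> A" by blast
      have b: "bounded (C j)" "diameter (C j) \<le> e" using C by (auto simp: fine_covers_def)
      then have "dist x y \<le> e" using diameter_bounded_bound[OF b(1) x(1) j] by simp
      then show False using sep[OF x(2) y] assms(1) by simp
    qed
    then show "y \<in> (\<Union>j. C2 j)" using j by (auto simp: C2_def)
  qed (use C e in \<open>auto simp: fine_covers_def C2_def\<close>)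
  have "hausdorff_content s e A + hausdorff_content s e B \<le> (\<Sum>j. diam_gauge s (C1 j)) + (\<Sum>j. diam_gauge s (C2 j))"
    by (intro add_mono hausdorff_content_le C1 C2)
  also have "\<dots> = (\<Sum>j. diam_gauge s (C1 j) + diam_gauge s (C2 j))"
    by (intro suminf_add) auto
  also have "\<dots> = (\<Sum>j. diam_gauge s (C j))"
    by (intro suminf_cong) (auto simp: C1_def C2_def diam_gauge_def)
  finally show "hausdorff_content s e A + hausdorff_content s e B \<le> (\<Sum>j. diam_gauge s (C j))" .
qed

text \<open>Contents only grow as the scale shrinks, so two different scales may be replaced by a
  common one below \<open>d\<close>, where splitting of covers applies.\<close>

lemma hausdorff_outer_separated:
  assumes "0 < d" and sep: "\<And>x y. x \<in> A \<Longrightarrow> y \<in> B \<Longrightarrow> d \<le> dist x y"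
  shows "hausdorff_outer s A + hausdorff_outer s B \<le> hausdorff_outer s (A \<union> B)"
proof -
  have *: "hausdorff_content s e A + hausdorff_content s e' B \<le> hausdorff_outer s (A \<union> B)"
    if "0 < e" "0 < e'" for e e'
  proof -
    define m where "m = min (d / 2) (min e e')"
    have m: "0 < m" "m < d" "m \<le> e" "m \<le> e'" using assms that by (auto simp: m_def)
    have "hausdorff_content s e A + hausdorff_content s e' B \<le> hausdorff_content s m A + hausdorff_content s m B"
      by (intro add_mono hausdorff_content_antimono m)
    also have "\<dots> \<le> hausdorff_content s m (A \<union> B)"
      by (rule hausdorff_content_separated[OF m(2) sep])
    also have "\<dots> \<le> hausdorff_outer s (A \<union> B)" by (rule hausdorff_content_le_outer[OF m(1)])
    finally show ?thesis .
  qed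
  have "{0<..} \<noteq> ({}::real set)" by (metis empty_iff greaterThan_iff zero_less_one)
  note S = ennreal_SUP_add_left[OF this] ennreal_SUP_add_right[OF this]
  have S2: "c + (SUP e'\<in>{0<..}. hausdorff_content s e' B) = (SUP e'\<in>{0<..}. c + hausdorff_content s e' B)" for c
    using S(2)[of c "\<lambda>e'. hausdorff_content s e' B"] by (simp add: add.commute)
  have "hausdorff_outer s A + hausdorff_outer s B =
      (SUP e\<in>{0<..}. hausdorff_content s e A + (SUP e'\<in>{0<..}. hausdorff_content s e' B))"
    unfolding hausdorff_outer_def by (rule S(1)[symmetric])
  also have "\<dots> = (SUP e\<in>{0<..}. SUP e'\<in>{0<..}. hausdorff_content s e A + hausdorff_content s e' B)"
    unfolding S2 ..
  also have "\<dots> \<le> hausdorff_outer s (A \<union> B)"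
    by (intro SUP_least) (use * in auto)
  finally show ?thesis .
qed

text \<open>The sets \<open>R i\<close> are every second ring around a closed set, so they are at positive distance.\<close>

lemma metric_outer_measure_ring_sum:
  fixes \<mu> :: "'a::metric_space set \<Rightarrow> ennreal" and q :: "'a \<Rightarrow> real"
  assumes sep: "\<And>A B d. 0 < d \<Longrightarrow> (\<And>x y. x \<in> A \<Longrightarrow> y \<in> B \<Longrightarrow> d \<le> dist x y) \<Longrightarrow> \<mu> A + \<mu> B \<le> \<mu> (A \<union> B)"
    and lip: "\<And>x y. q x - q y \<le> dist x y"
    and R: "\<And>i x. x \<in> R i \<Longrightarrow> lo i \<le> q x \<and> q x < hi i"
    and dec: "\<And>i. hi (Suc i) < lo i" and lo: "decseq lo" and z: "\<mu> {} = 0"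
  shows "(\<Sum>i<n. \<mu> (R i)) \<le> \<mu> (\<Union>i<n. R i)"
proof (induction n)
  case 0 then show ?case by (simp add: z)
next
  case (Suc n)
  show ?case
  proof (cases n)
    case 0 then show ?thesis by (simp add: lessThan_Suc)
  next
    case (Suc m)
    have "(\<Sum>i<n. \<mu> (R i)) + \<mu> (R n) \<le> \<mu> (\<Union>i<n. R i) + \<mu> (R n)"
      by (intro add_right_mono Suc.IH)
    also have "\<dots> \<le> \<mu> ((\<Union>i<n. R i) \<union> R n)"
    proof (rule sep[of "lo m - hi n"])
      show "0 < lo m - hi n" using dec[of m] Suc by simp
      fix x y assume x: "x \<in> (\<Union>i<n. R i)" and y: "y \<in> R n"
      then obtain i where i: "i \<le> m" "x \<in> R i" using Suc by (auto simp: less_Suc_eq_le)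
      have "lo m \<le> lo i" using lo i(1) by (rule decseqD)
      then show "lo m - hi n \<le> dist x y" using R[OF i(2)] R[OF y] lip[of x y] by linarith
    qed
    also have "(\<Union>i<n. R i) \<union> R n = (\<Union>i<Suc n. R i)" by (auto simp: less_Suc_eq)
    finally show ?thesis by simp
  qed
qed

text \<open>The part \<open>A' k\<close> of \<open>A\<close> has positive distance from
  \<open>F\<close>, so additivity holds for it. What is missing from \<open>A - F\<close> is a union
  of rings around \<open>F\<close>, and their measures form a convergent series, whose tail is
  negligible.\<close>

lemma metric_outer_measure_closed:
  fixes \<mu> :: "'a::metric_space set \<Rightarrow> ennreal"
  assumes oms: "outer_measure_space UNIV \<mu>"
    and sep: "\<And>A B d. 0 < d \<Longrightarrow> (\<And>x y. x \<in> A \<Longrightarrow> y \<in> B \<Longrightarrow> d \<le> dist x y) \<Longrightarrow> \<mu> A + \<mu> B \<le> \<mu> (A \<union> B)"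
    and F: "closed F"
  shows "\<mu> (F \<inter> A) + \<mu> (A - F) \<le> \<mu> A"
proof (cases "F = {} \<or> \<mu> A = \<infinity>")
  case True
  then show ?thesis using oms by (auto simp: outer_measure_space_def positive_def)
next
  case False
  then have Fn: "F \<noteq> {}" and fin: "\<mu> A < top" by (auto simp: less_top)
  have mono: "X \<subseteq> Y \<Longrightarrow> \<mu> X \<le> \<mu> Y" for X Y using oms by (auto simp: outer_measure_space_def increasing_def)
  have csub: "\<mu> (\<Union>i. X i) \<le> (\<Sum>i. \<mu> (X i))" for X :: "nat \<Rightarrow> 'a set"
  proof -
    \<comment> \<open>Countable subadditivity is formulated for disjoint families; disjointing the
      sets and monotonicity give it in general.\<close>
    have "countably_subadditive UNIV \<mu>" using oms by (simp add: outer_measure_space_def)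
    then have "\<mu> (\<Union>i. disjointed X i) \<le> (\<Sum>i. \<mu> (disjointed X i))"
      unfolding countably_subadditive_def using disjoint_family_disjointed[of X] by simp
    also have "\<dots> \<le> (\<Sum>i. \<mu> (X i))"
      by (intro suminf_le mono disjointed_subset) auto
    finally show ?thesis by (simp add: UN_disjointed_eq)
  qed
  define q where "q = (\<lambda>x. infdist x F)"
  have lip: "q x - q y \<le> dist x y" for x y
    using infdist_triangle[of x F y] by (simp add: q_def)
  define A' where "A' = (\<lambda>k::nat. {x \<in> A. 1 / (real k + 1) \<le> q x})"
  define R where "R = (\<lambda>i::nat. {x \<in> A. 1 / (real i + 2) \<le> q x \<and> q x < 1 / (real i + 1)})"
  have near: "\<mu> (F \<inter> A) + \<mu> (A' k) \<le> \<mu> A" for k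
  proof -
    have "\<mu> (F \<inter> A) + \<mu> (A' k) \<le> \<mu> (F \<inter> A \<union> A' k)"
    proof (rule sep[of "1 / (real k + 1)"])
      fix x y assume xy: "x \<in> F \<inter> A" "y \<in> A' k"
      then have "infdist y F \<le> dist y x" by (intro infdist_le) simp
      then show "1 / (real k + 1) \<le> dist x y"
        using xy(2) by (simp add: A'_def q_def dist_commute)
    qed simp
    also have "\<dots> \<le> \<mu> A" by (rule mono) (auto simp: A'_def)
    finally show ?thesis .
  qed
  have even: "(\<Sum>i<n. \<mu> (R (2 * i))) \<le> \<mu> A" for n
  proof -
    have "(\<Sum>i<n. \<mu> (R (2 * i))) \<le> \<mu> (\<Union>i<n. R (2 * i))"
    proof (rule metric_outer_measure_ring_sum[of \<mu> q _ "\<lambda>i. 1 / (2 * real i + 2)" "\<lambda>i. 1 / (2 * real i + 1)"])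
      show "decseq (\<lambda>i. 1 / (2 * real i + 2))"
        unfolding decseq_def by (intro allI impI divide_left_mono) auto
      show "1 / (2 * real (Suc i) + 1) < 1 / (2 * real i + 2)" for i
        by (rule divide_strict_left_mono) auto
      show "1 / (2 * real i + 2) \<le> q x \<and> q x < 1 / (2 * real i + 1)" if "x \<in> R (2 * i)" for i x
        using that by (simp add: R_def add_ac)
      show "\<mu> {} = 0" using oms by (simp add: outer_measure_space_def positive_def)
    qed (fact sep lip)+
    also have "\<dots> \<le> \<mu> A" by (rule mono) (auto simp: R_def)
    finally show ?thesis .
  qed
  have odd: "(\<Sum>i<n. \<mu> (R (2 * i + 1))) \<le> \<mu> A" for n
  proof -
    have "(\<Sum>i<n. \<mu> (R (2 * i + 1))) \<le> \<mu> (\<Union>i<n. R (2 * i + 1))"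
    proof (rule metric_outer_measure_ring_sum[of \<mu> q _ "\<lambda>i. 1 / (2 * real i + 3)" "\<lambda>i. 1 / (2 * real i + 2)"])
      show "decseq (\<lambda>i. 1 / (2 * real i + 3))"
        unfolding decseq_def by (intro allI impI divide_left_mono) auto
      show "1 / (2 * real (Suc i) + 2) < 1 / (2 * real i + 3)" for i
        by (rule divide_strict_left_mono) auto
      show "1 / (2 * real i + 3) \<le> q x \<and> q x < 1 / (2 * real i + 2)" if "x \<in> R (2 * i + 1)" for i x
        using that by (simp add: R_def add_ac)
      show "\<mu> {} = 0" using oms by (simp add: outer_measure_space_def positive_def)
    qed (fact sep lip)+
    also have "\<dots> \<le> \<mu> A" by (rule mono) (auto simp: R_def)
    finally show ?thesis .
  qed
  \<comment> \<open>Consecutive rings need not be at positive distance, so even and odd ones are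
    summed apart, each family costing at most the measure of \<open>A\<close>.\<close>
  have "(\<Sum>i<n. \<mu> (R i)) \<le> \<mu> A + \<mu> A" for n
  proof -
    have "(\<Sum>i<n. \<mu> (R i)) \<le> (\<Sum>i<2*n. \<mu> (R i))"
      by (intro sum_mono2) auto
    also have "\<dots> = (\<Sum>i<n. \<mu> (R (2 * i))) + (\<Sum>i<n. \<mu> (R (2 * i + 1)))"
      by (induction n) (simp_all add: add_ac)
    also have "\<dots> \<le> \<mu> A + \<mu> A" by (intro add_mono even odd)
    finally show ?thesis .
  qed
  then have "(\<Sum>i. \<mu> (R i)) \<le> \<mu> A + \<mu> A"
    unfolding suminf_eq_SUP by (intro SUP_least)
  then have "(\<Sum>i. \<mu> (R i)) \<noteq> top"
    using fin by (auto simp: top_unique)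
  have Rfin: "\<mu> (R i) < top" for i
    by (rule ennreal_suminf_lessD[of "\<lambda>i. \<mu> (R i)"])
       (use \<open>(\<Sum>i. \<mu> (R i)) \<noteq> top\<close> in \<open>simp add: less_top\<close>)
  define r where "r = (\<lambda>i. enn2real (\<mu> (R i)))"
  have r: "\<mu> (R i) = ennreal (r i)" "0 \<le> r i" for i
    using Rfin[of i] by (simp_all add: r_def)
  have sr: "summable r"
    using \<open>(\<Sum>i. \<mu> (R i)) \<noteq> top\<close> by (intro summable_suminf_not_top) (simp_all add: r)
  show ?thesis
  proof (rule ennreal_le_epsilon)
    fix e :: real assume e: "0 < e"
    obtain k where k: "norm (\<Sum>i. r (i + k)) < e" using suminf_exist_split[OF e sr] by blast
    have tail: "(\<Sum>i. \<mu> (R (i + k))) \<le> ennreal e"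
    proof -
      have "(\<Sum>i. \<mu> (R (i + k))) = ennreal (\<Sum>i. r (i + k))"
        unfolding r by (intro suminf_ennreal2 r summable_ignore_initial_segment sr)
      then show ?thesis using k by (auto intro!: ennreal_leI)
    qed
    \<comment> \<open>Cover of \<open>A - F\<close> by its far part and the rings closer to
      \<open>F\<close>, of total measure at most \<open>e\<close>.\<close>
    define X where "X = (\<lambda>i. case i of 0 \<Rightarrow> A' k | Suc i \<Rightarrow> R (i + k))"
    have "A - F \<subseteq> (\<Union>i. X i)"
    proof
      fix x assume x: "x \<in> A - F"
      then have qx: "0 < q x" unfolding q_def using infdist_pos_not_in_closed[OF F Fn] by blast
      define P where "P = (\<lambda>j::nat. 1 / (real j + 1) \<le> q x)"
      obtain j0 where "inverse (real (Suc j0)) < q x" using reals_Archimedean[OF qx] by blast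
      then have "P j0" by (simp add: P_def inverse_eq_divide add.commute)
      then have "\<exists>j. P j" by (rule exI)
      then have P: "P (LEAST j. P j)" by (rule LeastI_ex)
      show "x \<in> (\<Union>i. X i)"
      proof (cases "P k")
        case True
        then show ?thesis using x by (intro UN_I[of 0]) (auto simp: X_def A'_def P_def)
      next
        case False
        \<comment> \<open>The first threshold that \<open>q x\<close> reaches lies beyond
          \<open>k\<close>, and \<open>x\<close> belongs to the ring numbered one less.\<close>
        define j where "j = (LEAST j. P j)"
        have "k < j"
        proof (rule ccontr)
          assume "\<not> k < j"
          then have "1 / (real k + 1) \<le> 1 / (real j + 1)" by (intro divide_left_mono) auto
          then show False using False P by (simp add: P_def j_def)
        qed
        define i where "i = j - k - 1"
        have i: "j = Suc (i + k)" using \<open>k < j\<close> by (simp add: i_def)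
        have "\<not> P (i + k)" using not_less_Least[of "i + k" P] i by (simp add: j_def)
        moreover have "P (Suc (i + k))" using P i by (simp add: j_def)
        ultimately have "x \<in> R (i + k)" using x by (auto simp: P_def R_def algebra_simps)
        then show ?thesis by (intro UN_I[of "Suc i"]) (auto simp: X_def)
      qed
    qed
    then have "\<mu> (A - F) \<le> (\<Sum>i. \<mu> (X i))" by (rule order_trans[OF mono csub])
    also have "\<dots> = (\<Sum>i. \<mu> (X (i + 1))) + (\<Sum>i<1. \<mu> (X i))" by (rule suminf_offset) simp
    also have "\<dots> = \<mu> (A' k) + (\<Sum>i. \<mu> (R (i + k)))" by (simp add: X_def add.commute)
    finally have "\<mu> (F \<inter> A) + \<mu> (A - F) \<le> \<mu> (F \<inter> A) + (\<mu> (A' k) + (\<Sum>i. \<mu> (R (i + k))))"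
      by (rule add_left_mono)
    also have "\<dots> = (\<mu> (F \<inter> A) + \<mu> (A' k)) + (\<Sum>i. \<mu> (R (i + k)))" by (simp add: add.assoc)
    also have "\<dots> \<le> \<mu> A + ennreal e" by (intro add_mono near tail)
    finally show "\<mu> (F \<inter> A) + \<mu> (A - F) \<le> \<mu> A + ennreal e" .
  qed
qed

text \<open>Closed sets satisfy the Caratheodory splitting condition and generate the Borel sets, so
  the measure on the lambda system restricts to them.\<close>

lemma hausdorff_measure_space: "measure_space UNIV (sets borel) (hausdorff_outer s :: 'a::euclidean_space set \<Rightarrow> ennreal)"
proof -
  interpret sigma_algebra UNIV "UNIV :: 'a set set"
    using sigma_algebra_Pow[of "UNIV :: 'a set"] by simp
  let ?L = "lambda_system UNIV UNIV (hausdorff_outer s) :: 'a set set"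
  have m: "measure_space UNIV ?L (hausdorff_outer s)"
    by (rule caratheodory_lemma[OF hausdorff_outer_space])
  then interpret L: sigma_algebra UNIV ?L by (simp add: measure_space_def)
  have "F \<in> ?L" if F: "closed F" for F
  proof -
    have "hausdorff_outer s (F \<inter> A) + hausdorff_outer s ((UNIV - F) \<inter> A) = hausdorff_outer s A" for A
    proof (rule antisym)
      have "(UNIV - F) \<inter> A = A - F" by blast
      then show "hausdorff_outer s (F \<inter> A) + hausdorff_outer s ((UNIV - F) \<inter> A) \<le> hausdorff_outer s A"
        using metric_outer_measure_closed[OF hausdorff_outer_space hausdorff_outer_separated F, where A = A] by simp
      \<comment> \<open>Subadditivity for two sets, from the countable version by padding with empty
        sets.\<close>
      have "hausdorff_outer s (\<Union>i. (if i = 0 then F \<inter> A else if i = Suc 0 then (UNIV - F) \<inter> A else {}))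
         \<le> (\<Sum>i. hausdorff_outer s (if i = 0 then F \<inter> A else if i = Suc 0 then (UNIV - F) \<inter> A else {}))"
        by (rule hausdorff_outer_countably_subadditive)
      also have "(\<Union>i::nat. (if i = 0 then F \<inter> A else if i = Suc 0 then (UNIV - F) \<inter> A else {})) = A"
        by (auto split: if_splits)
      also have "(\<Sum>i::nat. hausdorff_outer s (if i = 0 then F \<inter> A else if i = Suc 0 then (UNIV - F) \<inter> A else {}))
        = (\<Sum>i\<in>{0,Suc 0}. hausdorff_outer s (if i = 0 then F \<inter> A else if i = Suc 0 then (UNIV - F) \<inter> A else {}))"
        using hausdorff_outer_space[of s]
        by (intro suminf_finite) (auto simp: outer_measure_space_def positive_def)
      also have "\<dots> = hausdorff_outer s (F \<inter> A) + hausdorff_outer s ((UNIV - F) \<inter> A)" by simp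
      finally show "hausdorff_outer s A \<le> hausdorff_outer s (F \<inter> A) + hausdorff_outer s ((UNIV - F) \<inter> A)" .
    qed
    then show ?thesis by (simp add: lambda_system_def)
  qed
  then have "sigma_sets UNIV (Collect closed) \<subseteq> ?L"
    by (intro L.sigma_sets_subset) auto
  moreover have "sets borel = sigma_sets UNIV (Collect closed :: 'a set set)"
    by (subst borel_eq_closed) (simp add: sets_measure_of)
  ultimately have "sets borel \<subseteq> ?L" by simp
  moreover have "sigma_algebra UNIV (sets borel :: 'a set set)"
    using sets.sigma_algebra_axioms[of "borel :: 'a measure"] by simp
  ultimately show ?thesis using measure_down[OF m] by blast
qed

lemma sigma_algebra_UNIV_borel: "sigma_algebra UNIV (sets (borel :: 'a::topological_space measure))"
  using sets.sigma_algebra_axioms[of "borel :: 'a measure"] by simp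

lemma sets_hausdorff_measure [simp, measurable_cong]: "sets (hausdorff_measure s) = sets borel"
  unfolding hausdorff_measure_def
  by (rule sigma_algebra.sets_measure_of_eq[OF sigma_algebra_UNIV_borel])

lemma space_hausdorff_measure [simp]: "space (hausdorff_measure s) = UNIV"
  unfolding hausdorff_measure_def by (simp add: space_measure_of_conv)

text \<open>\<open>measure_of\<close> keeps the given set function only when it is a measure; this
  identity is the purpose of the Caratheodory argument.\<close>

lemma emeasure_hausdorff_measure:
  assumes "A \<in> sets borel"
  shows "emeasure (hausdorff_measure s) A = hausdorff_outer s A"
proof -
  have "emeasure (measure_of UNIV (sets borel) (hausdorff_outer s)) A = hausdorff_outer s A"
    by (rule emeasure_measure_of_sigma)
       (use hausdorff_measure_space[of s, where ?'a = 'a] assms in \<open>auto simp: measure_space_def\<close>)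
  then show ?thesis unfolding hausdorff_measure_def .
qed

text \<open>
  A set of diameter \<open>d\<close> lies in a ball of radius \<open>d\<close>. The resulting factor \<open>2 ^ DIM('m)\<close> is harmless
  here and avoids the isodiametric inequality.
\<close>

lemma emeasure_lborel_le_hausdorff_outer:
  fixes f :: "'a::euclidean_space \<Rightarrow> 'm::euclidean_space"
  assumes lip: "\<And>x y. x \<in> A \<Longrightarrow> y \<in> A \<Longrightarrow> dist (f x) (f y) \<le> dist x y"
    and B: "B \<subseteq> f ` A"
  shows "emeasure lborel B \<le> 2 ^ DIM('m) * hausdorff_outer DIM('m) A"
proof -
  let ?m = "DIM('m)"
  have "emeasure lborel B \<le> 2 ^ ?m * (\<Sum>j. diam_gauge ?m (C j))" if C: "C \<in> fine_covers 1 A" for C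
  proof -
    define c where "c = (\<lambda>j. SOME a. a \<in> C j \<inter> A)"
    \<comment> \<open>Balls are centred at images of points of \<open>A\<close>, because the
      contraction property of \<open>f\<close> is available there only.\<close>
    define D where "D = (\<lambda>j. if C j \<inter> A = {} then {} else cball (f (c j)) (diameter (C j)))"
    have c: "c j \<in> C j \<inter> A" if "C j \<inter> A \<noteq> {}" for j
      unfolding c_def using that by (metis ex_in_conv someI_ex)
    have "B \<subseteq> (\<Union>j. D j)"
    proof
      fix y assume "y \<in> B"
      then obtain x where x: "x \<in> A" "y = f x" using B by blast
      then obtain j where j: "x \<in> C j" using C by (auto simp: fine_covers_def)
      have "bounded (C j)" using C by (auto simp: fine_covers_def)
      moreover have cj: "c j \<in> C j \<inter> A" using c x j by blast
      ultimately have "dist (c j) x \<le> diameter (C j)" using diameter_bounded_bound j by blast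
      moreover have "dist (f (c j)) (f x) \<le> dist (c j) x" using lip cj x by blast
      ultimately show "y \<in> (\<Union>j. D j)" using x j by (intro UN_I[of j]) (auto simp: D_def)
    qed
    then have "emeasure lborel B \<le> emeasure lborel (\<Union>j. D j)"
      by (intro emeasure_mono) (auto simp: D_def)
    also have "\<dots> \<le> (\<Sum>j. emeasure lborel (D j))"
      by (intro emeasure_subadditive_countably) (auto simp: D_def)
    also have "\<dots> \<le> (\<Sum>j. 2 ^ ?m * diam_gauge ?m (C j))"
    proof (intro suminf_le allI)
      fix j
      have "bounded (C j)" using C by (auto simp: fine_covers_def)
      then have d: "0 \<le> diameter (C j)" by (rule diameter_ge_0)
      show "emeasure lborel (D j) \<le> 2 ^ ?m * diam_gauge ?m (C j)"
      proof (cases "C j \<inter> A = {}")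
        case False
        then have "emeasure lborel (D j) = ennreal (unit_ball_vol ?m * diameter (C j) ^ ?m)"
          using d by (simp add: D_def emeasure_cball)
        also have "\<dots> = 2 ^ ?m * diam_gauge ?m (C j)"
        proof -
          have "diam_gauge ?m (C j) = ennreal (unit_ball_vol ?m * (diameter (C j) / 2) ^ ?m)"
            using False by (auto simp: diam_gauge_def)
          moreover have "(2::ennreal) ^ ?m = ennreal (2 ^ ?m)" by (simp flip: ennreal_numeral add: ennreal_power)
          ultimately show ?thesis using d by (simp add: power_divide flip: ennreal_mult')
        qed
        finally show ?thesis by simp
      qed (simp add: D_def)
    qed auto
    also have "\<dots> = 2 ^ ?m * (\<Sum>j. diam_gauge ?m (C j))" by simp
    finally show ?thesis .
  qed
  moreover define k :: ennreal where "k = ennreal (1 / 2 ^ ?m)"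
  have k: "k * (2 ^ ?m * x) = x" for x
  proof -
    have "k * 2 ^ ?m = ennreal (1 / 2 ^ ?m * 2 ^ ?m)"
      unfolding k_def by (subst ennreal_mult') (auto simp flip: ennreal_numeral ennreal_power)
    also have "\<dots> = 1" by simp
    finally show ?thesis by (simp add: mult.assoc[symmetric])
  qed
  ultimately have "k * emeasure lborel B \<le> (\<Sum>j. diam_gauge ?m (C j))" if "C \<in> fine_covers 1 A" for C
    using mult_left_mono[of "emeasure lborel B" "2 ^ ?m * (\<Sum>j. diam_gauge ?m (C j))" k] that k by auto
  \<comment> \<open>The reciprocal \<open>k\<close> moves the constant to the left, so that the
    infimum over covers can be taken on the right.\<close>
  then have "k * emeasure lborel B \<le> hausdorff_content ?m 1 A"
    unfolding hausdorff_content_eq by (rule INF_greatest)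
  also have "\<dots> \<le> hausdorff_outer ?m A"
    by (rule hausdorff_content_le_outer) simp
  finally have "2 ^ ?m * (k * emeasure lborel B) \<le> 2 ^ ?m * hausdorff_outer ?m A"
    by (rule mult_left_mono) simp
  also have "2 ^ ?m * (k * emeasure lborel B) = emeasure lborel B"
    using k[of "emeasure lborel B"] by (simp add: mult_ac)
  finally show ?thesis .
qed

section \<open>Packing, and Hausdorff measure of Lipschitz images\<close>

text \<open>Volume comparison: the balls of radius \<open>d / 2\<close> about the points are
  disjoint and lie in the ball of radius \<open>2 * \<rho>\<close>.\<close>

lemma separated_net_card:
  fixes S :: "'m::euclidean_space set"
  assumes S: "finite S" "S \<subseteq> cball 0 \<rho>" "\<And>x y. x \<in> S \<Longrightarrow> y \<in> S \<Longrightarrow> x \<noteq> y \<Longrightarrow> d \<le> dist x y"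
    and d: "0 < d" "d \<le> \<rho>"
  shows "real (card S) \<le> (4 * \<rho> / d) ^ DIM('m)"
proof -
  let ?m = "DIM('m)" let ?u = "unit_ball_vol (real ?m)"
  have "disjoint_family_on (\<lambda>x. ball x (d/2)) S"
    unfolding disjoint_family_on_def
  proof (intro ballI impI)
    fix x y assume "x \<in> S" "y \<in> S" "x \<noteq> y"
    then have "d \<le> dist x y" by (rule S(3))
    then show "ball x (d/2) \<inter> ball y (d/2) = {}" by (intro disjoint_ballI) auto
  qed
  then have "(\<Sum>x\<in>S. emeasure lborel (ball x (d/2))) = emeasure lborel (\<Union>x\<in>S. ball x (d/2))"
    by (intro sum_emeasure) (use S in auto)
  also have "\<dots> \<le> emeasure lborel (cball (0::'m) (2 * \<rho>))"
  proof (intro emeasure_mono subsetI)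
    fix y assume "y \<in> (\<Union>x\<in>S. ball x (d/2))"
    then obtain x where "x \<in> S" "dist x y < d/2" by auto
    then show "y \<in> cball 0 (2 * \<rho>)" using S(2) d norm_triangle_ineq2[of y x] by (auto simp: dist_norm norm_minus_commute)
  qed auto
  finally have "ennreal (real (card S) * (?u * (d/2) ^ ?m)) \<le> ennreal (?u * (2 * \<rho>) ^ ?m)"
    using d by (simp add: emeasure_ball emeasure_cball ennreal_mult' ennreal_of_nat_eq_real_of_nat)
  then have "real (card S) * (?u * (d/2) ^ ?m) \<le> ?u * (2 * \<rho>) ^ ?m"
    using d by (subst (asm) ennreal_le_iff) auto
  then have "?u * (real (card S) * (d/2) ^ ?m) \<le> ?u * (2 * \<rho>) ^ ?m" by (simp add: algebra_simps)
  then have "real (card S) * (d/2) ^ ?m \<le> (2 * \<rho>) ^ ?m"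
    by (subst (asm) mult_le_cancel_left_pos) (auto simp: unit_ball_vol_pos)
  then have "real (card S) \<le> (2 * \<rho>) ^ ?m / (d/2) ^ ?m"
    using d by (simp add: pos_le_divide_eq)
  also have "\<dots> = ((2 * \<rho>) / (d/2)) ^ ?m" by (rule power_divide[symmetric])
  also have "(2 * \<rho>) / (d/2) = 4 * \<rho> / d" by simp
  finally show ?thesis .
qed

text \<open>The packing bound allows a separated set of largest cardinality, and a point farther
  than \<open>d\<close> from all of it could be added.\<close>

lemma maximal_separated_net:
  fixes \<rho> d :: real
  assumes d: "0 < d" "d \<le> \<rho>"
  obtains S :: "'m::euclidean_space set" where "finite S" "S \<subseteq> cball 0 \<rho>"
    "real (card S) \<le> (4 * \<rho> / d) ^ DIM('m)" "cball 0 \<rho> \<subseteq> (\<Union>x\<in>S. cball x d)"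
proof -
  define P where "P = (\<lambda>S::'m set. finite S \<and> S \<subseteq> cball 0 \<rho> \<and> (\<forall>x\<in>S. \<forall>y\<in>S. x \<noteq> y \<longrightarrow> d \<le> dist x y))"
  have card: "real (card S) \<le> (4 * \<rho> / d) ^ DIM('m)" if "P S" for S
    by (rule separated_net_card) (use that d in \<open>auto simp: P_def\<close>)
  have bd: "card S < Suc (nat \<lfloor>(4 * \<rho> / d) ^ DIM('m)\<rfloor>)" if "P S" for S
    using card[OF that] by (simp add: le_nat_floor less_Suc_eq_le)
  have "P {}" by (simp add: P_def)
  then obtain S where S: "P S" "\<And>T. P T \<Longrightarrow> card T \<le> card S"
    using ex_has_greatest_nat[of P "{}" card] bd by (metis less_imp_le)
  have "x \<in> (\<Union>y\<in>S. cball y d)" if x: "x \<in> cball 0 \<rho>" for x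
  proof (rule ccontr)
    assume n: "x \<notin> (\<Union>y\<in>S. cball y d)"
    then have far: "\<And>y. y \<in> S \<Longrightarrow> d \<le> dist y x" by force
    then have "P (insert x S)" using S(1) x by (auto simp: P_def dist_commute)
    moreover have "x \<notin> S" using far d by fastforce
    ultimately show False using S(2)[of "insert x S"] S(1) by (simp add: P_def)
  qed
  then show thesis using S(1) card[OF S(1)] by (intro that[of S]) (auto simp: P_def)
qed

text \<open>A net of at most \<open>(4 * \<rho> / d) ^ DIM('m)\<close> balls maps to pieces of gauge
  of order \<open>(d * L) ^ DIM('m)\<close>; the product does not depend on \<open>d\<close>, hence
  the bound is uniform in the scale.\<close>

lemma hausdorff_outer_lipschitz_image:
  fixes f :: "'m::euclidean_space \<Rightarrow> 'a::euclidean_space"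
  assumes L: "0 < L" "0 < \<rho>"
    and lip: "\<And>x y. x \<in> cball 0 \<rho> \<Longrightarrow> y \<in> cball 0 \<rho> \<Longrightarrow> dist (f x) (f y) \<le> L * dist x y"
  shows "hausdorff_outer DIM('m) (f ` cball 0 \<rho>) < top"
proof -
  let ?m = "DIM('m)" let ?u = "unit_ball_vol (real ?m)"
  have "hausdorff_content ?m e (f ` cball 0 \<rho>) \<le> ennreal (?u * (4 * \<rho> * L) ^ ?m)" if e: "0 < e" for e
  proof -
    define d where "d = min \<rho> (e / (2 * L))"
    have d: "0 < d" "d \<le> \<rho>" "2 * d * L \<le> e" using L e by (auto simp: d_def field_simps min_def)
    obtain S :: "'m set" where S: "finite S" "S \<subseteq> cball 0 \<rho>"
      "real (card S) \<le> (4 * \<rho> / d) ^ ?m" "cball 0 \<rho> \<subseteq> (\<Union>x\<in>S. cball x d)"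
      by (rule maximal_separated_net[OF d(1,2)]) (rule that)
    obtain g where g: "bij_betw g {..<card S} S" using ex_bij_betw_nat_finite[OF S(1)]
      by (auto simp: atLeast0LessThan)
    define C where "C = (\<lambda>j. if j < card S then f ` (cball (g j) d \<inter> cball 0 \<rho>) else {})"
    have di: "dist u v \<le> 2 * d * L" if u: "u \<in> C j" and v: "v \<in> C j" for u v j
    proof -
      obtain x y where xy: "u = f x" "v = f y" "x \<in> cball (g j) d \<inter> cball 0 \<rho>" "y \<in> cball (g j) d \<inter> cball 0 \<rho>"
        using u v unfolding C_def by (metis (no_types, lifting) empty_iff imageE)
      then have "dist x y \<le> 2 * d" using dist_triangle_le[of x "g j" y] by (auto simp: dist_commute)
      moreover have "dist u v \<le> L * dist x y" using lip xy by auto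
      ultimately show ?thesis using L by (smt (verit) mult.commute mult_left_mono)
    qed
    have diam: "diameter (C j) \<le> 2 * d * L" for j
      using di[of _ j] L d by (intro diameter_le) (auto simp: dist_norm)
    have bdd: "bounded (C j)" for j
      unfolding bounded_two_points using di by blast
    have "C \<in> fine_covers e (f ` cball 0 \<rho>)"
      unfolding fine_covers_def
    proof (intro CollectI conjI allI)
      show "f ` cball 0 \<rho> \<subseteq> (\<Union>j. C j)"
      proof
        fix y assume "y \<in> f ` cball 0 \<rho>"
        then obtain x where x: "y = f x" "x \<in> cball 0 \<rho>" by blast
        then obtain z where "z \<in> S" "x \<in> cball z d" using S(4) by blast
        moreover then obtain j where "j < card S" "z = g j" using g by (auto simp: bij_betw_def)
        ultimately show "y \<in> (\<Union>j. C j)" using x by (auto simp: C_def)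
      qed
      show "bounded (C j)" "diameter (C j) \<le> e" for j
        using bdd order_trans[OF diam d(3)] by simp_all
    qed
    then have "hausdorff_content ?m e (f ` cball 0 \<rho>) \<le> (\<Sum>j. diam_gauge ?m (C j))"
      by (rule hausdorff_content_le)
    also have "\<dots> = (\<Sum>j\<in>{..<card S}. diam_gauge ?m (C j))"
      by (intro suminf_finite) (auto simp: C_def diam_gauge_def)
    also have "\<dots> \<le> (\<Sum>j\<in>{..<card S}. ennreal (?u * (d * L) ^ ?m))"
    proof (intro sum_mono)
      fix j
      have "(diameter (C j) / 2) ^ ?m \<le> (d * L) ^ ?m"
        using diam[of j] diameter_ge_0[OF bdd[of j]] by (intro power_mono) auto
      then show "diam_gauge ?m (C j) \<le> ennreal (?u * (d * L) ^ ?m)"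
        by (auto simp: diam_gauge_def intro!: ennreal_leI mult_left_mono)
    qed
    also have "\<dots> = ennreal (real (card S) * (?u * (d * L) ^ ?m))"
      by (simp add: ennreal_mult' ennreal_of_nat_eq_real_of_nat)
    also have "\<dots> \<le> ennreal ((4 * \<rho> / d) ^ ?m * (?u * (d * L) ^ ?m))"
      using d L S(3) by (intro ennreal_leI mult_right_mono) auto
    also have "(4 * \<rho> / d) ^ ?m * (?u * (d * L) ^ ?m) = ?u * (4 * \<rho> * L) ^ ?m"
    proof -
      have "(4 * \<rho> / d) ^ ?m * (?u * (d * L) ^ ?m) = ?u * ((4 * \<rho> / d) * (d * L)) ^ ?m"
        by (simp only: power_mult_distrib mult_ac)
      also have "(4 * \<rho> / d) * (d * L) = 4 * \<rho> * L" using d by simp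
      finally show ?thesis .
    qed
    finally show ?thesis .
  qed
  then have "hausdorff_outer ?m (f ` cball 0 \<rho>) \<le> ennreal (?u * (4 * \<rho> * L) ^ ?m)"
    unfolding hausdorff_outer_def by (intro SUP_least) auto
  then show ?thesis by (metis ennreal_less_top order_le_less_trans)
qed

section \<open>Weak limits with respect to a locally finite Borel measure\<close>

text \<open>Each approximating sequence may have its own limit; uniform errors make \<open>a\<close>
  Cauchy. This carries convergence of integrals from a class of integrands to its L1 limits.\<close>

lemma convergent_if_uniformly_approximable:
  fixes a :: "nat \<Rightarrow> real"
  assumes "\<And>e. 0 < e \<Longrightarrow> \<exists>b. convergent b \<and> (\<forall>k. \<bar>a k - b k\<bar> \<le> e)"
  shows "convergent a"
  unfolding Cauchy_convergent_iff[symmetric]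
proof (rule CauchyI)
  fix e :: real assume "0 < e"
  then obtain b where b: "convergent b" "\<And>k. \<bar>a k - b k\<bar> \<le> e / 4"
    using assms[of "e / 4"] by auto
  then have "Cauchy b" by (simp add: Cauchy_convergent_iff)
  then obtain N where N: "\<And>m n. m \<ge> N \<Longrightarrow> n \<ge> N \<Longrightarrow> \<bar>b m - b n\<bar> < e / 4"
    using CauchyD[of b "e / 4"] \<open>0 < e\<close> by auto
  have "\<bar>a m - a n\<bar> < e" if "m \<ge> N" "n \<ge> N" for m n
    using b(2)[of m] b(2)[of n] N[OF that] \<open>0 < e\<close> by linarith
  then show "\<exists>M. \<forall>m\<ge>M. \<forall>n\<ge>M. norm (a m - a n) < e" by auto
qed

lemma abs_integral_le:
  fixes f :: "'a \<Rightarrow> real"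
  assumes "integrable S h" "f \<in> borel_measurable S" "AE x in S. \<bar>f x\<bar> \<le> h x"
  shows "\<bar>LINT x|S. f x\<bar> \<le> (LINT x|S. h x)" "integrable S f"
proof -
  show i: "integrable S f"
    by (rule Bochner_Integration.integrable_bound[OF assms(1,2)])
       (use assms(3) in eventually_elim, auto)
  have "\<bar>LINT x|S. f x\<bar> \<le> (LINT x|S. \<bar>f x\<bar>)" using integral_norm_bound[of S f] by simp
  also have "\<dots> \<le> (LINT x|S. h x)"
    by (intro integral_mono_AE integrable_abs i assms)
  finally show "\<bar>LINT x|S. f x\<bar> \<le> (LINT x|S. h x)" .
qed

lemma integrable_mult_bounded:
  fixes f g :: "'a \<Rightarrow> real"
  assumes "integrable S f" "g \<in> borel_measurable S" "\<And>x. \<bar>g x\<bar> \<le> M"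
  shows "integrable S (\<lambda>x. f x * g x)" "\<bar>LINT x|S. f x * g x\<bar> \<le> M * (LINT x|S. \<bar>f x\<bar>)"
proof -
  have b: "\<bar>f x * g x\<bar> \<le> M * \<bar>f x\<bar>" for x
    using mult_right_mono[OF assms(3)[of x], of "\<bar>f x\<bar>"] by (simp add: abs_mult mult.commute)
  show "integrable S (\<lambda>x. f x * g x)"
    by (rule abs_integral_le(2)[of S "\<lambda>x. M * \<bar>f x\<bar>"]) (use assms b in auto)
  have "\<bar>LINT x|S. f x * g x\<bar> \<le> (LINT x|S. M * \<bar>f x\<bar>)"
    by (rule abs_integral_le(1)[of S "\<lambda>x. M * \<bar>f x\<bar>"]) (use assms b in auto)
  then show "\<bar>LINT x|S. f x * g x\<bar> \<le> M * (LINT x|S. \<bar>f x\<bar>)" by simp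
qed

text \<open>Finite additivity suffices: domination by a finite measure supplies continuity at the empty set.\<close>

lemma (in finite_measure) bounded_density_exists:
  fixes \<nu> :: "'a set \<Rightarrow> real"
  assumes pos: "\<And>A. A \<in> sets M \<Longrightarrow> 0 \<le> \<nu> A"
    and le: "\<And>A. A \<in> sets M \<Longrightarrow> \<nu> A \<le> c * measure M A"
    and add: "\<And>A B. A \<in> sets M \<Longrightarrow> B \<in> sets M \<Longrightarrow> A \<inter> B = {} \<Longrightarrow> \<nu> (A \<union> B) = \<nu> A + \<nu> B"
    and c: "0 \<le> c"
  obtains u where "u \<in> borel_measurable M" "\<And>x. 0 \<le> u x" "\<And>x. u x \<le> c"
    "\<And>A. A \<in> sets M \<Longrightarrow> \<nu> A = (LINT x|M. indicator A x * u x)"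
proof -
  define N where "N = measure_of (space M) (sets M) (\<lambda>A. ennreal (\<nu> A))"
  have e: "\<nu> {} = 0" using le[of "{}"] pos[of "{}"] by simp
  have ca: "countably_additive (sets M) (\<lambda>A. ennreal (\<nu> A))"
  proof (rule sets.empty_continuous_imp_countably_additive)
    show "positive (sets M) (\<lambda>A. ennreal (\<nu> A))" by (simp add: positive_def e)
    show "additive (sets M) (\<lambda>A. ennreal (\<nu> A))"
      by (auto simp: additive_def add pos simp flip: ennreal_plus)
    show "\<forall>A\<in>sets M. ennreal (\<nu> A) \<noteq> \<infinity>" by simp
    fix A :: "nat \<Rightarrow> 'a set" assume A: "range A \<subseteq> sets M" "decseq A" "(\<Inter>i. A i) = {}"
    have "(\<lambda>i. measure M (A i)) \<longlonglongrightarrow> measure M (\<Inter>i. A i)"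
      by (rule finite_Lim_measure_decseq[OF A(1,2)])
    then have l: "(\<lambda>i. c * measure M (A i)) \<longlonglongrightarrow> 0"
      using A(3) tendsto_mult_right_zero by fastforce
    have "(\<lambda>i. \<nu> (A i)) \<longlonglongrightarrow> 0"
      by (rule tendsto_sandwich[OF _ _ tendsto_const l])
         (use A(1) pos le in \<open>auto intro!: always_eventually\<close>)
    then show "(\<lambda>i. ennreal (\<nu> (A i))) \<longlonglongrightarrow> 0" using tendsto_ennrealI by fastforce
  qed
  have eN: "emeasure N A = ennreal (\<nu> A)" if "A \<in> sets M" for A
    unfolding N_def
    by (rule emeasure_measure_of_sigma) (use ca that e sets.sigma_algebra_axioms in \<open>auto simp: positive_def\<close>)
  have sN: "sets N = sets M" unfolding N_def by simp
  have "absolutely_continuous M N"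
    unfolding absolutely_continuous_def
  proof
    fix A assume A: "A \<in> null_sets M"
    then have "A \<in> sets M" "measure M A = 0" by (auto simp: measure_def null_sets_def)
    then have "\<nu> A = 0" using le[of A] pos[of A] by simp
    then show "A \<in> null_sets N" using \<open>A \<in> sets M\<close> by (auto simp: null_sets_def eN sN)
  qed
  then obtain h where h: "h \<in> borel_measurable M" "density M h = N"
    using Radon_Nikodym sN by blast
  have hA: "(\<integral>\<^sup>+ x\<in>A. h x \<partial>M) = ennreal (\<nu> A)" if "A \<in> sets M" for A
    using emeasure_density[OF h(1) that] eN[OF that] h(2) by simp
  \<comment> \<open>On the set where the density exceeds \<open>c\<close>, the bound on
    \<open>\<nu>\<close> leaves no room for the integral of the excess, so the excess vanishes
    almost everywhere.\<close>
  define A where "A = {x \<in> space M. ennreal c < h x}"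
  have A: "A \<in> sets M" unfolding A_def using h(1) by measurable
  have "(\<integral>\<^sup>+ x\<in>A. h x \<partial>M) = (\<integral>\<^sup>+ x. ennreal c * indicator A x + (h x - ennreal c) * indicator A x \<partial>M)"
    by (intro nn_integral_cong) (auto simp: A_def indicator_def add_diff_inverse_ennreal)
  also have "\<dots> = ennreal c * emeasure M A + (\<integral>\<^sup>+ x. (h x - ennreal c) * indicator A x \<partial>M)"
    using A h(1) by (subst nn_integral_add) (auto simp: nn_integral_cmult_indicator)
  finally have split: "(\<integral>\<^sup>+ x\<in>A. h x \<partial>M) = ennreal c * emeasure M A + (\<integral>\<^sup>+ x. (h x - ennreal c) * indicator A x \<partial>M)" .
  have cA: "ennreal c * emeasure M A = ennreal (c * measure M A)"
    unfolding emeasure_eq_measure by (rule ennreal_mult[symmetric]) (use c in auto)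
  have "(\<integral>\<^sup>+ x\<in>A. h x \<partial>M) \<le> ennreal (c * measure M A)"
    unfolding hA[OF A] by (rule ennreal_leI[OF le[OF A]])
  then have "ennreal (c * measure M A) + (\<integral>\<^sup>+ x. (h x - ennreal c) * indicator A x \<partial>M) \<le> ennreal (c * measure M A) + 0"
    unfolding split cA by simp
  then have "(\<integral>\<^sup>+ x. (h x - ennreal c) * indicator A x \<partial>M) = 0"
    by (subst (asm) ennreal_add_left_cancel_le) auto
  then have "AE x in M. (h x - ennreal c) * indicator A x = 0"
    using A h(1) by (subst (asm) nn_integral_0_iff_AE) auto
  then have AEh: "AE x in M. h x \<le> ennreal c"
    by (rule AE_mp) (auto intro!: AE_I2 simp: A_def indicator_def ennreal_minus_eq_0 split: if_splits)
  \<comment> \<open>Truncation at \<open>c\<close> changes \<open>h\<close> on a null set only and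
    makes the bounds hold at every point.\<close>
  define u where "u = (\<lambda>x. min c (enn2real (h x)))"
  have um: "u \<in> borel_measurable M" unfolding u_def using h(1) by measurable
  have u: "0 \<le> u x" "u x \<le> c" for x using c by (auto simp: u_def)
  have uh: "AE x in M. ennreal (u x) = h x"
    using AEh
  proof eventually_elim
    fix x assume "h x \<le> ennreal c"
    then obtain r where r: "h x = ennreal r" "0 \<le> r" by (cases "h x") (auto simp: top_unique)
    then show "ennreal (u x) = h x" using \<open>h x \<le> ennreal c\<close> c by (simp add: u_def min_def)
  qed
  show thesis
  proof (rule that[OF um u])
    fix A assume A: "A \<in> sets M"
    have "(LINT x|M. indicator A x * u x) = enn2real (\<integral>\<^sup>+ x. ennreal (indicator A x * u x) \<partial>M)"
      using A um u by (intro integral_eq_nn_integral) auto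
    also have "(\<integral>\<^sup>+ x. ennreal (indicator A x * u x) \<partial>M) = (\<integral>\<^sup>+ x\<in>A. h x \<partial>M)"
      by (rule nn_integral_cong_AE) (use uh in eventually_elim, auto simp: indicator_def)
    finally show "\<nu> A = (LINT x|M. indicator A x * u x)" using hA[OF A] pos[OF A] by simp
  qed
qed

section \<open>Weak limits over a finite measure\<close>

text \<open>The limits over measurable sets form a bounded additive set function, hence have a
  density; density of simple functions in L1 and the uniform bound \<open>c\<close> extend the
  convergence to all integrable \<open>f\<close>.\<close>

lemma (in finite_measure) weak_limit_exists:
  fixes g :: "nat \<Rightarrow> 'a \<Rightarrow> real"
  assumes g: "\<And>k. g k \<in> borel_measurable M" "\<And>k x. \<bar>g k x\<bar> \<le> c"
    and conv: "\<And>A. A \<in> sets M \<Longrightarrow> convergent (\<lambda>k. LINT x|M. indicator A x * g k x)"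
  shows "\<exists>u\<in>borel_measurable M. (\<forall>x. \<bar>u x\<bar> \<le> c) \<and>
    (\<forall>f. integrable M f \<longrightarrow> (\<lambda>k. LINT x|M. f x * g k x) \<longlonglongrightarrow> (LINT x|M. f x * u x))"
proof -
  have c: "0 \<le> c" using g(2)[of 0 undefined] by linarith
  have iI: "integrable M (indicator A :: _ \<Rightarrow> real)" if "A \<in> sets M" for A using that by (simp add: emeasure_eq_measure)
  define l where "l = (\<lambda>A. lim (\<lambda>k. LINT x|M. indicator A x * g k x))"
  have l: "(\<lambda>k. LINT x|M. indicator A x * g k x) \<longlonglongrightarrow> l A" if "A \<in> sets M" for A
    unfolding l_def using conv[OF that] by (simp add: convergent_LIMSEQ_iff)
  have lb: "\<bar>l A\<bar> \<le> c * measure M A" if A: "A \<in> sets M" for A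
  proof (rule LIMSEQ_le_const2[OF tendsto_rabs[OF l[OF A]]])
    show "\<exists>N. \<forall>k\<ge>N. \<bar>LINT x|M. indicator A x * g k x\<bar> \<le> c * measure M A"
      using integrable_mult_bounded(2)[OF iI[OF A] g] A by auto
  qed
  have ladd: "l (A \<union> B) = l A + l B" if AB: "A \<in> sets M" "B \<in> sets M" "A \<inter> B = {}" for A B
  proof (rule LIMSEQ_unique[OF l])
    have "(LINT x|M. indicator (A \<union> B) x * g k x) = (LINT x|M. indicator A x * g k x) + (LINT x|M. indicator B x * g k x)" for k
    proof -
      have "(LINT x|M. indicator (A \<union> B) x * g k x) = (LINT x|M. indicator A x * g k x + indicator B x * g k x)"
        using AB(3) by (intro Bochner_Integration.integral_cong refl) (auto simp: indicator_def)
      also have "\<dots> = (LINT x|M. indicator A x * g k x) + (LINT x|M. indicator B x * g k x)"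
        using integrable_mult_bounded(1)[OF iI[OF AB(1)] g(1)[of k] g(2)]
          integrable_mult_bounded(1)[OF iI[OF AB(2)] g(1)[of k] g(2)]
        by (rule Bochner_Integration.integral_add)
      finally show ?thesis .
    qed
    then show "(\<lambda>k. LINT x|M. indicator (A \<union> B) x * g k x) \<longlonglongrightarrow> l A + l B"
      using tendsto_add[OF l[OF AB(1)] l[OF AB(2)]] by simp
  qed (use AB in auto)
  \<comment> \<open>The limit \<open>l\<close> is signed, with modulus at most \<open>c\<close>
    times the measure. Adding that multiple makes it nonnegative with constant \<open>2 * c\<close>;
    the shift is undone in the density.\<close>
  obtain w where w: "w \<in> borel_measurable M" "\<And>x. 0 \<le> w x" "\<And>x. w x \<le> 2 * c"
    "\<And>A. A \<in> sets M \<Longrightarrow> l A + c * measure M A = (LINT x|M. indicator A x * w x)"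
  proof (rule bounded_density_exists[of "\<lambda>A. l A + c * measure M A" "2 * c"])
    fix A B assume AB: "A \<in> sets M" "B \<in> sets M" "A \<inter> B = {}"
    then show "l (A \<union> B) + c * measure M (A \<union> B) = (l A + c * measure M A) + (l B + c * measure M B)"
      using ladd[OF AB] finite_measure_Union[OF AB] by (simp add: algebra_simps)
  next
    fix A assume "A \<in> sets M"
    from lb[OF this] show "0 \<le> l A + c * measure M A" "l A + c * measure M A \<le> 2 * c * measure M A"
      by linarith+
  next
    show "0 \<le> 2 * c" using c by simp
  qed (rule that)
  define u where "u = (\<lambda>x. w x - c)"
  have um: "u \<in> borel_measurable M" using w(1) by (simp add: u_def)
  have ub: "\<bar>u x\<bar> \<le> c" for x using w(2,3)[of x] by (simp add: u_def abs_le_iff)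
  show ?thesis
  proof (rule bexI[OF _ um], rule conjI, use ub in blast, intro allI impI)
    fix f :: "'a \<Rightarrow> real" assume "integrable M f"
    then show "(\<lambda>k. LINT x|M. f x * g k x) \<longlonglongrightarrow> (LINT x|M. f x * u x)"
    proof (induction rule: integrable_induct)
      case (base A r)
      have "(LINT x|M. indicator A x * u x) = (LINT x|M. indicator A x * w x) - (LINT x|M. indicator A x * c)"
        using integrable_mult_bounded(1)[OF iI[OF base(1)] w(1), of "2 * c"] w(2,3) iI[OF base(1)]
        by (subst Bochner_Integration.integral_diff[symmetric]) (auto simp: u_def algebra_simps abs_of_nonneg)
      also have "\<dots> = l A" using w(4)[OF base(1)] base(1) by (simp add: mult.commute)
      finally have "(\<lambda>k. r * (LINT x|M. indicator A x * g k x)) \<longlonglongrightarrow> r * (LINT x|M. indicator A x * u x)"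
        using tendsto_mult_left[OF l[OF base(1)]] by simp
      then show ?case by (simp add: mult_ac flip: integral_mult_right_zero)
    next
      case (add f1 f2)
      have "(LINT x|M. (f1 x + f2 x) * h x) = (LINT x|M. f1 x * h x) + (LINT x|M. f2 x * h x)"
        if "h \<in> borel_measurable M" "\<And>x. \<bar>h x\<bar> \<le> c" for h
        using integrable_mult_bounded(1)[OF add(1) that] integrable_mult_bounded(1)[OF add(2) that]
        by (simp add: distrib_right)
      then show ?case using tendsto_add[OF add(3,4)] g um ub by simp
    next
      case (lim f s)
      let ?d = "\<lambda>i. LINT x|M. \<bar>f x - s i x\<bar>"
      have d0: "?d \<longlonglongrightarrow> 0"
      proof -
        have "?d \<longlonglongrightarrow> (LINT x|M. 0)"
        proof (rule integral_dominated_convergence[where w = "\<lambda>x. 3 * \<bar>f x\<bar>"])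
          show "AE x in M. (\<lambda>i. \<bar>f x - s i x\<bar>) \<longlonglongrightarrow> 0"
          proof (rule AE_I2)
            fix x assume "x \<in> space M"
            from tendsto_diff[OF tendsto_const[of "f x"] lim(2)[OF this]]
            show "(\<lambda>i. \<bar>f x - s i x\<bar>) \<longlonglongrightarrow> 0" using tendsto_rabs_zero by fastforce
          qed
          show "AE x in M. norm \<bar>f x - s i x\<bar> \<le> 3 * \<bar>f x\<bar>" for i
            using lim(3)[of _ i] by (intro AE_I2) (smt (verit) real_norm_def)
        qed (use lim in auto)
        then show ?thesis by simp
      qed
      \<comment> \<open>The error is uniform over functions bounded by \<open>c\<close>, so one
        index \<open>i\<close> serves every \<open>g k\<close> and the limit
        \<open>u\<close>.\<close>
      have diff: "\<bar>(LINT x|M. f x * h x) - (LINT x|M. s i x * h x)\<bar> \<le> c * ?d i"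
        if h: "h \<in> borel_measurable M" "\<And>x. \<bar>h x\<bar> \<le> c" for h i
      proof -
        have "(LINT x|M. f x * h x) - (LINT x|M. s i x * h x) = (LINT x|M. (f x - s i x) * h x)"
          using integrable_mult_bounded(1)[OF lim(4) h] integrable_mult_bounded(1)[OF lim(1) h, of i]
          by (simp add: left_diff_distrib)
        then show ?thesis
          using integrable_mult_bounded(2)[OF Bochner_Integration.integrable_diff[OF lim(4) lim(1)] h, of i] by simp
      qed
      show ?case
      proof (rule LIMSEQ_I)
        fix e :: real assume e: "0 < e"
        have "(\<lambda>i. c * ?d i) \<longlonglongrightarrow> c * 0" by (intro tendsto_intros d0)
        then obtain i where "norm (c * ?d i - 0) < e / 3" using LIMSEQ_D[of _ 0 "e / 3"] e by force
        then have i: "c * ?d i < e / 3" by simp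
        obtain K where K: "\<And>k. k \<ge> K \<Longrightarrow> \<bar>(LINT x|M. s i x * g k x) - (LINT x|M. s i x * u x)\<bar> < e / 3"
          using LIMSEQ_D[OF lim(5)[of i], of "e / 3"] e by auto
        have "\<bar>(LINT x|M. f x * g k x) - (LINT x|M. f x * u x)\<bar> < e" if "k \<ge> K" for k
          using K[OF that] i diff[OF g(1)[of k] g(2), of i] diff[OF um ub, of i] by linarith
        then show "\<exists>no. \<forall>k\<ge>no. norm ((LINT x|M. f x * g k x) - (LINT x|M. f x * u x)) < e" by auto
      qed
    qed
  qed
qed

text \<open>
  The test functions \<open>V\<close> need not form a vector space; all that is used is that they separate compact
  subsets of \<open>\<Gamma>\<close> from their neighbourhoods.
\<close>

locale locally_finite_borel =
  fixes T :: "'a::euclidean_space measure" and \<Gamma> :: "'a set" and V :: "('a \<Rightarrow> real) set"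
  assumes sets_T [simp, measurable_cong]: "sets T = sets borel"
    and finite_cball: "\<And>R. emeasure T (cball 0 R) < top"
    and closed_\<Gamma>: "closed \<Gamma>" and null_compl: "emeasure T (- \<Gamma>) = 0"
    and bump: "\<And>K U. compact K \<Longrightarrow> open U \<Longrightarrow> K \<subseteq> \<Gamma> \<Longrightarrow> K \<subseteq> U \<Longrightarrow>
      \<exists>\<phi>\<in>V. \<phi> \<in> borel_measurable borel \<and> (\<forall>x. 0 \<le> \<phi> x \<and> \<phi> x \<le> 1) \<and> (\<forall>x\<in>K. \<phi> x = 1) \<and> (\<forall>x. x \<notin> U \<longrightarrow> \<phi> x = 0)"
begin

section \<open>Compact sets and test functions for a locally finite measure\<close>

lemma space_T [simp]: "space T = UNIV"
  using sets_eq_imp_space_eq[OF sets_T] by simp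

lemma AE_\<Gamma>: "AE x in T. x \<in> \<Gamma>"
  by (rule AE_I[of _ _ "- \<Gamma>"]) (use null_compl closed_\<Gamma> in auto)

lemma emeasure_bounded: "bounded A \<Longrightarrow> emeasure T A < top"
proof -
  assume "bounded A"
  then obtain R where "A \<subseteq> cball 0 R" by (auto simp: bounded_iff subset_iff)
  then have "emeasure T A \<le> emeasure T (cball 0 R)" by (intro emeasure_mono) auto
  then show ?thesis using finite_cball[of R] by (rule order_le_less_trans)
qed

lemma integrable_indicator_bounded:
  "A \<in> sets borel \<Longrightarrow> bounded A \<Longrightarrow> integrable T (indicator A :: 'a \<Rightarrow> real)"
  using emeasure_bounded[of A] by simp

definition shrink :: "'a set \<Rightarrow> nat \<Rightarrow> 'a set" where
  "shrink K n = {x. infdist x K < 1 / (real n + 1)}"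

lemma shrink:
  assumes "compact K" "K \<noteq> {}"
  shows "open (shrink K n)" "K \<subseteq> shrink K n" "x \<notin> K \<Longrightarrow> eventually (\<lambda>n. x \<notin> shrink K n) sequentially"
    "\<exists>R. \<forall>n. shrink K n \<subseteq> cball 0 R"
proof -
  show "open (shrink K n)"
    unfolding shrink_def by (intro open_Collect_less continuous_intros)
  show "K \<subseteq> shrink K n" by (auto simp: shrink_def)
  show "eventually (\<lambda>n. x \<notin> shrink K n) sequentially" if "x \<notin> K"
  proof -
    have pos: "0 < infdist x K"
      using infdist_pos_not_in_closed[OF compact_imp_closed[OF assms(1)] assms(2) that] .
    have "(\<lambda>n. 1 / (real n + 1)) \<longlonglongrightarrow> 0"
      using LIMSEQ_inverse_real_of_nat by (simp add: inverse_eq_divide add.commute)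
    from order_tendstoD(2)[OF this pos]
    have "eventually (\<lambda>n. 1 / (real n + 1) < infdist x K) sequentially" .
    then show ?thesis by (rule eventually_mono) (simp add: shrink_def)
  qed
  obtain R where R: "\<And>x. x \<in> K \<Longrightarrow> norm x \<le> R"
    using compact_imp_bounded[OF assms(1)] by (auto simp: bounded_iff)
  have "norm x \<le> R + 1" if "x \<in> shrink K n" for x n
  proof -
    obtain y where y: "y \<in> K" "infdist x K = dist x y"
      using infdist_attains_inf[OF compact_imp_closed[OF assms(1)] assms(2)] by metis
    have "1 / (real n + 1) \<le> 1" by (simp add: divide_le_eq_1)
    moreover have "dist x y < 1 / (real n + 1)" using that y(2) by (simp add: shrink_def)
    ultimately have "dist x y \<le> 1" by linarith
    then show ?thesis using R[OF y(1)] norm_triangle_ineq[of "x - y" y] by (simp add: dist_norm)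
  qed
  then show "\<exists>R. \<forall>n. shrink K n \<subseteq> cball 0 R" by (intro exI[of _ "R + 1"]) auto
qed

text \<open>Test functions adapted to neighbourhoods shrinking to \<open>K\<close>; the common
  dominating ball lets dominated convergence pass from the class \<open>V\<close> to the indicator
  of \<open>K\<close>.\<close>

lemma bump_sequence:
  assumes K: "compact K" "K \<subseteq> \<Gamma>"
  obtains \<phi> R where "\<And>n. \<phi> n \<in> V" "\<And>n. \<phi> n \<in> borel_measurable borel"
    "\<And>n x. \<bar>\<phi> n x\<bar> \<le> indicator (cball 0 R) x" "\<And>x. (\<lambda>n. \<phi> n x) \<longlonglongrightarrow> indicator K x"
proof (cases "K = {}")
  case True
  \<comment> \<open>For empty \<open>K\<close> the sets \<open>shrink K n\<close> are the whole
    space, as the distance to the empty set is 0; a test function that vanishes identically replaces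
    the sequence.\<close>
  obtain \<phi> where "\<phi> \<in> V" "\<phi> \<in> borel_measurable borel" "\<And>x. \<phi> x = 0"
    using bump[of "{}" "{}"] by auto
  then show thesis using True by (intro that[of "\<lambda>n. \<phi>"]) auto
next
  case False
  obtain R where R: "\<And>n. shrink K n \<subseteq> cball 0 R" using shrink(4)[OF K(1) False] by blast
  have "\<exists>\<phi>\<in>V. \<phi> \<in> borel_measurable borel \<and> (\<forall>x. 0 \<le> \<phi> x \<and> \<phi> x \<le> 1) \<and> (\<forall>x\<in>K. \<phi> x = 1) \<and>
     (\<forall>x. x \<notin> shrink K n \<longrightarrow> \<phi> x = 0)" for n
    by (rule bump[OF K(1) shrink(1)[OF K(1) False] K(2) shrink(2)[OF K(1) False]])
  then obtain \<phi> where \<phi>: "\<And>n. \<phi> n \<in> V" "\<And>n. \<phi> n \<in> borel_measurable borel"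
    "\<And>n x. 0 \<le> \<phi> n x \<and> \<phi> n x \<le> 1" "\<And>n x. x \<in> K \<Longrightarrow> \<phi> n x = 1"
    "\<And>n x. x \<notin> shrink K n \<Longrightarrow> \<phi> n x = 0"
    by metis
  show thesis
  proof (rule that[of \<phi> R])
    show "\<bar>\<phi> n x\<bar> \<le> indicator (cball 0 R) x" for n x
      using \<phi>(3)[of n x] \<phi>(5)[of x n] R[of n] by (cases "x \<in> shrink K n") (auto simp: indicator_def)
    show "(\<lambda>n. \<phi> n x) \<longlonglongrightarrow> indicator K x" for x
    proof (cases "x \<in> K")
      case False
      have "eventually (\<lambda>n. \<phi> n x = 0) sequentially"
        using shrink(3)[OF K(1) \<open>K \<noteq> {}\<close> False] by (rule eventually_mono) (rule \<phi>(5))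
      then show ?thesis using False by (simp add: tendsto_eventually)
    qed (simp add: \<phi>(4))
  qed (use \<phi> in auto)
qed

text \<open>Inner regularity is applied to the finite restriction of \<open>T\<close> to a ball
  containing \<open>A\<close>. The compact set is taken inside \<open>A \<inter> \<Gamma>\<close>,
  which loses no measure since \<open>T\<close> does not charge the complement of
  \<open>\<Gamma>\<close>.\<close>

lemma inner_compact:
  assumes A: "A \<in> sets borel" "bounded A" and e: "0 < (e::real)"
  obtains K where "compact K" "K \<subseteq> A" "K \<subseteq> \<Gamma>" "measure T (A - K) < e"
proof -
  obtain R where R: "A \<subseteq> cball 0 R" using A(2) by (auto simp: bounded_iff subset_iff)
  define TR where "TR = density T (indicator (cball 0 R))"
  have eTR: "emeasure TR B = emeasure T (cball 0 R \<inter> B)" if "B \<in> sets borel" for B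
    using that by (simp add: TR_def emeasure_restricted)
  have 1: "sets TR = sets borel" "emeasure TR (space TR) \<noteq> \<infinity>"
    using finite_cball[of R] eTR[of UNIV] by (simp_all add: TR_def less_top)
  let ?B = "A \<inter> \<Gamma>"
  have B: "?B \<in> sets borel" using A closed_\<Gamma> by simp
  have S: "emeasure TR ?B = (SUP K\<in>{K. K \<subseteq> ?B \<and> compact K}. emeasure TR K)"
    by (rule inner_regular[OF 1 B])
  have fin: "emeasure TR ?B < top"
    using emeasure_bounded[of "cball 0 R \<inter> ?B"] by (simp add: eTR[OF B] bounded_Int)
  have "{} \<in> {K. K \<subseteq> ?B \<and> compact K}" by simp
  then have "{K. K \<subseteq> ?B \<and> compact K} \<noteq> {}" by (metis empty_iff)
  from SUP_approx_ennreal[OF e this S] fin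
  have "\<exists>K\<in>{K. K \<subseteq> ?B \<and> compact K}. emeasure TR ?B < emeasure TR K + ennreal e"
    by (simp add: less_top)
  then obtain K where K: "K \<subseteq> ?B" "compact K" "emeasure TR ?B < emeasure TR K + ennreal e"
    by blast
  have Kb: "K \<in> sets borel" using K(2) by (simp add: compact_imp_closed)
  have bK: "bounded K" "bounded ?B" using K(2) compact_imp_bounded A(2) by (auto intro: bounded_Int)
  have i: "cball 0 R \<inter> ?B = ?B" "cball 0 R \<inter> K = K" using R K(1) by auto
  have "emeasure T ?B < emeasure T K + ennreal e"
    using K(3) eTR[OF B] eTR[OF Kb] i by simp
  moreover have "emeasure T ?B = emeasure T K + emeasure T (?B - K)"
  proof -
    have "?B = K \<union> (?B - K)" using K(1) by blast
    then show ?thesis using Kb B plus_emeasure[of K T "?B - K"] by simp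
  qed
  ultimately have "emeasure T (?B - K) < ennreal e"
    using emeasure_bounded[OF bK(1)] by (simp add: ennreal_add_left_cancel_less)
  moreover have "emeasure T (A - K) = emeasure T (?B - K)"
    by (rule emeasure_eq_AE) (use AE_\<Gamma> A Kb B in auto)
  ultimately have "emeasure T (A - K) < ennreal e" by simp
  then have "measure T (A - K) < e"
    unfolding measure_def using e by (cases "emeasure T (A - K)") (auto simp: ennreal_less_iff)
  then show thesis using K by (intro that[of K]) auto
qed

section \<open>Uniqueness and weak limits for a locally finite measure\<close>

text \<open>By approximation with test functions, \<open>h\<close> has integral 0 over every compact
  subset of \<open>\<Gamma>\<close>. A compact set on which \<open>h\<close> has a strict sign is
  therefore null, and such sets exhaust the points of that sign in measure.\<close>

lemma AE_zero_if_orthogonal: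
  assumes h: "h \<in> borel_measurable borel" "\<And>R. integrable T (\<lambda>x. indicator (cball 0 R) x * h x)"
    and z: "\<And>\<phi>. \<phi> \<in> V \<Longrightarrow> (LINT x|T. h x * \<phi> x) = 0"
  shows "AE x in T. h x = (0::real)"
proof -
  have zK: "(LINT x|T. indicator K x * h x) = 0" if K: "compact K" "K \<subseteq> \<Gamma>" for K
  proof -
    obtain \<phi> R where \<phi>: "\<And>n::nat. \<phi> n \<in> V" "\<And>n. \<phi> n \<in> borel_measurable borel"
      "\<And>n x. \<bar>\<phi> n x\<bar> \<le> indicator (cball 0 R) x" "\<And>x. (\<lambda>n. \<phi> n x) \<longlonglongrightarrow> indicator K x"
      by (rule bump_sequence[OF K]) (rule that)
    have Kb: "K \<in> sets borel" using K(1) by (simp add: compact_imp_closed)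
    have "(\<lambda>n. LINT x|T. h x * \<phi> n x) \<longlonglongrightarrow> (LINT x|T. h x * indicator K x)"
    proof (rule integral_dominated_convergence[where w = "\<lambda>x. \<bar>indicator (cball 0 R) x * h x\<bar>"])
      show "AE x in T. norm (h x * \<phi> n x) \<le> \<bar>indicator (cball 0 R) x * h x\<bar>" for n
      proof (rule AE_I2)
        fix x
        show "norm (h x * \<phi> n x) \<le> \<bar>indicator (cball 0 R) x * h x\<bar>"
          using mult_left_mono[OF \<phi>(3)[of n x], of "\<bar>h x\<bar>"] by (simp add: abs_mult mult.commute)
      qed
      show "AE x in T. (\<lambda>n. h x * \<phi> n x) \<longlonglongrightarrow> h x * indicator K x"
        by (intro AE_I2 tendsto_mult tendsto_const \<phi>(4))
    qed (use h \<phi>(2) Kb in auto)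
    moreover have "(\<lambda>n. LINT x|T. h x * \<phi> n x) = (\<lambda>n. 0)" using z \<phi>(1) by blast
    ultimately show ?thesis by (simp add: LIMSEQ_const_iff mult.commute)
  qed
  \<comment> \<open>\<open>c\<close> is later taken as 1 and as -1, so one argument covers both
    signs.\<close>
  have half: "AE x in T. \<not> (x \<in> cball 0 R \<and> 0 < c * h x)" for R c
  proof -
    define A where "A = {x \<in> cball 0 R. 0 < c * h x}"
    have A: "A \<in> sets borel" "bounded A"
    proof -
      have "A = cball 0 R \<inter> {x. 0 < c * h x}" by (auto simp: A_def)
      moreover have "{x. 0 < c * h x} \<in> sets borel" using h(1) by measurable
      ultimately show "A \<in> sets borel" by simp
      show "bounded A" by (rule bounded_subset[OF bounded_cball[of 0 R]]) (auto simp: A_def)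
    qed
    have "measure T A < e" if e: "0 < e" for e
    proof -
      obtain K where K: "compact K" "K \<subseteq> A" "K \<subseteq> \<Gamma>" "measure T (A - K) < e"
        by (rule inner_compact[OF A e]) (rule that)
      have Kb: "K \<in> sets borel" using K(1) by (simp add: compact_imp_closed)
      have "(LINT x|T. indicator K x * (c * h x)) = 0"
        using zK[OF K(1,3)] by (simp add: mult.left_commute)
      moreover have "integrable T (\<lambda>x. indicator K x * (c * h x))"
      proof -
        have "integrable T (\<lambda>x. c * (indicator K x *\<^sub>R (indicator (cball 0 R) x * h x)))"
          by (intro integrable_mult_right integrable_mult_indicator h(2)) (simp add: Kb)
        also have "(\<lambda>x. c * (indicator K x *\<^sub>R (indicator (cball 0 R) x * h x))) = (\<lambda>x. indicator K x * (c * h x))"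
        proof
          fix x
          show "c * (indicator K x *\<^sub>R (indicator (cball 0 R) x * h x)) = indicator K x * (c * h x)"
            using K(2) by (cases "x \<in> K") (auto simp: A_def)
        qed
        finally show ?thesis .
      qed
      moreover have "AE x in T. 0 \<le> indicator K x * (c * h x)"
      proof (rule AE_I2)
        fix x show "0 \<le> indicator K x * (c * h x)"
          using K(2) by (cases "x \<in> K") (auto simp: A_def intro: less_imp_le)
      qed
      ultimately have "AE x in T. indicator K x * (c * h x) = 0"
        using integral_nonneg_eq_0_iff_AE by blast
      then have "AE x in T. x \<notin> K"
      proof (rule eventually_mono)
        fix x assume "indicator K x * (c * h x) = 0"
        then show "x \<notin> K" using K(2) by (cases "x \<in> K") (auto simp: A_def)
      qed
      then have "emeasure T K = 0"
        using AE_iff_measurable[of K T "\<lambda>x. x \<notin> K"] Kb by simp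
      moreover have "emeasure T A = emeasure T (A - K)"
      proof (rule emeasure_eq_AE)
        show "AE x in T. (x \<in> A) = (x \<in> A - K)"
          using \<open>AE x in T. x \<notin> K\<close> by (rule eventually_mono) simp
      qed (use A Kb in auto)
      ultimately show ?thesis using K(4) by (simp add: measure_def)
    qed
    then have "\<not> 0 < measure T A" by blast
    then have "measure T A = 0" using measure_nonneg[of T A] by linarith
    then have "emeasure T A = 0"
      using emeasure_bounded[OF A(2)] by (simp add: emeasure_eq_ennreal_measure)
    then show ?thesis
      using A(1) by (intro AE_I[of _ _ A]) (auto simp: A_def)
  qed
  have "AE x in T. \<forall>n::nat. \<not> (x \<in> cball 0 (real n) \<and> 0 < 1 * h x) \<and> \<not> (x \<in> cball 0 (real n) \<and> 0 < (- 1) * h x)"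
    unfolding AE_all_countable by (intro allI AE_conjI half)
  then show ?thesis
  proof eventually_elim
    case (elim x)
    obtain n :: nat where "norm x \<le> real n" using real_arch_simple by blast
    then show "h x = 0" using elim[rule_format, of n] by auto
  qed
qed

text \<open>Uniform boundedness of \<open>g k\<close> lets convergence spread by L1 approximation,
  from test functions to compact subsets of \<open>\<Gamma>\<close> and on to bounded Borel sets.
  There the result for finite measures applies.\<close>

lemma weak_limit_exists_locally:
  fixes g :: "nat \<Rightarrow> 'a \<Rightarrow> real"
  assumes g: "\<And>k. g k \<in> borel_measurable borel" "\<And>k x. \<bar>g k x\<bar> \<le> c"
    and conv: "\<And>\<phi>. \<phi> \<in> V \<Longrightarrow> convergent (\<lambda>k. LINT x|T. \<phi> x * g k x)"
  obtains u where "u \<in> borel_measurable borel" "\<And>x. \<bar>u x\<bar> \<le> c"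
    "\<And>f b R. f \<in> borel_measurable borel \<Longrightarrow> (\<forall>x. \<bar>f x\<bar> \<le> b * indicator (cball 0 R) x) \<Longrightarrow>
      (\<lambda>k. LINT x|T. f x * g k x) \<longlonglongrightarrow> (LINT x|T. f x * u x)"
proof -
  have c: "0 \<le> c" using g(2)[of 0 undefined] by linarith
  have gT: "g k \<in> borel_measurable T" for k using g(1) by simp
  have transfer: "convergent (\<lambda>k. LINT x|T. f x * g k x)"
    if f: "integrable T f"
      and ap: "\<And>e. 0 < e \<Longrightarrow> \<exists>f'. integrable T f' \<and> convergent (\<lambda>k. LINT x|T. f' x * g k x) \<and> (LINT x|T. \<bar>f x - f' x\<bar>) < e"
    for f
  proof (rule convergent_if_uniformly_approximable)
    fix e :: real assume e: "0 < e"
    \<comment> \<open>The denominator is \<open>c + 1\<close> because \<open>c\<close> may be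
      0.\<close>
    then have "0 < e / (c + 1)" using c by simp
    then obtain f' where f': "integrable T f'" "convergent (\<lambda>k. LINT x|T. f' x * g k x)" "(LINT x|T. \<bar>f x - f' x\<bar>) < e / (c + 1)"
      using ap[of "e / (c + 1)"] by auto
    have "\<bar>(LINT x|T. f x * g k x) - (LINT x|T. f' x * g k x)\<bar> \<le> e" for k
    proof -
      have "(LINT x|T. f x * g k x) - (LINT x|T. f' x * g k x) = (LINT x|T. (f x - f' x) * g k x)"
        using integrable_mult_bounded(1)[OF f gT g(2)] integrable_mult_bounded(1)[OF f'(1) gT g(2)]
        by (simp add: left_diff_distrib)
      also have "\<bar>\<dots>\<bar> \<le> c * (LINT x|T. \<bar>f x - f' x\<bar>)"
        by (rule integrable_mult_bounded(2)[OF Bochner_Integration.integrable_diff[OF f f'(1)] gT g(2)])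
      also have "\<dots> \<le> (c + 1) * (LINT x|T. \<bar>f x - f' x\<bar>)"
        by (intro mult_right_mono) auto
      also have "\<dots> \<le> (c + 1) * (e / (c + 1))"
        using f'(3) c by (intro mult_left_mono) auto
      also have "\<dots> = e" using c by simp
      finally show ?thesis .
    qed
    then show "\<exists>b. convergent b \<and> (\<forall>k. \<bar>(LINT x|T. f x * g k x) - b k\<bar> \<le> e)"
      by (intro exI[of _ "\<lambda>k. LINT x|T. f' x * g k x"] conjI allI f'(2))
  qed
  have convK: "convergent (\<lambda>k. LINT x|T. indicator K x * g k x)" if K: "compact K" "K \<subseteq> \<Gamma>" for K
  proof (rule transfer)
    have Kb: "K \<in> sets borel" using K(1) by (simp add: compact_imp_closed)
    show "integrable T (indicator K :: 'a \<Rightarrow> real)"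
      by (rule integrable_indicator_bounded[OF Kb compact_imp_bounded[OF K(1)]])
    fix e :: real assume e: "0 < e"
    obtain \<phi> R where \<phi>: "\<And>n::nat. \<phi> n \<in> V" "\<And>n. \<phi> n \<in> borel_measurable borel"
      "\<And>n x. \<bar>\<phi> n x\<bar> \<le> indicator (cball 0 R) x" "\<And>x. (\<lambda>n. \<phi> n x) \<longlonglongrightarrow> indicator K x"
      by (rule bump_sequence[OF K]) (rule that)
    have iR: "integrable T (indicator (cball 0 R) :: 'a \<Rightarrow> real)"
      by (rule integrable_indicator_bounded) auto
    have i: "integrable T (\<phi> n)" for n
      by (rule abs_integral_le(2)[OF iR]) (use \<phi>(2,3) in auto)
    have "(\<lambda>n. LINT x|T. \<bar>indicator K x - \<phi> n x\<bar>) \<longlonglongrightarrow> (LINT x|T. 0)"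
    proof (rule integral_dominated_convergence[where w = "\<lambda>x. indicator K x + indicator (cball 0 R) x"])
      show "AE x in T. (\<lambda>n. \<bar>indicator K x - \<phi> n x\<bar>) \<longlonglongrightarrow> 0"
      proof (rule AE_I2)
        fix x
        from tendsto_diff[OF tendsto_const[of "indicator K x"] \<phi>(4)[of x]]
        show "(\<lambda>n. \<bar>indicator K x - \<phi> n x\<bar>) \<longlonglongrightarrow> 0" using tendsto_rabs_zero by fastforce
      qed
      show "AE x in T. norm \<bar>indicator K x - \<phi> n x\<bar> \<le> indicator K x + indicator (cball 0 R) x" for n
      proof (rule AE_I2)
        fix x
        show "norm \<bar>indicator K x - \<phi> n x\<bar> \<le> indicator K x + indicator (cball 0 R) x"
          using \<phi>(3)[of n x] by (cases "x \<in> K") auto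
      qed
      show "integrable T (\<lambda>x. indicator K x + indicator (cball 0 R) x :: real)"
        by (intro Bochner_Integration.integrable_add iR integrable_indicator_bounded Kb compact_imp_bounded K)
    qed (use \<phi>(2) Kb in auto)
    then have "eventually (\<lambda>n. (LINT x|T. \<bar>indicator K x - \<phi> n x\<bar>) < e) sequentially"
      by (rule order_tendstoD(2)) (use e in simp)
    then obtain n where n: "(LINT x|T. \<bar>indicator K x - \<phi> n x\<bar>) < e"
      using eventually_happens'[OF sequentially_bot] by blast
    then show "\<exists>f'. integrable T f' \<and> convergent (\<lambda>k. LINT x|T. f' x * g k x) \<and> (LINT x|T. \<bar>indicator K x - f' x\<bar>) < e"
      using i[of n] conv[OF \<phi>(1)[of n]] n by (intro exI[of _ "\<phi> n"]) simp
  qed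
  have convA: "convergent (\<lambda>k. LINT x|T. indicator A x * g k x)" if A: "A \<in> sets borel" "bounded A" for A
  proof (rule transfer)
    show "integrable T (indicator A :: 'a \<Rightarrow> real)" by (rule integrable_indicator_bounded[OF A])
    fix e :: real assume e: "0 < e"
    obtain K where K: "compact K" "K \<subseteq> A" "K \<subseteq> \<Gamma>" "measure T (A - K) < e"
      by (rule inner_compact[OF A e]) (rule that)
    have Kb: "K \<in> sets borel" using K(1) by (simp add: compact_imp_closed)
    have "(LINT x|T. \<bar>indicator A x - indicator K x\<bar> :: real) = (LINT x|T. indicator (A - K) x)"
      using K(2) by (intro Bochner_Integration.integral_cong) (auto simp: indicator_def)
    also have "\<dots> = measure T (A - K)" using A Kb by simp
    finally show "\<exists>f'. integrable T f' \<and> convergent (\<lambda>k. LINT x|T. f' x * g k x) \<and> (LINT x|T. \<bar>indicator A x - f' x\<bar>) < e"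
      using integrable_indicator_bounded[OF Kb compact_imp_bounded[OF K(1)]] convK[OF K(1,3)] K(4)
      by (intro exI[of _ "indicator K"]) simp
  qed
  \<comment> \<open>Disjoint bounded shells, indexed by the integer part of the norm. A limit
    density is found on each, and \<open>u\<close> uses at \<open>x\<close> the one of the shell
    containing \<open>x\<close>.\<close>
  define P where "P = (\<lambda>i::nat. {x::'a. nat \<lfloor>norm x\<rfloor> = i})"
  have Pb: "P i \<in> sets borel" for i unfolding P_def by measurable
  have Pbd: "bounded (P i)" for i
  proof (rule boundedI)
    fix x assume "x \<in> P i"
    then have "real i = real_of_int \<lfloor>norm x\<rfloor>" unfolding P_def by (auto simp: of_nat_nat)
    then show "norm x \<le> real i + 1" by linarith
  qed
  define Ti where "Ti = (\<lambda>i. density T (indicator (P i)))"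
  have Ti_sets: "sets (Ti i) = sets borel" for i by (simp add: Ti_def)
  have Ti_int: "(LINT x|Ti i. f x) = (LINT x|T. indicator (P i) x * f x)" if "f \<in> borel_measurable borel" for i and f :: "'a \<Rightarrow> real"
  proof -
    have "Ti i = density T (\<lambda>x. ennreal (indicator (P i) x))"
      unfolding Ti_def by (intro arg_cong[of _ _ "density T"]) (auto simp: ennreal_indicator)
    then have "(LINT x|Ti i. f x) = (LINT x|T. indicator (P i) x *\<^sub>R f x)"
      by (simp only:) (rule integral_density, use that Pb in auto)
    then show ?thesis by simp
  qed
  define Q where "Q = (\<lambda>i u. u \<in> borel_measurable borel \<and> (\<forall>x. \<bar>u x\<bar> \<le> c) \<and>
    (\<forall>f. integrable (Ti i) f \<longrightarrow> (\<lambda>k. LINT x|Ti i. f x * g k x) \<longlonglongrightarrow> (LINT x|Ti i. f x * u x)))"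
  have ex: "\<exists>u. Q i u" for i
  proof -
    interpret Ti: finite_measure "Ti i"
      by standard (use emeasure_bounded[OF Pbd[of i]] Pb in \<open>simp add: Ti_def emeasure_restricted less_top\<close>)
    have gm: "g k \<in> borel_measurable (Ti i)" for k using g(1)[of k] measurable_cong_sets[OF Ti_sets refl] by blast
    have "convergent (\<lambda>k. LINT x|Ti i. indicator A x * g k x)" if "A \<in> sets (Ti i)" for A
    proof -
      have A: "A \<in> sets borel" using that Ti_sets by simp
      have "(LINT x|Ti i. indicator A x * g k x) = (LINT x|T. indicator (A \<inter> P i) x * g k x)" for k
      proof -
        have "(\<lambda>x. indicator A x * g k x) \<in> borel_measurable borel" using A g(1) by measurable
        from Ti_int[OF this] show ?thesis by (simp add: indicator_inter_arith mult_ac)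
      qed
      then show ?thesis using convA[of "A \<inter> P i"] A Pb Pbd by (simp add: bounded_Int)
    qed
    then show ?thesis
      using Ti.weak_limit_exists[OF gm g(2)] unfolding measurable_cong_sets[OF Ti_sets refl] Q_def by (simp add: Bex_def)
  qed
  define U where "U = (\<lambda>i. SOME u. Q i u)"
  have "Q i (U i)" for i
    unfolding U_def by (rule someI_ex[OF ex])
  then have U: "\<And>i. U i \<in> borel_measurable borel" "\<And>i x. \<bar>U i x\<bar> \<le> c"
    "\<And>i f. integrable (Ti i) f \<Longrightarrow> (\<lambda>k. LINT x|Ti i. f x * g k x) \<longlonglongrightarrow> (LINT x|Ti i. f x * U i x)"
    by (simp_all add: Q_def)
  define u where "u = (\<lambda>x. U (nat \<lfloor>norm x\<rfloor>) x)"
  have um: "u \<in> borel_measurable borel"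
    unfolding u_def by (rule measurable_compose_countable[OF U(1)]) measurable
  have ub: "\<bar>u x\<bar> \<le> c" for x using U(2) by (simp add: u_def)
  show thesis
  proof (rule that[OF um ub])
    fix f :: "'a \<Rightarrow> real" and b R
    assume "f \<in> borel_measurable borel" "\<forall>x. \<bar>f x\<bar> \<le> b * indicator (cball 0 R) x"
    then have f: "f \<in> borel_measurable borel" "\<And>x. \<bar>f x\<bar> \<le> b * indicator (cball 0 R) x" by simp_all
    define n where "n = nat \<lfloor>R\<rfloor>"
    have iR: "integrable T (\<lambda>x. b * indicator (cball 0 R) x)"
      by (intro integrable_mult_right integrable_indicator_bounded) auto
    have fi: "integrable T f"
      by (rule abs_integral_le(2)[OF iR]) (use f in auto)
    have fP: "f x = (\<Sum>i\<le>n. indicator (P i) x * f x)" for x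
    proof (cases "x \<in> cball 0 R")
      case True
      then have "nat \<lfloor>norm x\<rfloor> \<le> n" unfolding n_def by (intro nat_mono floor_mono) simp
      then have "(\<Sum>i\<le>n. indicator (P i) x * f x) = (\<Sum>i\<le>n. if i = nat \<lfloor>norm x\<rfloor> then f x else 0)"
        by (intro sum.cong) (auto simp: P_def)
      then show ?thesis using \<open>nat \<lfloor>norm x\<rfloor> \<le> n\<close> by simp
    next
      case False
      then have "f x = 0" using f(2)[of x] by simp
      then show ?thesis by simp
    qed
    have dec: "(LINT x|T. f x * h x) = (\<Sum>i\<le>n. LINT x|Ti i. f x * h x)"
      if h: "h \<in> borel_measurable borel" "\<And>x. \<bar>h x\<bar> \<le> c" for h
    proof -
      have hT: "h \<in> borel_measurable T" using h(1) by simp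
      have "(LINT x|T. f x * h x) = (LINT x|T. (\<Sum>i\<le>n. indicator (P i) x * (f x * h x)))"
        by (intro Bochner_Integration.integral_cong refl)
           (subst fP, simp add: sum_distrib_right mult.assoc)
      also have "\<dots> = (\<Sum>i\<le>n. LINT x|T. indicator (P i) x * (f x * h x))"
        using integrable_mult_indicator[OF _ integrable_mult_bounded(1)[OF fi hT h(2)]] Pb
        by (intro Bochner_Integration.integral_sum) simp
      also have "\<dots> = (\<Sum>i\<le>n. LINT x|Ti i. f x * h x)"
        using f(1) h(1) by (intro sum.cong refl) (subst Ti_int, auto)
      finally show ?thesis .
    qed
    have fTi: "integrable (Ti i) f" for i
    proof -
      have "Ti i = density T (\<lambda>x. ennreal (indicator (P i) x))"
        unfolding Ti_def by (intro arg_cong[of _ _ "density T"]) (auto simp: ennreal_indicator)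
      moreover have "integrable T (\<lambda>x. indicator (P i) x *\<^sub>R f x)"
        by (rule integrable_mult_indicator[OF _ fi]) (simp add: Pb)
      ultimately show ?thesis
        by (simp only:) (rule integrable_density[THEN iffD2], use Pb f(1) in auto)
    qed
    have "(\<lambda>k. \<Sum>i\<le>n. LINT x|Ti i. f x * g k x) \<longlonglongrightarrow> (\<Sum>i\<le>n. LINT x|Ti i. f x * U i x)"
      by (intro tendsto_sum U(3) fTi)
    also have "(\<Sum>i\<le>n. LINT x|Ti i. f x * U i x) = (\<Sum>i\<le>n. LINT x|Ti i. f x * u x)"
    proof (intro sum.cong refl)
      fix i
      have "(LINT x|T. indicator (P i) x * (f x * U i x)) = (LINT x|T. indicator (P i) x * (f x * u x))"
        by (intro Bochner_Integration.integral_cong refl) (auto simp: indicator_def P_def u_def)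
      then show "(LINT x|Ti i. f x * U i x) = (LINT x|Ti i. f x * u x)"
        using f(1) U(1) um by (subst (1 2) Ti_int) auto
    qed
    finally show "(\<lambda>k. LINT x|T. f x * g k x) \<longlonglongrightarrow> (LINT x|T. f x * u x)"
      unfolding dec[OF um ub] dec[OF g] .
  qed
qed

end

section \<open>Boundaries that are uniform graphs\<close>

text \<open>The Hessian bound and the vanishing gradient at the origin give a gradient of size at
  most \<open>L * norm x\<close>, and integrating once more gives quadratic smallness; the gradient
  bound gives the Lipschitz estimate.\<close>

lemma C2_holder_graph_bounds:
  fixes h :: "'m::euclidean_space \<Rightarrow> real"
  assumes g: "C2_holder_graph \<beta> r L h" and r: "0 < r"
  shows "h 0 = 0" "norm x \<le> r \<Longrightarrow> \<bar>h x\<bar> \<le> L * norm x * norm x"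
    "norm x \<le> r \<Longrightarrow> norm y \<le> r \<Longrightarrow> \<bar>h x - h y\<bar> \<le> L * norm (x - y)"
proof -
  obtain h1 h2 where H: "\<And>x. x \<in> cball 0 r \<Longrightarrow> (h has_derivative (\<lambda>y. h1 x \<bullet> y)) (at x within cball 0 r)"
    "\<And>x. x \<in> cball 0 r \<Longrightarrow> (h1 has_derivative blinfun_apply (h2 x)) (at x within cball 0 r)"
    "\<And>x. x \<in> cball 0 r \<Longrightarrow> norm (h1 x) \<le> L" "\<And>x. x \<in> cball 0 r \<Longrightarrow> norm (h2 x) \<le> L"
    "h1 0 = 0" "h 0 = 0"
    using g unfolding C2_holder_graph_def by blast
  show "h 0 = 0" by fact
  have on: "onorm (\<lambda>y. h1 x \<bullet> y) \<le> norm (h1 x)" for x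
    by (rule onorm_bound) (simp_all add: Cauchy_Schwarz_ineq2)
  have h1: "norm (h1 x) \<le> L * norm x" if "norm x \<le> r" for x
  proof -
    have "norm (h1 x - h1 0) \<le> L * norm (x - 0)"
    proof (rule differentiable_bound[OF convex_cball H(2)])
      show "onorm (blinfun_apply (h2 y)) \<le> L" if "y \<in> cball 0 r" for y
        using H(4)[OF that] by (simp add: norm_blinfun.rep_eq)
    qed (use that r in auto)
    then show ?thesis using H(5) by simp
  qed
  show "\<bar>h x\<bar> \<le> L * norm x * norm x" if x: "norm x \<le> r"
  proof -
    \<comment> \<open>The mean value estimate is used on the ball of radius \<open>norm x\<close>,
      where the gradient is at most \<open>L * norm x\<close>.\<close>
    have "norm (h x - h 0) \<le> (L * norm x) * norm (x - 0)"
    proof (rule differentiable_bound[OF convex_cball[of 0 "norm x"]])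
      fix y :: 'm assume y: "y \<in> cball 0 (norm x)"
      then have "y \<in> cball 0 r" using x by simp
      then show "(h has_derivative (\<lambda>u. h1 y \<bullet> u)) (at y within cball 0 (norm x))"
        by (rule has_derivative_subset[OF H(1)]) (use x in auto)
      have "0 \<le> L" using H(3)[of 0] r norm_ge_zero[of "h1 0"] by (simp del: norm_ge_zero)
      have "norm (h1 y) \<le> L * norm y" using h1 y x by simp
      also have "\<dots> \<le> L * norm x" using y \<open>0 \<le> L\<close> by (intro mult_left_mono) auto
      finally show "onorm (\<lambda>u. h1 y \<bullet> u) \<le> L * norm x" using on[of y] by linarith
    qed auto
    then show ?thesis using H(6) by simp
  qed
  show "\<bar>h x - h y\<bar> \<le> L * norm (x - y)" if xy: "norm x \<le> r" "norm y \<le> r"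
  proof -
    have "norm (h x - h y) \<le> L * norm (x - y)"
    proof (rule differentiable_bound[OF convex_cball H(1)])
      show "onorm (\<lambda>u. h1 z \<bullet> u) \<le> L" if "z \<in> cball 0 r" for z
        using on[of z] H(3)[OF that] by linarith
    qed (use xy in auto)
    then show ?thesis by simp
  qed
qed

text \<open>Records what the boundary side of the charts provides. The tubular neighbourhood of the
  original chart is replaced by a metric ball, so that a boundary point is known to lie on the graph
  as soon as it is within \<open>\<rho>\<close> of \<open>z\<close>.\<close>

definition graph_chart ::
  "real \<Rightarrow> real \<Rightarrow> real \<Rightarrow> ('m::euclidean_space \<times> real) set \<Rightarrow> 'm \<times> real \<Rightarrow> ('m \<times> real \<Rightarrow> 'm \<times> real) \<Rightarrow> ('m \<Rightarrow> real) \<Rightarrow> bool"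
where
  "graph_chart r \<rho> L \<Gamma> z T h \<longleftrightarrow>
     orthogonal_transformation T \<and> h 0 = 0 \<and>
     (\<forall>x. norm x < r \<longrightarrow> \<bar>h x\<bar> \<le> L * norm x * norm x \<and> z + T (x, h x) \<in> \<Gamma>) \<and>
     (\<forall>x y. norm x < r \<longrightarrow> norm y < r \<longrightarrow> \<bar>h x - h y\<bar> \<le> L * norm (x - y)) \<and>
     (\<forall>q\<in>\<Gamma>. dist z q < \<rho> \<longrightarrow> (\<exists>x. norm x < r \<and> q = z + T (x, h x)))"

lemma uniformly_C2_holder_domain_chart:
  fixes \<Omega> :: "('m::euclidean_space \<times> real) set"
  assumes "uniformly_C2_holder_domain \<beta> \<Omega>"
  obtains r \<rho> L where "0 < r" "0 < \<rho>" "0 < L" "\<And>z. z \<in> frontier \<Omega> \<Longrightarrow> \<exists>T h. graph_chart r \<rho> L (frontier \<Omega>) z T h"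
proof -
  obtain r \<eta> L where c: "0 < r" "0 < \<eta>" "0 < L"
    and ch: "\<forall>z0\<in>frontier \<Omega>. \<exists>(T :: 'm \<times> real \<Rightarrow> 'm \<times> real) (h :: 'm \<Rightarrow> real).
          orthogonal_transformation T \<and> C2_holder_graph \<beta> r L h \<and>
          (let \<Phi> = (\<lambda>y. z0 + T y);
               U = {(x', t). norm x' < r \<and> h x' - \<eta> < t \<and> t < h x' + \<eta>}
           in \<Omega> \<inter> \<Phi> ` U = \<Phi> ` {(x', t). norm x' < r \<and> h x' < t \<and> t < h x' + \<eta>} \<and>
              frontier \<Omega> \<inter> \<Phi> ` U = \<Phi> ` {(x', t). norm x' < r \<and> t = h x'})"
    using assms unfolding uniformly_C2_holder_domain_def by blast
  \<comment> \<open>If both chart coordinates are below \<open>\<rho>\<close>, the height above the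
    graph is less than \<open>\<rho> * (1 + L * r)\<close>, so this choice keeps the point inside
    the chart neighbourhood.\<close>
  define \<rho> where "\<rho> = min r (\<eta> / (1 + L * r))"
  have \<rho>: "0 < \<rho>" "\<rho> \<le> r" "\<rho> * (1 + L * r) \<le> \<eta>"
  proof -
    have p: "0 < 1 + L * r" using c by (simp add: add_pos_pos)
    then show "0 < \<rho>" "\<rho> \<le> r" using c by (auto simp: \<rho>_def)
    have "\<rho> \<le> \<eta> / (1 + L * r)" by (simp add: \<rho>_def)
    then show "\<rho> * (1 + L * r) \<le> \<eta>" using p by (simp add: pos_le_divide_eq)
  qed
  show thesis
  proof (rule that[OF c(1) \<rho>(1) c(3)])
    fix z assume z: "z \<in> frontier \<Omega>"
    from bspec[OF ch z] obtain T :: "'m \<times> real \<Rightarrow> 'm \<times> real" and h :: "'m \<Rightarrow> real" where Th: "orthogonal_transformation T \<and> C2_holder_graph \<beta> r L h \<and>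
          (let \<Phi> = (\<lambda>y. z + T y);
               U = {(x', t). norm x' < r \<and> h x' - \<eta> < t \<and> t < h x' + \<eta>}
           in \<Omega> \<inter> \<Phi> ` U = \<Phi> ` {(x', t). norm x' < r \<and> h x' < t \<and> t < h x' + \<eta>} \<and>
              frontier \<Omega> \<inter> \<Phi> ` U = \<Phi> ` {(x', t). norm x' < r \<and> t = h x'})"
      by (elim exE) (rule that)
    then have T: "orthogonal_transformation T" and h: "C2_holder_graph \<beta> r L h"
      by simp_all
    have F: "frontier \<Omega> \<inter> (\<lambda>y. z + T y) ` {(x', t). norm x' < r \<and> h x' - \<eta> < t \<and> t < h x' + \<eta>}
         = (\<lambda>y. z + T y) ` {(x', t). norm x' < r \<and> t = h x'}"
      using Th unfolding Let_def by (elim conjE)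
    note b = C2_holder_graph_bounds[OF h c(1)]
    have "z + T (x, h x) \<in> frontier \<Omega>" if "norm x < r" for x
    proof -
      have "z + T (x, h x) \<in> (\<lambda>y. z + T y) ` {(x', t). norm x' < r \<and> t = h x'}" using that by blast
      then show ?thesis unfolding F[symmetric] by blast
    qed
    moreover have "\<exists>x. norm x < r \<and> q = z + T (x, h x)" if q: "q \<in> frontier \<Omega>" "dist z q < \<rho>" for q
    proof -
      obtain y where y: "q - z = T y" using orthogonal_transformation_surj[OF T] by (metis surjD)
      obtain x t where xt: "y = (x, t)" by force
      have "norm y < \<rho>" using q(2) y orthogonal_transformation_norm[OF T, of y] by (simp add: dist_norm norm_minus_commute)
      then have n: "norm x < \<rho>" "\<bar>t\<bar> < \<rho>"
        using norm_fst_le[of x t] norm_snd_le[of t x] xt by (auto simp: real_norm_def[symmetric] simp del: real_norm_def)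
      then have nr: "norm x < r" using \<rho> by simp
      have "\<bar>h x\<bar> \<le> L * norm x * norm x" using b(2) nr by simp
      also have "\<dots> \<le> L * r * \<rho>" using n nr c by (intro mult_mono) auto
      finally have "\<bar>t - h x\<bar> < \<rho> + L * r * \<rho>" using n by linarith
      also have "\<dots> \<le> \<eta>" using \<rho>(3) by (simp add: algebra_simps)
      finally have "y \<in> {(x', t). norm x' < r \<and> h x' - \<eta> < t \<and> t < h x' + \<eta>}"
        using nr by (auto simp: xt abs_less_iff)
      moreover have "q = z + T y" using y by (simp add: algebra_simps)
      ultimately have "q \<in> (\<lambda>y. z + T y) ` {(x', t). norm x' < r \<and> t = h x'}"
        using q(1) F by blast
      then show ?thesis by blast
    qed
    ultimately have "graph_chart r \<rho> L (frontier \<Omega>) z T h"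
      unfolding graph_chart_def using T b by simp
    then show "\<exists>T h. graph_chart r \<rho> L (frontier \<Omega>) z T h" by blast
  qed
qed

text \<open>The constants are the same at every base point; the lower density of small boundary
  balls and the width of the layer with unique nearest points are expressed through them.\<close>

locale uniform_graph =
  fixes \<Gamma> :: "('m::euclidean_space \<times> real) set" and r \<rho> L :: real
  assumes pos: "0 < r" "0 < \<rho>" "0 < L" and closed: "closed \<Gamma>" and nonempty: "\<Gamma> \<noteq> {}"
    and chart: "\<And>z. z \<in> \<Gamma> \<Longrightarrow> \<exists>T h. graph_chart r \<rho> L \<Gamma> z T h"
begin

section \<open>Surface measure of boundary balls\<close>

text \<open>Orthogonal projection to the horizontal coordinates of the chart does not increase
  distances, and it maps the boundary ball onto a set containing a disc of radius
  \<open>e / (1 + L)\<close>.\<close>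

lemma hausdorff_lower_density:
  assumes z: "z \<in> \<Gamma>" and e: "0 < e" "e < r"
  shows "ennreal (unit_ball_vol (real DIM('m)) * (e / (1 + L)) ^ DIM('m)) \<le>
    2 ^ DIM('m) * hausdorff_outer DIM('m) (\<Gamma> \<inter> cball z e)"
proof -
  obtain T h where c: "graph_chart r \<rho> L \<Gamma> z T h" using chart[OF z] by blast
  then have T: "orthogonal_transformation T" by (simp add: graph_chart_def)
  \<comment> \<open>As \<open>h 0 = 0\<close>, the Lipschitz bound puts the graph point over
    \<open>x\<close> within \<open>(1 + L) * norm x\<close> of the centre.\<close>
  define s where "s = e / (1 + L)"
  have s: "0 < s" "s \<le> e" "s * (1 + L) = e"
    using pos e by (auto simp: s_def pos_divide_le_eq)
  define f where "f = (\<lambda>q. fst (inv T (q - z)))"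
  have lin: "linear (inv T)" and nrm: "norm (inv T y) = norm y" for y
    using orthogonal_transformation_inv[OF T] by (auto simp: orthogonal_transformation_norm orthogonal_transformation_linear)
  have "emeasure lborel (cball (0::'m) s) \<le> 2 ^ DIM('m) * hausdorff_outer DIM('m) (\<Gamma> \<inter> cball z e)"
  proof (rule emeasure_lborel_le_hausdorff_outer)
    show "dist (f x) (f y) \<le> dist x y" for x y
    proof -
      have "dist (f x) (f y) = norm (fst (inv T (x - z) - inv T (y - z)))" by (simp add: f_def dist_norm)
      also have "inv T (x - z) - inv T (y - z) = inv T (x - y)"
        using linear_diff[OF lin, of "x - z" "y - z"] by simp
      also have "norm (fst (inv T (x - y))) \<le> norm (inv T (x - y))" by (metis norm_fst_le prod.collapse)
      finally show ?thesis by (simp add: nrm dist_norm)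
    qed
    show "cball 0 s \<subseteq> f ` (\<Gamma> \<inter> cball z e)"
    proof
      fix x :: 'm assume x: "x \<in> cball 0 s"
      then have nx: "norm x < r" using s e by simp
      have "\<bar>h x\<bar> \<le> L * norm x"
        using c nx pos unfolding graph_chart_def by (metis diff_zero norm_zero)
      have "norm (T (x, h x)) \<le> norm x + \<bar>h x\<bar>"
        using orthogonal_transformation_norm[OF T] norm_Pair_le[of x "h x"] by simp
      also have "\<dots> \<le> norm x * (1 + L)" using \<open>\<bar>h x\<bar> \<le> L * norm x\<close> by (simp add: algebra_simps)
      also have "\<dots> \<le> s * (1 + L)" using x pos by (intro mult_right_mono) auto
      finally have "norm (T (x, h x)) \<le> e" using s by simp
      then have "z + T (x, h x) \<in> \<Gamma> \<inter> cball z e"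
        using c nx by (auto simp: graph_chart_def dist_norm)
      moreover have "f (z + T (x, h x)) = x"
        using orthogonal_transformation_inj[OF T] by (simp add: f_def)
      ultimately show "x \<in> f ` (\<Gamma> \<inter> cball z e)" by (metis imageI)
    qed
  qed
  then show ?thesis using s by (simp add: emeasure_cball s_def)
qed

text \<open>Near \<open>z\<close> the boundary lies in a Lipschitz image of a disc. The radius
  \<open>r / 2\<close> keeps the closed disc strictly inside the domain of the chart.\<close>

lemma hausdorff_locally_finite:
  assumes z: "z \<in> \<Gamma>"
  shows "hausdorff_outer DIM('m) (\<Gamma> \<inter> ball z (min \<rho> (r / 2))) < top"
proof -
  obtain T h where c: "graph_chart r \<rho> L \<Gamma> z T h" using chart[OF z] by blast
  then have T: "orthogonal_transformation T" by (simp add: graph_chart_def)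
  define f where "f = (\<lambda>x. z + T (x, h x))"
  have "\<Gamma> \<inter> ball z (min \<rho> (r / 2)) \<subseteq> f ` cball 0 (r / 2)"
  proof
    fix q assume q: "q \<in> \<Gamma> \<inter> ball z (min \<rho> (r / 2))"
    then obtain x where x: "q = z + T (x, h x)" using c by (auto simp: graph_chart_def)
    have "norm x \<le> norm (x, h x)" by (rule norm_fst_le)
    also have "\<dots> = dist z q" using orthogonal_transformation_norm[OF T] by (simp add: x dist_norm)
    finally have "x \<in> cball 0 (r / 2)" using q by simp
    then show "q \<in> f ` cball 0 (r / 2)" unfolding x f_def by (rule imageI)
  qed
  then have "hausdorff_outer DIM('m) (\<Gamma> \<inter> ball z (min \<rho> (r / 2))) \<le> hausdorff_outer DIM('m) (f ` cball 0 (r / 2))"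
    by (rule hausdorff_outer_mono)
  also have "\<dots> < top"
  proof (rule hausdorff_outer_lipschitz_image[where L = "1 + L"])
    fix x y :: 'm assume xy: "x \<in> cball 0 (r / 2)" "y \<in> cball 0 (r / 2)"
    have "dist (f x) (f y) = norm (T ((x, h x) - (y, h y)))"
      using linear_diff[OF orthogonal_transformation_linear[OF T], of "(x, h x)" "(y, h y)"] by (simp add: f_def dist_norm)
    also have "\<dots> = norm (x - y, h x - h y)" using orthogonal_transformation_norm[OF T] by simp
    also have "\<dots> \<le> norm (x - y) + \<bar>h x - h y\<bar>" using norm_Pair_le[of "x - y" "h x - h y"] by simp
    also have "\<dots> \<le> norm (x - y) + L * norm (x - y)"
      using c xy pos by (intro add_left_mono) (auto simp: graph_chart_def)
    finally show "dist (f x) (f y) \<le> (1 + L) * dist x y" by (simp add: dist_norm algebra_simps)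
  qed (use pos in auto)
  finally show ?thesis .
qed

lemma hausdorff_finite_cball: "emeasure (hausdorff_measure DIM('m)) (\<Gamma> \<inter> cball 0 R) < top"
proof -
  let ?s = "min \<rho> (r / 2)"
  have cpt: "compact (\<Gamma> \<inter> cball 0 R)" using closed by (intro closed_Int_compact) auto
  have cov: "\<Gamma> \<inter> cball 0 R \<subseteq> (\<Union>z\<in>\<Gamma>. ball z ?s)" using pos by force
  obtain F where F: "F \<subseteq> \<Gamma>" "finite F" "\<Gamma> \<inter> cball 0 R \<subseteq> (\<Union>z\<in>F. ball z ?s)"
    by (rule compactE_image[OF cpt open_ball cov]) (rule that)
  have "emeasure (hausdorff_measure DIM('m)) (\<Gamma> \<inter> cball 0 R)
      \<le> emeasure (hausdorff_measure DIM('m)) (\<Union>z\<in>F. \<Gamma> \<inter> ball z ?s)"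
  proof (rule emeasure_mono)
    have "(\<Union>z\<in>F. \<Gamma> \<inter> ball z ?s) \<in> sets borel"
      by (rule sets.finite_UN) (use F closed in auto)
    then show "(\<Union>z\<in>F. \<Gamma> \<inter> ball z ?s) \<in> sets (hausdorff_measure DIM('m))"
      unfolding sets_hausdorff_measure .
  qed (use F in blast)
  also have "\<dots> \<le> (\<Sum>z\<in>F. emeasure (hausdorff_measure DIM('m)) (\<Gamma> \<inter> ball z ?s))"
    by (rule emeasure_subadditive_finite) (use F closed in auto)
  also have "\<dots> < top"
  proof -
    have "emeasure (hausdorff_measure DIM('m)) (\<Gamma> \<inter> ball z ?s) < top" if "z \<in> F" for z
      using hausdorff_locally_finite[of z] F(1) that closed by (subst emeasure_hausdorff_measure) auto
    then have fin: "\<forall>z\<in>F. emeasure (hausdorff_measure DIM('m)) (\<Gamma> \<inter> ball z ?s) < top" by blast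
    show ?thesis using F(2) fin
      by (induction F rule: finite_induct) (auto simp: less_top[symmetric])
  qed
  finally show ?thesis .
qed

text \<open>
  In the chart at \<open>p\<close> the point \<open>x\<close> lies on the vertical axis, and the graph stays below
  \<open>L \<bar>y\<bar>\<^sup>2\<close>. The quadratic gap gives uniqueness and continuity of the nearest point without the
  inverse function theorem.
\<close>

lemma nearest_point_gap:
  assumes p: "p \<in> \<Gamma>" "\<And>q. q \<in> \<Gamma> \<Longrightarrow> dist x p \<le> dist x q"
    and q: "q \<in> \<Gamma>" "dist p q < \<rho>"
  shows "(dist x p)\<^sup>2 + (1 - 2 * L * dist x p) * (dist p q)\<^sup>2 \<le> (dist x q)\<^sup>2"
proof -
  obtain T h where c: "graph_chart r \<rho> L \<Gamma> p T h" using chart[OF p(1)] by blast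
  then have T: "orthogonal_transformation T" by (simp add: graph_chart_def)
  obtain w where w: "x - p = T w" using orthogonal_transformation_surj[OF T] by (metis surjD)
  obtain a b where ab: "w = (a, b)" by force
  have lin: "linear T" by (rule orthogonal_transformation_linear[OF T])
  have dx: "(dist x p)\<^sup>2 = a \<bullet> a + b\<^sup>2"
    using w orthogonal_transformation_norm[OF T, of w] ab by (simp add: dist_norm norm_Pair dot_square_norm)
  have dy: "(dist x (p + T (y, h y)))\<^sup>2 = (a - y) \<bullet> (a - y) + (b - h y)\<^sup>2" for y
  proof -
    have "x - (p + T (y, h y)) = T (w - (y, h y))"
      using w linear_diff[OF lin, of w "(y, h y)"] by (simp add: algebra_simps)
    then show ?thesis
      using orthogonal_transformation_norm[OF T, of "w - (y, h y)"] ab by (simp add: dist_norm norm_Pair dot_square_norm)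
  qed
  have min: "a \<bullet> a + b\<^sup>2 \<le> (a - y) \<bullet> (a - y) + (b - h y)\<^sup>2" if "norm y < r" for y
  proof -
    have "p + T (y, h y) \<in> \<Gamma>" using c that by (simp add: graph_chart_def)
    then have "(dist x p)\<^sup>2 \<le> (dist x (p + T (y, h y)))\<^sup>2" by (intro power_mono p(2)) auto
    then show ?thesis by (simp add: dx dy)
  qed
  have hb: "\<bar>h y\<bar> \<le> L * norm y * norm y" if "norm y < r" for y using c that by (simp add: graph_chart_def)
  \<comment> \<open>First-order condition without derivatives: sliding along the graph from
    \<open>p\<close> in the direction \<open>a\<close> gains a term linear in the step size and
    costs only quadratic ones.\<close>
  have a0: "a = 0"
  proof (rule ccontr)
    assume "a \<noteq> 0"
    then have A: "0 < norm a" by simp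
    \<comment> \<open>Collects the quadratic costs in units of
      \<open>s\<^sup>2 * (norm a)\<^sup>2\<close>: the displacement, the cross term with
      \<open>b\<close>, and the squared height. With \<open>s * M \<le> 1\<close> the linear gain
      wins.\<close>
    define M where "M = 1 + 2 * \<bar>b\<bar> * L + L\<^sup>2 * (norm a)\<^sup>2"
    have M: "1 \<le> M" using pos by (simp add: M_def)
    define s where "s = min 1 (min (r / (2 * norm a)) (1 / M))"
    have s: "0 < s" "s \<le> 1" "s * norm a < r" "s * M \<le> 1"
    proof -
      show "0 < s" "s \<le> 1" using pos A M by (auto simp: s_def)
      have "s \<le> r / (2 * norm a)" by (simp add: s_def)
      then have "s * norm a \<le> r / 2" using A by (simp add: pos_le_divide_eq mult_ac)
      then show "s * norm a < r" using pos by simp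
      have "s \<le> 1 / M" by (simp add: s_def)
      then show "s * M \<le> 1" using M by (simp add: pos_le_divide_eq)
    qed
    define y where "y = s *\<^sub>R a"
    have ny: "norm y = s * norm a" "norm y < r" using s by (simp_all add: y_def)
    have h1: "\<bar>h y\<bar> \<le> L * s\<^sup>2 * (norm a)\<^sup>2"
      using hb[OF ny(2)] by (simp add: ny power2_eq_square mult_ac)
    have "- 2 * b * h y \<le> 2 * \<bar>b\<bar> * (L * s\<^sup>2 * (norm a)\<^sup>2)"
    proof -
      have "- 2 * b * h y \<le> 2 * (\<bar>b\<bar> * \<bar>h y\<bar>)" by (simp add: abs_mult[symmetric])
      also have "\<dots> \<le> 2 * (\<bar>b\<bar> * (L * s\<^sup>2 * (norm a)\<^sup>2))" using h1 by (intro mult_left_mono) auto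
      finally show ?thesis by simp
    qed
    moreover have "(h y)\<^sup>2 \<le> L\<^sup>2 * (norm a)\<^sup>2 * (s\<^sup>2 * (norm a)\<^sup>2)"
    proof -
      have "(h y)\<^sup>2 \<le> (L * s\<^sup>2 * (norm a)\<^sup>2)\<^sup>2" using h1 power_mono[OF h1, of 2] by simp
      also have "\<dots> = (L\<^sup>2 * (norm a)\<^sup>2 * (s\<^sup>2 * (norm a)\<^sup>2)) * s\<^sup>2" by (simp add: power2_eq_square mult_ac)
      also have "\<dots> \<le> (L\<^sup>2 * (norm a)\<^sup>2 * (s\<^sup>2 * (norm a)\<^sup>2)) * 1"
        using s by (intro mult_left_mono) (auto simp: power_le_one)
      finally show ?thesis by simp
    qed
    moreover have "0 \<le> - 2 * (s * (norm a)\<^sup>2) + s\<^sup>2 * (norm a)\<^sup>2 - 2 * b * h y + (h y)\<^sup>2"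
    proof -
      have "(a - y) \<bullet> (a - y) = a \<bullet> a - 2 * (s * (norm a)\<^sup>2) + s\<^sup>2 * (norm a)\<^sup>2"
        unfolding power2_norm_eq_inner
        by (simp add: y_def inner_diff_left inner_diff_right power2_eq_square algebra_simps)
      then show ?thesis using min[OF ny(2)] by (simp add: power2_diff)
    qed
    ultimately have "2 * (s * (norm a)\<^sup>2) \<le> s\<^sup>2 * (norm a)\<^sup>2 * M"
      by (simp add: M_def algebra_simps)
    also have "\<dots> = (s * (norm a)\<^sup>2) * (s * M)" by (simp add: power2_eq_square)
    also have "\<dots> \<le> (s * (norm a)\<^sup>2) * 1" using s by (intro mult_left_mono) auto
    finally have "s * (norm a)\<^sup>2 \<le> 0" by simp
    then show False using s A by (simp add: mult_le_0_iff)
  qed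
  have db: "dist x p = \<bar>b\<bar>" using dx a0 by (metis add_0 inner_zero_left real_sqrt_abs real_sqrt_unique zero_le_dist)
  obtain y where y: "norm y < r" "q = p + T (y, h y)" using c q by (auto simp: graph_chart_def)
  have "(dist x q)\<^sup>2 = norm y * norm y + (b - h y)\<^sup>2" using dy[of y] a0 by (simp add: y dot_square_norm power2_eq_square)
  moreover have pq: "(dist p q)\<^sup>2 = norm y * norm y + (h y)\<^sup>2"
    using orthogonal_transformation_norm[OF T, of "(y, h y)"] by (simp add: y dist_norm norm_Pair power2_eq_square)
  \<comment> \<open>With \<open>a = 0\<close> this cross term is the only one that could bring
    \<open>q\<close> closer to \<open>x\<close> than \<open>p\<close>; the quadratic bound on the
    graph controls it.\<close>
  moreover have "2 * b * h y \<le> 2 * L * dist x p * (dist p q)\<^sup>2"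
  proof -
    have "b * h y \<le> \<bar>b\<bar> * \<bar>h y\<bar>" by (simp add: abs_mult[symmetric])
    also have "\<dots> \<le> \<bar>b\<bar> * (L * (norm y * norm y))" using hb[OF y(1)] by (intro mult_left_mono) (auto simp: mult_ac)
    also have "\<dots> \<le> \<bar>b\<bar> * (L * (dist p q)\<^sup>2)" using pq pos by (intro mult_left_mono) auto
    finally show ?thesis by (simp add: db mult_ac)
  qed
  ultimately show ?thesis using dx a0 by (simp add: power2_diff algebra_simps)
qed

section \<open>The nearest point and the gradient of the distance\<close>

definition near_point :: "'m \<times> real \<Rightarrow> 'm \<times> real" where
  "near_point x = (SOME p. p \<in> \<Gamma> \<and> infdist x \<Gamma> = dist x p)"

lemma near_point: "near_point x \<in> \<Gamma>" "infdist x \<Gamma> = dist x (near_point x)" "q \<in> \<Gamma> \<Longrightarrow> dist x (near_point x) \<le> dist x q"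
proof -
  have "\<exists>p. p \<in> \<Gamma> \<and> infdist x \<Gamma> = dist x p"
    using infdist_attains_inf[OF closed nonempty] by metis
  then have *: "near_point x \<in> \<Gamma> \<and> infdist x \<Gamma> = dist x (near_point x)"
    unfolding near_point_def by (rule someI_ex)
  then show "near_point x \<in> \<Gamma>" "infdist x \<Gamma> = dist x (near_point x)" by auto
  show "dist x (near_point x) \<le> dist x q" if "q \<in> \<Gamma>" using * infdist_le[OF that, of x] by simp
qed

text \<open>The bound \<open>1 / (4 * L)\<close> makes the gap coefficient
  \<open>1 - 2 * L * dist x p\<close> at least 1/2, and \<open>\<rho> / 4\<close> keeps the nearest
  points of neighbouring points within one chart.\<close>

definition reach :: real where "reach = min (\<rho> / 4) (1 / (4 * L))"

lemma reach_pos: "0 < reach" using pos by (simp add: reach_def)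

text \<open>The nearest point of \<open>y\<close> is almost nearest for a close \<open>x\<close>,
  and by the quadratic gap an almost nearest point must be close to the nearest one.\<close>

lemma near_point_continuous:
  assumes x: "infdist x \<Gamma> < reach"
  shows "isCont near_point x"
proof -
  let ?d = "infdist x \<Gamma>"
  have d: "0 \<le> ?d" "?d < \<rho> / 4" "2 * L * ?d \<le> 1/2"
  proof -
    have "?d \<le> 1 / (4 * L)" using x by (simp add: reach_def)
    then have "?d * (4 * L) \<le> 1" using pos by (simp add: pos_le_divide_eq)
    then show "2 * L * ?d \<le> 1/2" by (simp add: mult_ac)
  qed (use x in \<open>auto simp: reach_def infdist_nonneg\<close>)
  \<comment> \<open>Both factors 8 come from the increment 4 d t + 4 t^2 of the square of d + 2 t,
    with t the distance of \<open>x\<close> and \<open>y\<close>, divided by the gap coefficient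
    1/2.\<close>
  have est: "(dist (near_point x) (near_point y))\<^sup>2 \<le> 8 * ?d * dist x y + 8 * (dist x y)\<^sup>2" if y: "dist x y < \<rho> / 4" for y
  proof -
    let ?p = "near_point x" let ?q = "near_point y"
    have dy: "infdist y \<Gamma> \<le> ?d + dist x y" using infdist_triangle[of y \<Gamma> x] by (simp add: dist_commute)
    have xq: "dist x ?q \<le> ?d + 2 * dist x y"
      using dist_triangle[of x ?q y] near_point(2)[of y] dy by simp
    have "dist ?p ?q \<le> dist x ?p + dist x ?q" using dist_triangle[of ?p ?q x] by (simp add: dist_commute)
    also have "\<dots> \<le> 2 * ?d + 2 * dist x y" using xq near_point(2)[of x] by simp
    also have "\<dots> < \<rho>" using d y by simp
    finally have "?d\<^sup>2 + (1 - 2 * L * ?d) * (dist ?p ?q)\<^sup>2 \<le> (dist x ?q)\<^sup>2"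
      using nearest_point_gap[OF near_point(1)[of x] near_point(3)[of _ x] near_point(1)[of y]] near_point(2)[of x] by simp
    moreover have "(1/2) * (dist ?p ?q)\<^sup>2 \<le> (1 - 2 * L * ?d) * (dist ?p ?q)\<^sup>2"
      using d by (intro mult_right_mono) auto
    moreover have "(dist x ?q)\<^sup>2 \<le> (?d + 2 * dist x y)\<^sup>2" using xq by (intro power_mono) auto
    moreover have "(?d + 2 * dist x y)\<^sup>2 = ?d\<^sup>2 + 4 * ?d * dist x y + 4 * (dist x y)\<^sup>2"
      by (simp add: power2_sum power_mult_distrib)
    ultimately show ?thesis by linarith
  qed
  have "((\<lambda>y. (dist (near_point x) (near_point y))\<^sup>2) \<longlongrightarrow> 0) (at x)"
  proof (rule tendsto_sandwich[of "\<lambda>_. 0"])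
    have "((\<lambda>y. 8 * ?d * dist x y + 8 * (dist x y)\<^sup>2) \<longlongrightarrow> 8 * ?d * dist x x + 8 * (dist x x)\<^sup>2) (at x)"
      by (intro tendsto_intros)
    then show "((\<lambda>y. 8 * ?d * dist x y + 8 * (dist x y)\<^sup>2) \<longlongrightarrow> 0) (at x)" by simp
    show "\<forall>\<^sub>F y in at x. (dist (near_point x) (near_point y))\<^sup>2 \<le> 8 * ?d * dist x y + 8 * (dist x y)\<^sup>2"
      unfolding eventually_at using est pos by (intro exI[of _ "\<rho> / 4"]) (auto simp: dist_commute)
  qed auto
  from tendsto_real_sqrt[OF this]
  have "((\<lambda>y. dist (near_point y) (near_point x)) \<longlongrightarrow> 0) (at x)" by (simp add: dist_commute)
  then show ?thesis unfolding isCont_def by (rule tendsto_dist_iff[THEN iffD2])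
qed

text \<open>Off \<open>\<Gamma>\<close> and within the reach this is the gradient of the distance;
  in the domain it points inward, opposite to the exterior normal. The choice of nearest point makes
  it total.\<close>

definition normal :: "'m \<times> real \<Rightarrow> 'm \<times> real" where
  "normal x = (x - near_point x) /\<^sub>R infdist x \<Gamma>"

text \<open>The squared distance is a minimum of squared distances to fixed points. Freezing the
  minimiser at \<open>x\<close> or at \<open>y\<close> bounds its increment from both sides, and
  continuity of the nearest point closes the gap; the square root is harmless off
  \<open>\<Gamma>\<close>.\<close>

lemma infdist_has_derivative:
  assumes x: "infdist x \<Gamma> < reach" "x \<notin> \<Gamma>"
  shows "((\<lambda>y. infdist y \<Gamma>) has_derivative (\<lambda>u. normal x \<bullet> u)) (at x)"
proof -
  let ?p = near_point
  have pos': "0 < infdist x \<Gamma>" using x(2) infdist_pos_not_in_closed[OF closed nonempty] by simp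
  define D where "D = (\<lambda>y. (infdist y \<Gamma>)\<^sup>2)"
  have Dp: "D y = (y - ?p y) \<bullet> (y - ?p y)" for y by (simp add: D_def near_point(2) dist_norm dot_square_norm)
  have Dle: "D y \<le> (y - ?p z) \<bullet> (y - ?p z)" for y z
  proof -
    have "infdist y \<Gamma> \<le> dist y (?p z)" by (rule infdist_le[OF near_point(1)])
    then have "(infdist y \<Gamma>)\<^sup>2 \<le> (dist y (?p z))\<^sup>2" by (intro power_mono infdist_nonneg)
    then show ?thesis by (simp add: D_def dist_norm dot_square_norm)
  qed
  have "(D has_derivative (\<lambda>u. 2 * ((x - ?p x) \<bullet> u))) (at x)"
  proof (rule has_derivativeI_sandwich[of 1])
    show "bounded_linear (\<lambda>u. 2 * ((x - ?p x) \<bullet> u))"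
      by (intro bounded_linear_const_mult bounded_linear_inner_right)
    show "((\<lambda>y. 2 * norm (?p x - ?p y) + norm (y - x)) \<longlongrightarrow> 0) (at x)"
    proof -
      have "((\<lambda>y. 2 * norm (?p x - ?p y) + norm (y - x)) \<longlongrightarrow> 2 * norm (?p x - ?p x) + norm (x - x)) (at x)"
        using near_point_continuous[OF x(1)] unfolding isCont_def by (intro tendsto_intros)
      then show ?thesis by simp
    qed
    fix y assume yx: "y \<in> UNIV" "y \<noteq> x" "dist y x < 1"
    define u where "u = y - x"
    have u: "y = x + u" "0 < norm u" using yx by (simp_all add: u_def)
    \<comment> \<open>Upper bound by keeping the nearest point of \<open>x\<close>; the lower bound
      that follows keeps the nearest point of \<open>y\<close>.\<close>
    have "D y \<le> (y - ?p x) \<bullet> (y - ?p x)" by (rule Dle)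
    also have "\<dots> = D x + 2 * ((x - ?p x) \<bullet> u) + u \<bullet> u"
      by (simp add: Dp u(1) inner_diff_left inner_diff_right inner_add_left inner_add_right inner_commute algebra_simps)
    finally have up: "D y - D x - 2 * ((x - ?p x) \<bullet> u) \<le> u \<bullet> u" by simp
    have "D x \<le> (x - ?p y) \<bullet> (x - ?p y)" by (rule Dle)
    also have "\<dots> = D y - 2 * ((x - ?p x) \<bullet> u) - 2 * (u \<bullet> (?p x - ?p y)) - u \<bullet> u"
      by (simp add: Dp u(1) inner_diff_left inner_diff_right inner_add_left inner_add_right inner_commute algebra_simps)
    finally have "- (2 * (u \<bullet> (?p y - ?p x))) + u \<bullet> u \<le> D y - D x - 2 * ((x - ?p x) \<bullet> u)"
      by (simp add: inner_diff_right)
    moreover have "u \<bullet> (?p y - ?p x) \<le> norm u * norm (?p x - ?p y)"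
      using norm_cauchy_schwarz[of u "?p y - ?p x"] by (simp add: norm_minus_commute)
    moreover have "u \<bullet> u = norm u * norm u" by (simp add: dot_square_norm power2_eq_square)
    ultimately have "\<bar>D y - D x - 2 * ((x - ?p x) \<bullet> u)\<bar> \<le> norm u * (2 * norm (?p x - ?p y) + norm u)"
      using up u(2) norm_ge_zero[of "?p x - ?p y"] unfolding abs_le_iff
      by (smt (verit, ccfv_SIG) distrib_left mult.left_commute mult_nonneg_nonneg)
    then show "norm (D y - D x - 2 * ((x - ?p x) \<bullet> (y - x))) / norm (y - x) \<le> 2 * norm (?p x - ?p y) + norm (y - x)"
      using u(2) by (simp add: u_def[symmetric] pos_divide_le_eq mult.commute)
  qed simp
  note DD = this
  have Dpos: "0 < D x" using pos' by (simp add: D_def)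
  have sq: "sqrt (D y) = infdist y \<Gamma>" for y by (simp add: D_def infdist_nonneg)
  have "((\<lambda>y. sqrt (D y)) has_derivative (\<lambda>u. normal x \<bullet> u)) (at x)"
    by (rule has_derivative_eq_rhs[OF has_derivative_real_sqrt[OF Dpos DD]])
       (auto simp: sq normal_def mult.commute)
  then show ?thesis by (simp add: sq)
qed

lemma normal_continuous: "continuous_on {x. x \<notin> \<Gamma> \<and> infdist x \<Gamma> < reach} normal"
proof (intro continuous_at_imp_continuous_on ballI)
  fix x assume x: "x \<in> {x. x \<notin> \<Gamma> \<and> infdist x \<Gamma> < reach}"
  have "infdist x \<Gamma> \<noteq> 0" using x infdist_pos_not_in_closed[OF closed nonempty, of x] by simp
  then show "isCont normal x"
    unfolding normal_def using x near_point_continuous[of x]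
    by (intro continuous_intros) auto
qed

end

section \<open>Weak divergence against test functions of class C1\<close>

lemma integrable_inner_bounded:
  fixes f g :: "'a \<Rightarrow> 'b::euclidean_space"
  assumes f: "integrable M f" and g: "g \<in> borel_measurable M" "\<And>x. norm (g x) \<le> b"
  shows "integrable M (\<lambda>x. f x \<bullet> g x)" "\<bar>LINT x|M. f x \<bullet> g x\<bar> \<le> b * (LINT x|M. norm (f x))"
proof -
  have le: "\<bar>f x \<bullet> g x\<bar> \<le> b * norm (f x)" for x
  proof -
    have "\<bar>f x \<bullet> g x\<bar> \<le> norm (f x) * norm (g x)" by (rule Cauchy_Schwarz_ineq2)
    also have "\<dots> \<le> norm (f x) * b" by (intro mult_left_mono g) auto
    finally show ?thesis by (simp add: mult.commute)
  qed
  have i: "integrable M (\<lambda>x. b * norm (f x))" using f by simp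
  have m: "(\<lambda>x. f x \<bullet> g x) \<in> borel_measurable M" using f g by measurable
  show "integrable M (\<lambda>x. f x \<bullet> g x)" by (rule abs_integral_le(2)[OF i m]) (simp add: le)
  show "\<bar>LINT x|M. f x \<bullet> g x\<bar> \<le> b * (LINT x|M. norm (f x))"
    using abs_integral_le(1)[OF i m] le by simp
qed

lemma integral_inner_uniform_limit:
  fixes f g :: "'a \<Rightarrow> 'b::euclidean_space"
  assumes f: "integrable M f" and g: "g \<in> borel_measurable M" "\<And>x. norm (g x) \<le> b"
    and h: "\<And>n. h n \<in> borel_measurable M" "\<And>n x. norm (h n x - g x) \<le> e n" "e \<longlonglongrightarrow> 0"
  shows "(\<lambda>n::nat. LINT x|M. f x \<bullet> h n x) \<longlonglongrightarrow> (LINT x|M. f x \<bullet> g x)"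
proof -
  have d: "norm ((LINT x|M. f x \<bullet> h n x) - (LINT x|M. f x \<bullet> g x)) \<le> e n * (LINT x|M. norm (f x))" for n
  proof -
    have m: "(\<lambda>x. h n x - g x) \<in> borel_measurable M" using h(1) g(1) by measurable
    have "integrable M (\<lambda>x. f x \<bullet> (h n x - g x) + f x \<bullet> g x)"
      by (rule Bochner_Integration.integrable_add[OF integrable_inner_bounded(1)[OF f m h(2)] integrable_inner_bounded(1)[OF f g]])
    then have "integrable M (\<lambda>x. f x \<bullet> h n x)" by (simp add: inner_diff_right)
    then have "(LINT x|M. f x \<bullet> h n x) - (LINT x|M. f x \<bullet> g x) = (LINT x|M. f x \<bullet> (h n x - g x))"
      using integrable_inner_bounded(1)[OF f g] by (simp add: inner_diff_right)
    then show ?thesis using integrable_inner_bounded(2)[OF f m h(2)] by simp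
  qed
  have "(\<lambda>n. e n * (LINT x|M. norm (f x))) \<longlonglongrightarrow> 0 * (LINT x|M. norm (f x))"
    by (intro tendsto_intros h(3))
  then have "(\<lambda>n. e n * (LINT x|M. norm (f x))) \<longlonglongrightarrow> 0" by simp
  from Lim_null_comparison[OF always_eventually[OF allI[OF d]] this]
  have "(\<lambda>n. (LINT x|M. f x \<bullet> h n x) - (LINT x|M. f x \<bullet> g x)) \<longlonglongrightarrow> 0" .
  then show ?thesis by (simp add: LIM_zero_iff)
qed

lemma bounded_if_continuous_compact_support:
  fixes f :: "'a::euclidean_space \<Rightarrow> 'b::real_normed_vector"
  assumes "continuous_on UNIV f" "compact K" "\<And>x. x \<notin> K \<Longrightarrow> f x = 0"
  shows "\<exists>b\<ge>0. \<forall>x. norm (f x) \<le> b"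
proof -
  have "compact (f ` K)"
    by (rule compact_continuous_image[OF continuous_on_subset[OF assms(1) subset_UNIV] assms(2)])
  from compact_imp_bounded[OF this, unfolded bounded_iff]
  obtain b where b: "\<forall>y\<in>f ` K. norm y \<le> b" ..
  have "norm (f x) \<le> max b 0" for x
  proof (cases "x \<in> K")
    case True
    then have "norm (f x) \<le> b" using b by simp
    then show ?thesis by (rule max.coboundedI1)
  next
    case False
    then show ?thesis by (simp add: assms(3))
  qed
  then show ?thesis by (intro exI[of _ "max b 0"]) simp
qed

lemma continuous_borel_measurable_lebesgue:
  fixes f :: "'a::euclidean_space \<Rightarrow> 'b::euclidean_space"
  assumes "continuous_on UNIV f"
  shows "f \<in> borel_measurable lebesgue"
proof -
  have "f \<in> borel_measurable borel" by (rule borel_measurable_continuous_onI[OF assms])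
  then have "f \<in> borel_measurable lborel" by simp
  then show ?thesis by (rule measurable_completion)
qed

text \<open>Smooth approximations converge uniformly together with their gradients, and all supports
  stay in one compact subset of \<open>D\<close>, on which \<open>v\<close> and \<open>w\<close> are
  integrable.\<close>

lemma weak_divergence_C1:
  fixes v :: "'a::euclidean_space \<Rightarrow> 'a" and \<psi> :: "'a \<Rightarrow> real"
  assumes D: "open D" and v: "L1_loc D v" and w: "weak_divergence_on D v w"
    and \<psi>: "Ck 1 \<psi>" "compact (supp \<psi>)" "supp \<psi> \<subseteq> D"
  shows "(LINT x:D|lebesgue. w x * \<psi> x) = - (LINT x:D|lebesgue. v x \<bullet> grad \<psi> x)"
proof -
  obtain d where d: "d > 0" "(\<Union>x\<in>supp \<psi>. cball x d) \<subseteq> D"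
    using compact_subset_open_imp_cball_epsilon_subset[OF \<psi>(2) D \<psi>(3)] by blast
  \<comment> \<open>The closed \<open>d\<close>-neighbourhood of the support, written as a sum of
    compact sets to have its compactness.\<close>
  define K where "K = {x + y |x y. x \<in> supp \<psi> \<and> y \<in> cball 0 d}"
  have K: "compact K" unfolding K_def by (rule compact_sums[OF \<psi>(2) compact_cball])
  have near: "x \<in> K" if "y \<in> supp \<psi>" "dist x y \<le> d" for x y
    unfolding K_def by (rule CollectI, rule exI[of _ y], rule exI[of _ "x - y"]) (use that in \<open>simp add: dist_norm norm_minus_commute\<close>)
  have KD: "K \<subseteq> D"
  proof
    fix z assume "z \<in> K"
    then obtain x y where "z = x + y" "x \<in> supp \<psi>" "norm y \<le> d" unfolding K_def by auto
    then have "z \<in> cball x d" by (simp add: dist_norm)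
    then show "z \<in> D" using d(2) \<open>x \<in> supp \<psi>\<close> by blast
  qed
  define e where "e = (\<lambda>n::nat. min d (1 / real (Suc n)))"
  have e: "0 < e n" "e n \<le> d" "e n \<le> 1 / real (Suc n)" for n using d by (auto simp: e_def)
  have e0: "e \<longlonglongrightarrow> 0"
    by (rule tendsto_sandwich[of "\<lambda>_. 0" e sequentially "\<lambda>n. 1 / real (Suc n)"])
       (use e LIMSEQ_inverse_real_of_nat in \<open>auto intro!: always_eventually less_imp_le simp: inverse_eq_divide\<close>)
  have "\<forall>n. \<exists>\<eta>. (\<forall>k. Ck k \<eta>) \<and> (\<forall>x. \<eta> x \<noteq> 0 \<longrightarrow> (\<exists>y. \<psi> y \<noteq> 0 \<and> dist x y < e n)) \<and>
     (\<forall>x. \<bar>\<eta> x - \<psi> x\<bar> \<le> e n) \<and> (\<forall>x. norm (grad \<eta> x - grad \<psi> x) \<le> e n)"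
  proof
    fix n
    obtain \<eta> where "\<And>k. Ck k \<eta>" "\<And>x. \<eta> x \<noteq> 0 \<Longrightarrow> \<exists>y. \<psi> y \<noteq> 0 \<and> dist x y < e n"
      "\<And>x. \<bar>\<eta> x - \<psi> x\<bar> \<le> e n" "\<And>x. norm (grad \<eta> x - grad \<psi> x) \<le> e n"
      by (rule smooth_approximation[OF \<psi>(1,2) e(1)[of n]]) (rule that)
    then show "\<exists>\<eta>. (\<forall>k. Ck k \<eta>) \<and> (\<forall>x. \<eta> x \<noteq> 0 \<longrightarrow> (\<exists>y. \<psi> y \<noteq> 0 \<and> dist x y < e n)) \<and>
     (\<forall>x. \<bar>\<eta> x - \<psi> x\<bar> \<le> e n) \<and> (\<forall>x. norm (grad \<eta> x - grad \<psi> x) \<le> e n)"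
      by (intro exI[of _ \<eta>]) simp
  qed
  from choice[OF this] obtain \<eta> where "\<forall>n. (\<forall>k. Ck k (\<eta> n)) \<and> (\<forall>x. \<eta> n x \<noteq> 0 \<longrightarrow> (\<exists>y. \<psi> y \<noteq> 0 \<and> dist x y < e n)) \<and>
     (\<forall>x. \<bar>\<eta> n x - \<psi> x\<bar> \<le> e n) \<and> (\<forall>x. norm (grad (\<eta> n) x - grad \<psi> x) \<le> e n)"
    by (elim exE) (rule that)
  then have \<eta>: "\<And>n k. Ck k (\<eta> n)" "\<And>n x. \<eta> n x \<noteq> 0 \<Longrightarrow> \<exists>y. \<psi> y \<noteq> 0 \<and> dist x y < e n"
     "\<And>n x. \<bar>\<eta> n x - \<psi> x\<bar> \<le> e n" "\<And>n x. norm (grad (\<eta> n) x - grad \<psi> x) \<le> e n"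
    by simp_all
  have \<eta>K: "supp (\<eta> n) \<subseteq> K" for n
    unfolding supp_def[of "\<eta> n"]
  proof (rule closure_minimal[OF _ compact_imp_closed[OF K]], rule subsetI)
    fix x assume "x \<in> {x. \<eta> n x \<noteq> 0}"
    then obtain y where "\<psi> y \<noteq> 0" "dist x y < e n" using \<eta>(2)[of n x] by auto
    moreover have "y \<in> supp \<psi>" using \<open>\<psi> y \<noteq> 0\<close> supp_zero[of y \<psi>] by (cases "y \<in> supp \<psi>") simp_all
    ultimately show "x \<in> K" using near[of y x] e(2)[of n] by simp
  qed
  have \<psi>K: "supp \<psi> \<subseteq> K"
  proof
    fix x assume "x \<in> supp \<psi>"
    then show "x \<in> K" using near[of x x] d by simp
  qed
  have cpt: "compact (supp (\<eta> n))" for n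
    using compact_Int_closed[OF K, of "supp (\<eta> n)"] \<eta>K[of n] by (simp add: supp_def Int_absorb1)
  have iw: "integrable lebesgue (\<lambda>x. indicator K x *\<^sub>R w x)" and iv: "integrable lebesgue (\<lambda>x. indicator K x *\<^sub>R v x)"
    using w v K KD unfolding weak_divergence_on_def L1_loc_def set_integrable_def by simp_all
  have onK: "(LINT x:D|lebesgue. w x * \<phi> x) = (LINT x|lebesgue. (indicator K x *\<^sub>R w x) \<bullet> \<phi> x)"
     "(LINT x:D|lebesgue. v x \<bullet> grad \<phi> x) = (LINT x|lebesgue. (indicator K x *\<^sub>R v x) \<bullet> grad \<phi> x)"
    if "supp \<phi> \<subseteq> K" for \<phi>
  proof -
    have "x \<notin> K \<Longrightarrow> \<phi> x = 0 \<and> grad \<phi> x = 0" for x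
      using subsetD[OF that, of x] supp_zero[of x \<phi>] grad_zero_outside_supp[of x \<phi>] by auto
    then show "(LINT x:D|lebesgue. w x * \<phi> x) = (LINT x|lebesgue. (indicator K x *\<^sub>R w x) \<bullet> \<phi> x)"
     "(LINT x:D|lebesgue. v x \<bullet> grad \<phi> x) = (LINT x|lebesgue. (indicator K x *\<^sub>R v x) \<bullet> grad \<phi> x)"
      unfolding set_lebesgue_integral_def using KD
      by (intro Bochner_Integration.integral_cong refl; auto simp: indicator_def)+
  qed
  have c: "continuous_on UNIV \<phi> \<and> continuous_on UNIV (grad \<phi>)" if "Ck 1 \<phi>" for \<phi> :: "'a \<Rightarrow> real"
    using that[unfolded Ck_1_iff] Ck_1_continuous[OF that] by blast
  have m: "\<phi> \<in> borel_measurable lebesgue" "grad \<phi> \<in> borel_measurable lebesgue" if "Ck 1 \<phi>" for \<phi> :: "'a \<Rightarrow> real"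
    using c[OF that] by (simp_all add: continuous_borel_measurable_lebesgue)
  obtain b1 where b1: "\<And>x. norm (\<psi> x) \<le> b1"
    using bounded_if_continuous_compact_support[OF conjunct1[OF c[OF \<psi>(1)]] \<psi>(2)] supp_zero[of _ \<psi>] by meson
  obtain b2 where b2: "\<And>x. norm (grad \<psi> x) \<le> b2"
    using bounded_if_continuous_compact_support[OF conjunct2[OF c[OF \<psi>(1)]] \<psi>(2)] grad_zero_outside_supp[of _ \<psi>] by meson
  have "(\<lambda>n. LINT x|lebesgue. (indicator K x *\<^sub>R w x) \<bullet> \<eta> n x) \<longlonglongrightarrow> (LINT x|lebesgue. (indicator K x *\<^sub>R w x) \<bullet> \<psi> x)"
    by (rule integral_inner_uniform_limit[OF iw m(1)[OF \<psi>(1)] b1 m(1)[OF \<eta>(1)] _ e0]) (use \<eta>(3) in simp)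
  moreover have "(\<lambda>n. LINT x|lebesgue. (indicator K x *\<^sub>R v x) \<bullet> grad (\<eta> n) x) \<longlonglongrightarrow> (LINT x|lebesgue. (indicator K x *\<^sub>R v x) \<bullet> grad \<psi> x)"
    by (rule integral_inner_uniform_limit[OF iv m(2)[OF \<psi>(1)] b2 m(2)[OF \<eta>(1)] \<eta>(4) e0])
  then have "(\<lambda>n. - (LINT x|lebesgue. (indicator K x *\<^sub>R v x) \<bullet> grad (\<eta> n) x)) \<longlonglongrightarrow> - (LINT x|lebesgue. (indicator K x *\<^sub>R v x) \<bullet> grad \<psi> x)"
    by (rule tendsto_minus)
  moreover have "(LINT x|lebesgue. (indicator K x *\<^sub>R w x) \<bullet> \<eta> n x) = - (LINT x|lebesgue. (indicator K x *\<^sub>R v x) \<bullet> grad (\<eta> n) x)" for n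
  proof -
    have "(\<forall>k. Ck k (\<eta> n)) \<and> compact (supp (\<eta> n)) \<and> supp (\<eta> n) \<subseteq> D" using \<eta>(1) cpt \<eta>K KD by blast
    then have "(LINT x:D|lebesgue. w x * \<eta> n x) = - (LINT x:D|lebesgue. v x \<bullet> grad (\<eta> n) x)"
      using w unfolding weak_divergence_on_def by blast
    then show ?thesis unfolding onK[OF \<eta>K] .
  qed
  ultimately have "(LINT x|lebesgue. (indicator K x *\<^sub>R w x) \<bullet> \<psi> x) = - (LINT x|lebesgue. (indicator K x *\<^sub>R v x) \<bullet> grad \<psi> x)"
    by (simp only:) (rule LIMSEQ_unique)
  then show ?thesis unfolding onK[OF \<psi>K] .
qed

section \<open>A C1 step function\<close>

definition sq_pos :: "real \<Rightarrow> real" where "sq_pos u = (max 0 u)\<^sup>2"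

lemma sq_pos_deriv: "(sq_pos has_real_derivative 2 * max 0 u) (at u)"
proof -
  consider "u < 0" | "u = 0" | "u > 0" by linarith
  then show ?thesis
  proof cases
    case 1
    have "(sq_pos has_real_derivative 0) (at u)"
      by (rule DERIV_cong_ev[THEN iffD1, OF refl _ refl DERIV_const[of 0]])
         (use 1 in \<open>auto simp: sq_pos_def intro!: eventually_mono[OF eventually_nhds_in_open[of "{..<0}" u]]\<close>)
    then show ?thesis using 1 by simp
  next
    case 2
    have "((\<lambda>h. max 0 (h::real)) \<longlongrightarrow> max 0 0) (at 0)" by (intro tendsto_intros)
    then have "((\<lambda>h. max 0 (h::real)) \<longlongrightarrow> 0) (at 0)" by simp
    then have "((\<lambda>h. (sq_pos (0 + h) - sq_pos 0) / h) \<longlongrightarrow> 0) (at 0)"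
      by (rule Lim_transform_eventually)
         (auto simp: sq_pos_def power2_eq_square eventually_at max_def intro!: exI[of _ 1])
    then show ?thesis using 2 by (simp add: DERIV_def)
  next
    case 3
    have "((\<lambda>u. u\<^sup>2) has_real_derivative 2 * u) (at u)" by (auto intro!: derivative_eq_intros)
    then have "(sq_pos has_real_derivative 2 * u) (at u)"
      by (rule DERIV_cong_ev[THEN iffD1, OF refl _ refl, rotated])
         (use 3 in \<open>auto simp: sq_pos_def intro!: eventually_mono[OF eventually_nhds_in_open[of "{0<..}" u]]\<close>)
    then show ?thesis using 3 by simp
  qed
qed

text \<open>\<open>sq_pos (2 * t - 1)\<close> leaves 0 with zero slope at 1/2 and reaches 1 at 1;
  the outer \<open>1 - sq_pos (1 - _)\<close> flattens the arrival at 1. The result is C1 and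
  constant outside the interval from 1/2 to 1.\<close>

definition step :: "real \<Rightarrow> real" where "step t = 1 - sq_pos (1 - sq_pos (2 * t - 1))"
definition step' :: "real \<Rightarrow> real" where "step' t = 8 * max 0 (1 - sq_pos (2 * t - 1)) * max 0 (2 * t - 1)"

lemma step_deriv: "(step has_real_derivative step' t) (at t)"
proof -
  have "((\<lambda>t. sq_pos (2 * t - 1)) has_real_derivative (2 * max 0 (2 * t - 1)) * 2) (at t)"
    by (rule DERIV_chain2[OF sq_pos_deriv]) (auto intro!: derivative_eq_intros)
  then have "((\<lambda>t. 1 - sq_pos (2 * t - 1)) has_real_derivative 0 - (2 * max 0 (2 * t - 1)) * 2) (at t)"
    by (intro DERIV_diff DERIV_const)
  from DERIV_chain2[OF sq_pos_deriv this]
  have "((\<lambda>t. 1 - sq_pos (1 - sq_pos (2 * t - 1))) has_real_derivative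
    0 - (2 * max 0 (1 - sq_pos (2 * t - 1))) * (0 - (2 * max 0 (2 * t - 1)) * 2)) (at t)"
    by (intro DERIV_diff DERIV_const)
  moreover have "step = (\<lambda>t. 1 - sq_pos (1 - sq_pos (2 * t - 1)))" by (rule ext) (rule step_def)
  ultimately show ?thesis by (simp add: step'_def mult.assoc)
qed

lemma continuous_sq_pos: "continuous_on S sq_pos"
  unfolding sq_pos_def by (intro continuous_intros)

lemma continuous_step: "continuous_on S step"
  by (intro continuous_at_imp_continuous_on ballI DERIV_isCont[OF step_deriv])

lemma continuous_step': "continuous_on S step'"
  unfolding step'_def
  by (intro continuous_intros continuous_on_compose2[OF continuous_sq_pos[of UNIV]]) auto

lemma sq_pos_bounds: "0 \<le> sq_pos u" "u \<le> 0 \<Longrightarrow> sq_pos u = 0" "u \<le> 1 \<Longrightarrow> sq_pos u \<le> 1" "1 \<le> u \<Longrightarrow> 1 \<le> sq_pos u" "sq_pos 1 = 1"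
  by (auto simp: sq_pos_def max_def power_le_one one_le_power)

lemma step_zero: "t \<le> 1/2 \<Longrightarrow> step t = 0" "t \<le> 1/2 \<Longrightarrow> step' t = 0"
  by (simp_all add: step_def step'_def sq_pos_bounds)

lemma step_one: "1 \<le> t \<Longrightarrow> step t = 1" "1 \<le> t \<Longrightarrow> step' t = 0"
  using sq_pos_bounds(4)[of "2 * t - 1"] by (simp_all add: step_def step'_def sq_pos_bounds)

lemma step_range: "0 \<le> step t" "step t \<le> 1"
  using sq_pos_bounds(1)[of "2 * t - 1"] sq_pos_bounds(1)[of "1 - sq_pos (2 * t - 1)"]
    sq_pos_bounds(3)[of "1 - sq_pos (2 * t - 1)"] by (simp_all add: step_def)

text \<open>For \<open>t \<le> 1\<close> both positive parts in \<open>step'\<close> are at most 1,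
  and beyond 1 it vanishes. This 8 enters the constant of the trace estimate.\<close>

lemma step'_range: "0 \<le> step' t" "step' t \<le> 8"
proof -
  show "0 \<le> step' t" by (simp add: step'_def)
  show "step' t \<le> 8"
  proof (cases "t \<le> 1")
    case True
    have "max 0 (1 - sq_pos (2 * t - 1)) * max 0 (2 * t - 1) \<le> 1 * 1"
      using True sq_pos_bounds(1)[of "2 * t - 1"] by (intro mult_mono) auto
    then show ?thesis by (simp add: step'_def)
  qed (simp add: step_one)
qed

section \<open>Smearing a field onto the boundary\<close>

text \<open>Required for Fubini on the product of a boundary measure with Lebesgue measure.\<close>

lemma sigma_finite_lebesgue: "sigma_finite_measure (lebesgue :: 'a::euclidean_space measure)"
proof
  show "\<exists>A. countable A \<and> A \<subseteq> sets (lebesgue :: 'a measure) \<and> \<Union> A = space (lebesgue :: 'a measure) \<and>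
      (\<forall>a\<in>A. emeasure (lebesgue :: 'a measure) a \<noteq> \<infinity>)"
  proof (intro exI conjI ballI)
    show "countable (range (\<lambda>n. cball (0::'a) (real n)))" by simp
    show "range (\<lambda>n. cball (0::'a) (real n)) \<subseteq> sets lebesgue" by auto
    show "\<Union> (range (\<lambda>n. cball (0::'a) (real n))) = space lebesgue"
      by (auto simp: real_arch_simple)
    fix a assume "a \<in> range (\<lambda>n. cball (0::'a) (real n))"
    then show "emeasure lebesgue a \<noteq> \<infinity>" by (auto simp: emeasure_cball)
  qed
qed

lemma measurable_ident_lebesgue_borel: "(\<lambda>x. x) \<in> lebesgue \<rightarrow>\<^sub>M borel"
  by (rule measurable_completion) simp

context locally_finite_borel
begin

lemma sigma_finite_T: "sigma_finite_measure T"
proof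
  show "\<exists>A. countable A \<and> A \<subseteq> sets T \<and> \<Union> A = space T \<and> (\<forall>a\<in>A. emeasure T a \<noteq> \<infinity>)"
  proof (intro exI conjI ballI)
    show "countable (range (\<lambda>n. cball (0::'a) (real n)))" by simp
    show "range (\<lambda>n. cball (0::'a) (real n)) \<subseteq> sets T" by auto
    show "\<Union> (range (\<lambda>n. cball (0::'a) (real n))) = space T"
      by (auto simp: real_arch_simple)
    fix a assume "a \<in> range (\<lambda>n. cball (0::'a) (real n))"
    then show "emeasure T a \<noteq> \<infinity>" using finite_cball by (auto simp: less_top)
  qed
qed

section \<open>The kernel coupling boundary points and points of the domain\<close>

text \<open>Here \<open>y\<close> ranges over the boundary and \<open>x\<close> over the space. The
  free weight \<open>\<Psi>\<close> allows the constant 1, a test function at \<open>y\<close>, one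
  at \<open>x\<close>, or their difference, so one integrability proof serves all.\<close>

definition kernel :: "real \<Rightarrow> ('a \<Rightarrow> 'a \<Rightarrow> real) \<Rightarrow> ('a \<Rightarrow> real) \<Rightarrow> 'a \<Rightarrow> 'a \<Rightarrow> real" where
  "kernel s \<Psi> q y x = indicator \<Gamma> y * indicator (cball y s) x * \<Psi> y x * q x"

lemma kernel_measurable:
  assumes q: "q \<in> borel_measurable lebesgue" and \<Psi>: "case_prod \<Psi> \<in> borel_measurable (T \<Otimes>\<^sub>M lebesgue)"
  shows "case_prod (kernel s \<Psi> q) \<in> borel_measurable (T \<Otimes>\<^sub>M lebesgue)"
proof -
  have f: "fst \<in> borel_measurable (T \<Otimes>\<^sub>M (lebesgue :: 'a measure))"
    using measurable_fst[of T lebesgue] by (simp cong: measurable_cong_sets)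
  have sn: "snd \<in> borel_measurable (T \<Otimes>\<^sub>M (lebesgue :: 'a measure))"
    by (rule measurable_compose[OF measurable_snd measurable_ident_lebesgue_borel])
  have "(\<lambda>z. dist (fst z) (snd z)) \<in> borel_measurable (T \<Otimes>\<^sub>M (lebesgue :: 'a measure))"
    by (rule borel_measurable_dist[OF f sn])
  then have i: "(\<lambda>z. indicator {..s} (dist (fst z) (snd z)) :: real) \<in> borel_measurable (T \<Otimes>\<^sub>M (lebesgue :: 'a measure))"
    by (rule measurable_compose) simp
  have g: "(\<lambda>z. indicator \<Gamma> (fst z) :: real) \<in> borel_measurable (T \<Otimes>\<^sub>M (lebesgue :: 'a measure))"
    by (rule measurable_compose[OF f]) (use closed_\<Gamma> in simp)
  have qs: "(\<lambda>z. q (snd z)) \<in> borel_measurable (T \<Otimes>\<^sub>M (lebesgue :: 'a measure))"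
    by (rule measurable_compose[OF measurable_snd q])
  have "(\<lambda>z. indicator \<Gamma> (fst z) * indicator {..s} (dist (fst z) (snd z)) * case_prod \<Psi> z * q (snd z)) \<in> borel_measurable (T \<Otimes>\<^sub>M lebesgue)"
    by (intro borel_measurable_times g i \<Psi> qs)
  also have "(\<lambda>z. indicator \<Gamma> (fst z) * indicator {..s} (dist (fst z) (snd z)) * case_prod \<Psi> z * q (snd z)) = case_prod (kernel s \<Psi> q)"
    by (auto simp: kernel_def fun_eq_iff indicator_def)
  finally show ?thesis .
qed

text \<open>Tonelli with the integral over \<open>x\<close> inside: at each boundary point the mass
  of \<open>q\<close> in the ball is at most \<open>M\<close>, and the weight confines
  \<open>y\<close> to a ball of finite measure.\<close>

lemma kernel_integrable:
  assumes q: "q \<in> borel_measurable lebesgue" and \<Psi>: "case_prod \<Psi> \<in> borel_measurable (T \<Otimes>\<^sub>M lebesgue)"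
    and M: "0 \<le> M" "\<And>y. y \<in> \<Gamma> \<Longrightarrow> (\<integral>\<^sup>+ x\<in>cball y s. ennreal \<bar>q x\<bar> \<partial>lebesgue) \<le> ennreal M"
    and b: "0 \<le> b" "\<And>y x. y \<in> \<Gamma> \<Longrightarrow> x \<in> cball y s \<Longrightarrow> \<bar>\<Psi> y x\<bar> \<le> b * indicator (cball 0 R) y"
  shows "integrable (T \<Otimes>\<^sub>M lebesgue) (case_prod (kernel s \<Psi> q))"
    "\<bar>LINT y|T. LINT x|lebesgue. kernel s \<Psi> q y x\<bar> \<le> b * M * measure T (cball 0 R)"
proof -
  interpret T: sigma_finite_measure T by (rule sigma_finite_T)
  interpret leb: sigma_finite_measure "lebesgue :: 'a measure" by (rule sigma_finite_lebesgue)
  interpret P: pair_sigma_finite T "lebesgue :: 'a measure" ..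
  let ?P = "kernel s \<Psi> q"
  have m: "case_prod ?P \<in> borel_measurable (T \<Otimes>\<^sub>M lebesgue)" by (rule kernel_measurable[OF q \<Psi>])
  have inner: "(\<integral>\<^sup>+ x. ennreal \<bar>?P y x\<bar> \<partial>lebesgue) \<le> ennreal (b * M) * indicator (cball 0 R) y" for y
  proof (cases "y \<in> \<Gamma>")
    case True
    have "(\<integral>\<^sup>+ x. ennreal \<bar>?P y x\<bar> \<partial>lebesgue) \<le> (\<integral>\<^sup>+ x. ennreal (b * indicator (cball 0 R) y) * (ennreal \<bar>q x\<bar> * indicator (cball y s) x) \<partial>lebesgue)"
    proof (rule nn_integral_mono)
      fix x
      show "ennreal \<bar>?P y x\<bar> \<le> ennreal (b * indicator (cball 0 R) y) * (ennreal \<bar>q x\<bar> * indicator (cball y s) x)"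
      proof (cases "x \<in> cball y s")
        case x: True
        have "\<bar>?P y x\<bar> \<le> (b * indicator (cball 0 R) y) * \<bar>q x\<bar>"
          using True x mult_right_mono[OF b(2)[OF True x], of "\<bar>q x\<bar>"] by (simp add: kernel_def abs_mult)
        then show ?thesis using x b(1) by (simp add: ennreal_mult'[symmetric] ennreal_leI)
      qed (simp add: kernel_def)
    qed
    also have "\<dots> = ennreal (b * indicator (cball 0 R) y) * (\<integral>\<^sup>+ x\<in>cball y s. ennreal \<bar>q x\<bar> \<partial>lebesgue)"
    proof (rule nn_integral_cmult)
      have "(indicator (cball y s) :: 'a \<Rightarrow> ennreal) \<in> borel_measurable lebesgue"
        by (rule borel_measurable_indicator) simp
      then show "(\<lambda>x. ennreal \<bar>q x\<bar> * indicator (cball y s) x) \<in> borel_measurable lebesgue"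
        using q by measurable
    qed
    also have "\<dots> \<le> ennreal (b * indicator (cball 0 R) y) * ennreal M"
      by (intro mult_left_mono M True) simp
    also have "\<dots> = ennreal (b * M) * indicator (cball 0 R) y"
      using b(1) M(1) by (cases "y \<in> cball 0 R") (simp_all add: ennreal_mult)
    finally show ?thesis .
  qed (simp add: kernel_def)
  have "(\<integral>\<^sup>+ z. ennreal (norm (case_prod ?P z)) \<partial>(T \<Otimes>\<^sub>M lebesgue)) = (\<integral>\<^sup>+ y. \<integral>\<^sup>+ x. ennreal (norm (case_prod ?P (y, x))) \<partial>lebesgue \<partial>T)"
    by (rule leb.nn_integral_fst[symmetric]) (use m in measurable)
  also have "\<dots> \<le> (\<integral>\<^sup>+ y. ennreal (b * M) * indicator (cball 0 R) y \<partial>T)"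
    by (intro nn_integral_mono) (use inner in simp)
  also have "\<dots> = ennreal (b * M) * emeasure T (cball 0 R)"
    by (rule nn_integral_cmult_indicator) simp
  also have "\<dots> = ennreal (b * M * measure T (cball 0 R))"
    using finite_cball[of R] b(1) M(1) by (simp add: emeasure_eq_ennreal_measure less_top ennreal_mult)
  finally have nn: "(\<integral>\<^sup>+ z. ennreal (norm (case_prod ?P z)) \<partial>(T \<Otimes>\<^sub>M lebesgue)) \<le> ennreal (b * M * measure T (cball 0 R))" .
  show i: "integrable (T \<Otimes>\<^sub>M lebesgue) (case_prod ?P)"
    by (rule integrableI_bounded[OF m]) (unfold infinity_ennreal_def, rule order_le_less_trans[OF nn ennreal_less_top])
  have "(LINT y|T. LINT x|lebesgue. ?P y x) = (LINT z|(T \<Otimes>\<^sub>M lebesgue). case_prod ?P z)"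
    using P.integral_fst'[OF i] by simp
  moreover have "ennreal (norm (LINT z|(T \<Otimes>\<^sub>M lebesgue). case_prod ?P z)) \<le> ennreal (b * M * measure T (cball 0 R))"
    using integral_norm_bound_ennreal[OF i] nn by (rule order_trans)
  ultimately show "\<bar>LINT y|T. LINT x|lebesgue. ?P y x\<bar> \<le> b * M * measure T (cball 0 R)"
    using b(1) M(1) by (simp add: ennreal_le_iff)
qed

text \<open>
  The mass of \<open>k\<close> at \<open>x\<close> is spread evenly over the ball of radius \<open>s\<close> around \<open>x\<close>; if that ball has
  measure \<open>0\<close>, the division makes its contribution \<open>0\<close>.
\<close>

definition smear :: "real \<Rightarrow> ('a \<Rightarrow> real) \<Rightarrow> 'a \<Rightarrow> real" where
  "smear s k y = (LINT x|lebesgue. kernel s (\<lambda>_ _. 1) (\<lambda>x. k x / measure T (cball x s)) y x)"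

text \<open>The measure of a ball is the partial integral of a jointly measurable indicator, hence
  measurable in the centre.\<close>

lemma measure_cball_measurable: "(\<lambda>x. measure T (cball x s)) \<in> borel_measurable lebesgue"
proof -
  interpret T: sigma_finite_measure T by (rule sigma_finite_T)
  have f: "fst \<in> borel_measurable ((lebesgue :: 'a measure) \<Otimes>\<^sub>M T)"
    by (rule measurable_compose[OF measurable_fst measurable_ident_lebesgue_borel])
  have sn: "snd \<in> borel_measurable ((lebesgue :: 'a measure) \<Otimes>\<^sub>M T)"
    using measurable_snd[of lebesgue T] by (simp cong: measurable_cong_sets)
  have "(\<lambda>z. dist (fst z) (snd z)) \<in> borel_measurable ((lebesgue :: 'a measure) \<Otimes>\<^sub>M T)"
    by (rule borel_measurable_dist[OF f sn])
  then have "(\<lambda>z. indicator {..s} (dist (fst z) (snd z)) :: ennreal) \<in> borel_measurable ((lebesgue :: 'a measure) \<Otimes>\<^sub>M T)"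
    by (rule measurable_compose) simp
  then have "(\<lambda>x. \<integral>\<^sup>+ y. indicator {..s} (dist x y) \<partial>T) \<in> borel_measurable (lebesgue :: 'a measure)"
    by (intro T.borel_measurable_nn_integral) (simp add: case_prod_beta')
  moreover have "(\<integral>\<^sup>+ y. indicator {..s} (dist x y) \<partial>T) = emeasure T (cball x s)" for x
  proof -
    have "(\<integral>\<^sup>+ y. indicator {..s} (dist x y) \<partial>T) = (\<integral>\<^sup>+ y. indicator (cball x s) y \<partial>T)"
      by (intro nn_integral_cong) (auto simp: indicator_def)
    then show ?thesis by simp
  qed
  ultimately show ?thesis unfolding measure_def by simp
qed

text \<open>By Fubini the two pairings with \<open>\<phi>\<close> are the double integrals with
  weight \<open>\<phi> y\<close> and \<open>\<phi> x\<close>; as these points are at most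
  \<open>s\<close> apart, the difference is controlled by the oscillation of
  \<open>\<phi>\<close>.\<close>

lemma smear_approximates:
  assumes k: "k \<in> borel_measurable lebesgue" and s: "0 < s" "s \<le> 1"
    and pos: "\<And>x. k x \<noteq> 0 \<Longrightarrow> 0 < measure T (cball x s)"
    and M: "0 \<le> M" "\<And>y. y \<in> \<Gamma> \<Longrightarrow> (\<integral>\<^sup>+ x\<in>cball y s. ennreal \<bar>k x / measure T (cball x s)\<bar> \<partial>lebesgue) \<le> ennreal M"
  shows "smear s k \<in> borel_measurable borel" "\<bar>smear s k y\<bar> \<le> M"
    "continuous_on UNIV \<phi> \<Longrightarrow> (\<forall>x. \<phi> x \<noteq> 0 \<longrightarrow> norm x \<le> R) \<Longrightarrow> 0 \<le> e \<Longrightarrow>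
      (\<forall>x y. dist x y \<le> s \<longrightarrow> \<bar>\<phi> x - \<phi> y\<bar> \<le> e) \<Longrightarrow>
      \<bar>(LINT y|T. \<phi> y * smear s k y) - (LINT x|lebesgue. \<phi> x * k x)\<bar> \<le> e * M * measure T (cball 0 (R + 1))"
proof -
  interpret T: sigma_finite_measure T by (rule sigma_finite_T)
  interpret leb: sigma_finite_measure "lebesgue :: 'a measure" by (rule sigma_finite_lebesgue)
  interpret P: pair_sigma_finite T "lebesgue :: 'a measure" ..
  define q where "q = (\<lambda>x. k x / measure T (cball x s))"
  have q: "q \<in> borel_measurable lebesgue" unfolding q_def using k measure_cball_measurable by measurable
  have Mq: "(\<integral>\<^sup>+ x\<in>cball y s. ennreal \<bar>q x\<bar> \<partial>lebesgue) \<le> ennreal M" if "y \<in> \<Gamma>" for y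
    unfolding q_def by (rule M(2)[OF that])
  have sm: "smear s k y = (LINT x|lebesgue. kernel s (\<lambda>_ _. 1) q y x)" for y
    unfolding smear_def q_def ..
  have "(\<lambda>y. LINT x|lebesgue. kernel s (\<lambda>_ _. 1) q y x) \<in> borel_measurable T"
    by (rule leb.borel_measurable_lebesgue_integral[OF kernel_measurable[OF q]]) (simp add: case_prod_beta')
  then show "smear s k \<in> borel_measurable borel" unfolding sm[abs_def] by simp
  show "\<bar>smear s k y\<bar> \<le> M"
  proof (cases "integrable lebesgue (kernel s (\<lambda>_ _. 1) q y)")
    case True
    have "ennreal (norm (smear s k y)) \<le> (\<integral>\<^sup>+ x. ennreal (norm (kernel s (\<lambda>_ _. 1) q y x)) \<partial>lebesgue)"
      unfolding sm by (rule integral_norm_bound_ennreal[OF True])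
    also have "\<dots> \<le> ennreal M"
    proof (cases "y \<in> \<Gamma>")
      case True
      have "(\<integral>\<^sup>+ x. ennreal (norm (kernel s (\<lambda>_ _. 1) q y x)) \<partial>lebesgue) = (\<integral>\<^sup>+ x\<in>cball y s. ennreal \<bar>q x\<bar> \<partial>lebesgue)"
        using True by (intro nn_integral_cong) (simp add: kernel_def indicator_def)
      then show ?thesis using Mq[OF True] by simp
    qed (simp add: kernel_def)
    finally show ?thesis using M(1) by simp
  next
    case False
    \<comment> \<open>Without integrability the integral is 0 by default, which satisfies the
      bound.\<close>
    then show ?thesis unfolding sm by (simp add: not_integrable_integral_eq M(1))
  qed
  assume c: "continuous_on UNIV \<phi>" and R: "\<forall>x. \<phi> x \<noteq> 0 \<longrightarrow> norm x \<le> R" and e: "0 \<le> e"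
    and osc: "\<forall>x y. dist x y \<le> s \<longrightarrow> \<bar>\<phi> x - \<phi> y\<bar> \<le> e"
  have "\<exists>b\<ge>0. \<forall>x. norm (\<phi> x) \<le> b"
    by (rule bounded_if_continuous_compact_support[OF c compact_cball[of 0 R]]) (use R in auto)
  then obtain b where b: "0 \<le> b" "\<And>x. \<bar>\<phi> x\<bar> \<le> b" by auto
  have bm: "\<phi> \<in> borel_measurable borel" by (rule borel_measurable_continuous_onI[OF c])
  have m1: "case_prod (\<lambda>y x. \<phi> y) \<in> borel_measurable (T \<Otimes>\<^sub>M (lebesgue :: 'a measure))"
    using measurable_compose[OF measurable_fst[of T lebesgue], of \<phi> borel] bm by (simp add: case_prod_beta' cong: measurable_cong_sets)
  have m2: "case_prod (\<lambda>y x. \<phi> x) \<in> borel_measurable (T \<Otimes>\<^sub>M (lebesgue :: 'a measure))"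
    using measurable_compose[OF measurable_compose[OF measurable_snd[of T lebesgue] measurable_ident_lebesgue_borel] bm]
    by (simp add: case_prod_beta')
  have m3: "case_prod (\<lambda>y x. \<phi> y - \<phi> x) \<in> borel_measurable (T \<Otimes>\<^sub>M (lebesgue :: 'a measure))"
    using borel_measurable_diff[OF m1 m2] by (simp add: case_prod_beta')
  \<comment> \<open>Spreading moves mass by at most \<open>s \<le> 1\<close>, which is the origin of
    the radius \<open>R + 1\<close>.\<close>
  have far: "\<phi> x = 0" if "x \<in> cball y s" "y \<notin> cball 0 (R + 1)" for x y
  proof (rule ccontr)
    assume "\<phi> x \<noteq> 0"
    then have "norm x \<le> R" using R by simp
    moreover have "norm (y - x) \<le> s" using that(1) by (simp add: dist_norm)
    ultimately have "norm y \<le> R + 1" using norm_triangle_ineq[of x "y - x"] s by simp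
    then show False using that(2) by simp
  qed
  have far': "\<phi> y = 0" if "y \<notin> cball 0 (R + 1)" for y
  proof (rule ccontr)
    assume "\<phi> y \<noteq> 0"
    then have "norm y \<le> R" using R by simp
    then show False using that by simp
  qed
  have b1: "\<bar>\<phi> y\<bar> \<le> b * indicator (cball 0 (R + 1)) y" for y
    using b(2)[of y] far'[of y] by (cases "y \<in> cball 0 (R + 1)") auto
  have b2: "\<bar>\<phi> x\<bar> \<le> b * indicator (cball 0 (R + 1)) y" if "x \<in> cball y s" for x y
    using b(2)[of x] far[OF that] by (cases "y \<in> cball 0 (R + 1)") auto
  have b3: "\<bar>\<phi> y - \<phi> x\<bar> \<le> e * indicator (cball 0 (R + 1)) y" if "x \<in> cball y s" for x y
    using osc[rule_format, of y x] far[OF that] far'[of y] that by (cases "y \<in> cball 0 (R + 1)") auto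
  have i1: "integrable (T \<Otimes>\<^sub>M lebesgue) (case_prod (kernel s (\<lambda>y x. \<phi> y) q))"
    by (rule kernel_integrable(1)[OF q m1 M(1) Mq b(1) b1])
  have i2: "integrable (T \<Otimes>\<^sub>M lebesgue) (case_prod (kernel s (\<lambda>y x. \<phi> x) q))"
    by (rule kernel_integrable(1)[OF q m2 M(1) Mq b(1) b2])
  have "(LINT y|T. LINT x|lebesgue. kernel s (\<lambda>y x. \<phi> y - \<phi> x) q y x)
      = (LINT z|(T \<Otimes>\<^sub>M lebesgue). case_prod (kernel s (\<lambda>y x. \<phi> y - \<phi> x) q) z)"
    using P.integral_fst'[OF kernel_integrable(1)[OF q m3 M(1) Mq e b3]] by simp
  also have "\<dots> = (LINT z|(T \<Otimes>\<^sub>M lebesgue). case_prod (kernel s (\<lambda>y x. \<phi> y) q) z - case_prod (kernel s (\<lambda>y x. \<phi> x) q) z)"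
    by (intro Bochner_Integration.integral_cong) (auto simp: kernel_def algebra_simps)
  also have "\<dots> = (LINT z|(T \<Otimes>\<^sub>M lebesgue). case_prod (kernel s (\<lambda>y x. \<phi> y) q) z) - (LINT z|(T \<Otimes>\<^sub>M lebesgue). case_prod (kernel s (\<lambda>y x. \<phi> x) q) z)"
    by (rule Bochner_Integration.integral_diff[OF i1 i2])
  also have "(LINT z|(T \<Otimes>\<^sub>M lebesgue). case_prod (kernel s (\<lambda>y x. \<phi> y) q) z) = (LINT y|T. LINT x|lebesgue. kernel s (\<lambda>y x. \<phi> y) q y x)"
    using P.integral_fst'[OF i1] by simp
  also have "\<dots> = (LINT y|T. \<phi> y * smear s k y)"
  proof (intro Bochner_Integration.integral_cong refl)
    fix y
    have "(LINT x|lebesgue. kernel s (\<lambda>y x. \<phi> y) q y x) = (LINT x|lebesgue. \<phi> y * kernel s (\<lambda>_ _. 1) q y x)"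
      by (intro Bochner_Integration.integral_cong) (auto simp: kernel_def mult_ac)
    then show "(LINT x|lebesgue. kernel s (\<lambda>y x. \<phi> y) q y x) = \<phi> y * smear s k y" by (simp add: sm)
  qed
  also have "(LINT z|(T \<Otimes>\<^sub>M lebesgue). case_prod (kernel s (\<lambda>y x. \<phi> x) q) z) = (LINT x|lebesgue. LINT y|T. kernel s (\<lambda>y x. \<phi> x) q y x)"
    using P.integral_snd[OF i2] by simp
  also have "\<dots> = (LINT x|lebesgue. \<phi> x * k x)"
  proof (intro Bochner_Integration.integral_cong refl)
    fix x
    \<comment> \<open>Integrating over the boundary point gives the measure of the ball about
      \<open>x\<close>, which cancels the division in \<open>q\<close>; where
      \<open>k x \<noteq> 0\<close> that measure is positive.\<close>
    have "(LINT y|T. kernel s (\<lambda>y x. \<phi> x) q y x) = (LINT y|T. (\<phi> x * q x) * indicator (cball x s) y)"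
    proof (rule integral_cong_AE)
      show "AE y in T. kernel s (\<lambda>y x. \<phi> x) q y x = (\<phi> x * q x) * indicator (cball x s) y"
        using AE_\<Gamma> by (rule eventually_mono) (auto simp: kernel_def indicator_def dist_commute)
      have "(\<lambda>y. indicator \<Gamma> y * indicator (cball x s) y * \<phi> x * q x) \<in> borel_measurable T"
        by (intro borel_measurable_times borel_measurable_indicator borel_measurable_const) (simp_all add: closed_\<Gamma> borel_closed)
      also have "(\<lambda>y. indicator \<Gamma> y * indicator (cball x s) y * \<phi> x * q x) = (\<lambda>y. kernel s (\<lambda>y x. \<phi> x) q y x)"
        by (auto simp: kernel_def indicator_def dist_commute fun_eq_iff)
      finally show "(\<lambda>y. kernel s (\<lambda>y x. \<phi> x) q y x) \<in> borel_measurable T" .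
    qed (intro borel_measurable_times borel_measurable_indicator borel_measurable_const, simp)
    also have "\<dots> = \<phi> x * q x * measure T (cball x s)" by simp
    also have "\<dots> = \<phi> x * k x" using pos[of x] by (cases "k x = 0") (auto simp: q_def)
    finally show "(LINT y|T. kernel s (\<lambda>y x. \<phi> x) q y x) = \<phi> x * k x" .
  qed
  finally show "\<bar>(LINT y|T. \<phi> y * smear s k y) - (LINT x|lebesgue. \<phi> x * k x)\<bar> \<le> e * M * measure T (cball 0 (R + 1))"
    using kernel_integrable(2)[OF q m3 M(1) Mq e b3] by simp
qed

end

section \<open>Cutting off near the boundary\<close>

locale graph_domain = uniform_graph "frontier \<Omega>" r \<rho> L
  for \<Omega> :: "('m::euclidean_space \<times> real) set" and r \<rho> L +
  assumes open_\<Omega>: "open \<Omega>"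
begin

abbreviation "\<Gamma> \<equiv> frontier \<Omega>"
abbreviation "bdist x \<equiv> infdist x \<Gamma>"

lemma \<Omega>_not_\<Gamma>: "x \<in> \<Omega> \<Longrightarrow> x \<notin> \<Gamma>"
  using open_\<Omega> by (simp add: frontier_def interior_open)

lemma closure_\<Omega>: "closure \<Omega> = \<Omega> \<union> \<Gamma>"
  using open_\<Omega> closure_subset[of \<Omega>] by (auto simp: frontier_def interior_open)

lemma bdist_pos: "x \<in> \<Omega> \<Longrightarrow> 0 < bdist x"
  using infdist_pos_not_in_closed[OF closed nonempty] \<Omega>_not_\<Gamma> by blast

lemma continuous_bdist: "continuous_on S (\<lambda>x. bdist x)"
  by (intro continuous_intros)

section \<open>Cutoff test functions\<close>

definition cutoff :: "real \<Rightarrow> ('m \<times> real \<Rightarrow> real) \<Rightarrow> 'm \<times> real \<Rightarrow> real" where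
  "cutoff \<epsilon> \<phi> x = (if x \<in> \<Omega> then \<phi> x * step (bdist x / \<epsilon>) else 0)"

definition cutoff_grad :: "real \<Rightarrow> ('m \<times> real \<Rightarrow> real) \<Rightarrow> 'm \<times> real \<Rightarrow> 'm \<times> real" where
  "cutoff_grad \<epsilon> \<phi> x = (if x \<in> \<Omega> then step (bdist x / \<epsilon>) *\<^sub>R grad \<phi> x + (\<phi> x * (step' (bdist x / \<epsilon>) / \<epsilon>)) *\<^sub>R normal x else 0)"

text \<open>Three open sets cover the space: one where the cutoff vanishes, one within the reach
  where the distance is C1 and the product rule applies, and one where the step is constantly 1. The
  last two overlap because \<open>\<epsilon> < reach\<close>.\<close>

lemma cutoff_C1:
  assumes \<epsilon>: "0 < \<epsilon>" "\<epsilon> < reach" and \<phi>: "Ck 1 \<phi>"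
  shows "Ck 1 (cutoff \<epsilon> \<phi>)" "grad (cutoff \<epsilon> \<phi>) = cutoff_grad \<epsilon> \<phi>"
proof -
  define O1 where "O1 = {x. bdist x < \<epsilon> / 2} \<union> - closure \<Omega>"
  define O2 where "O2 = \<Omega> \<inter> {x. bdist x < reach}"
  define O3 where "O3 = \<Omega> \<inter> {x. \<epsilon> < bdist x}"
  have op: "open O1" "open O2" "open O3"
    unfolding O1_def O2_def O3_def
    by (intro open_Un open_Int open_Compl closed_closure open_\<Omega> open_Collect_less continuous_bdist continuous_on_const)+
  have cover: "x \<in> O1 \<or> x \<in> O2 \<or> x \<in> O3" for x
  proof (cases "x \<in> \<Omega>")
    case True
    then show ?thesis using \<epsilon> unfolding O2_def O3_def by auto
  next
    case False
    then show ?thesis using \<epsilon> unfolding O1_def closure_\<Omega> by auto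
  qed
  have D\<phi>: "(\<phi> has_derivative (\<lambda>u. grad \<phi> x \<bullet> u)) (at x)" for x
    by (rule spec[OF conjunct1[OF \<phi>[unfolded Ck_1_iff]]])
  have C\<phi>: "continuous_on S \<phi>" "continuous_on S (grad \<phi>)" for S
    by (rule Ck_1_continuous[OF \<phi>])
       (rule continuous_on_subset[OF conjunct2[OF \<phi>[unfolded Ck_1_iff]] subset_UNIV])
  have z1: "cutoff \<epsilon> \<phi> x = 0" "cutoff_grad \<epsilon> \<phi> x = 0" if "x \<in> O1" for x
  proof -
    have "x \<notin> \<Omega> \<or> bdist x / \<epsilon> \<le> 1/2"
      using that \<epsilon> closure_subset[of \<Omega>] unfolding O1_def by (auto simp: field_simps)
    then show "cutoff \<epsilon> \<phi> x = 0" "cutoff_grad \<epsilon> \<phi> x = 0"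
      by (auto simp: cutoff_def cutoff_grad_def step_zero)
  qed
  have z3: "cutoff \<epsilon> \<phi> x = \<phi> x" "cutoff_grad \<epsilon> \<phi> x = grad \<phi> x" if "x \<in> O3" for x
  proof -
    have "x \<in> \<Omega>" "1 \<le> bdist x / \<epsilon>" using that \<epsilon> unfolding O3_def by (auto simp: field_simps)
    then show "cutoff \<epsilon> \<phi> x = \<phi> x" "cutoff_grad \<epsilon> \<phi> x = grad \<phi> x"
      by (simp_all add: cutoff_def cutoff_grad_def step_one)
  qed
  have D: "(cutoff \<epsilon> \<phi> has_derivative (\<lambda>u. cutoff_grad \<epsilon> \<phi> x \<bullet> u)) (at x)" for x
  proof -
    consider "x \<in> O1" | "x \<in> O2" | "x \<in> O3" using cover by blast
    then show ?thesis
    proof cases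
      case 1
      have "((\<lambda>y. 0::real) has_derivative (\<lambda>u. cutoff_grad \<epsilon> \<phi> x \<bullet> u)) (at x)" using z1(2)[OF 1] by simp
      then show ?thesis
        by (rule has_derivative_transform_within_open[OF _ op(1) 1]) (simp add: z1)
    next
      case 2
      then have x: "x \<in> \<Omega>" "bdist x < reach" by (auto simp: O2_def)
      have n: "((\<lambda>y. bdist y / \<epsilon>) has_derivative (\<lambda>u. (normal x \<bullet> u) / \<epsilon>)) (at x)"
        using has_derivative_mult_left[OF infdist_has_derivative[OF x(2) \<Omega>_not_\<Gamma>[OF x(1)]], of "1 / \<epsilon>"] by simp
      have "((\<lambda>y. \<phi> y * step (bdist y / \<epsilon>)) has_derivative
          (\<lambda>u. \<phi> x * ((normal x \<bullet> u) / \<epsilon> * step' (bdist x / \<epsilon>)) + (grad \<phi> x \<bullet> u) * step (bdist x / \<epsilon>))) (at x)"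
        by (rule has_derivative_mult[OF D\<phi> DERIV_compose_FDERIV[OF step_deriv n]])
      moreover have "(\<lambda>u. \<phi> x * ((normal x \<bullet> u) / \<epsilon> * step' (bdist x / \<epsilon>)) + (grad \<phi> x \<bullet> u) * step (bdist x / \<epsilon>))
          = (\<lambda>u. cutoff_grad \<epsilon> \<phi> x \<bullet> u)"
        using x(1) by (simp add: cutoff_grad_def inner_add_left mult_ac fun_eq_iff)
      ultimately have "((\<lambda>y. \<phi> y * step (bdist y / \<epsilon>)) has_derivative (\<lambda>u. cutoff_grad \<epsilon> \<phi> x \<bullet> u)) (at x)"
        by simp
      then show ?thesis
        by (rule has_derivative_transform_within_open[OF _ op(2) 2]) (simp add: cutoff_def O2_def)
    next
      case 3
      have "(\<phi> has_derivative (\<lambda>u. cutoff_grad \<epsilon> \<phi> x \<bullet> u)) (at x)" using z3(2)[OF 3] D\<phi>[of x] by simp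
      then show ?thesis
        by (rule has_derivative_transform_within_open[OF _ op(3) 3]) (simp add: z3)
    qed
  qed
  have c1: "continuous_on O1 (cutoff_grad \<epsilon> \<phi>)"
    by (rule continuous_on_eq[OF continuous_on_const[of _ 0]]) (simp add: z1)
  have c3: "continuous_on O3 (cutoff_grad \<epsilon> \<phi>)"
    by (rule continuous_on_eq[OF C\<phi>(2)]) (simp add: z3)
  have c2: "continuous_on O2 (cutoff_grad \<epsilon> \<phi>)"
  proof (rule continuous_on_eq)
    have nc: "continuous_on O2 normal"
      by (rule continuous_on_subset[OF normal_continuous]) (use \<Omega>_not_\<Gamma> in \<open>auto simp: O2_def\<close>)
    have q: "continuous_on O2 (\<lambda>x. bdist x / \<epsilon>)" using \<epsilon> by (intro continuous_intros) auto
    show "continuous_on O2 (\<lambda>x. step (bdist x / \<epsilon>) *\<^sub>R grad \<phi> x + (\<phi> x * (step' (bdist x / \<epsilon>) / \<epsilon>)) *\<^sub>R normal x)"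
      using \<epsilon> by (intro continuous_intros C\<phi> nc continuous_on_compose2[OF continuous_step[of UNIV] q]
          continuous_on_compose2[OF continuous_step'[of UNIV] q]) auto
  qed (simp add: cutoff_grad_def O2_def)
  have C: "continuous_on UNIV (cutoff_grad \<epsilon> \<phi>)"
  proof (intro continuous_at_imp_continuous_on ballI)
    fix x
    show "isCont (cutoff_grad \<epsilon> \<phi>) x"
      using cover[of x] c1 c2 c3 op by (auto simp: continuous_on_eq_continuous_at)
  qed
  show "Ck 1 (cutoff \<epsilon> \<phi>)" "grad (cutoff \<epsilon> \<phi>) = cutoff_grad \<epsilon> \<phi>"
    by (rule Ck_1I[OF D C])+
qed

text \<open>The step removes distances up to \<open>\<epsilon> / 2\<close>, and the test function
  vanishes from a distance strictly below \<open>\<delta>\<close> on, so the support stays away from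
  both ends of the strip.\<close>

lemma cutoff_supp:
  assumes \<epsilon>: "0 < \<epsilon>" and \<phi>: "trace_test \<delta> \<Omega> \<phi>"
  shows "compact (supp (cutoff \<epsilon> \<phi>))" "supp (cutoff \<epsilon> \<phi>) \<subseteq> bdry_strip \<Omega> \<delta>"
proof -
  obtain d where d: "ereal d < \<delta>" "\<And>x. x \<in> \<Omega> \<Longrightarrow> d \<le> bdist x \<Longrightarrow> \<phi> x = 0"
    using \<phi> unfolding trace_test_def bdry_strip_def by (auto simp: not_less)
  \<comment> \<open>Taking the closure of \<open>\<Omega>\<close> adds boundary points only, and the
    lower bound on the distance excludes these again.\<close>
  define F where "F = supp \<phi> \<inter> (closure \<Omega> \<inter> {x. \<epsilon> / 2 \<le> bdist x} \<inter> {x. bdist x \<le> d})"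
  have "compact (supp \<phi>)" using \<phi> by (simp add: trace_test_def)
  moreover have "closed (closure \<Omega> \<inter> {x. \<epsilon> / 2 \<le> bdist x} \<inter> {x. bdist x \<le> d})"
    by (intro closed_Int closed_closure closed_Collect_le continuous_bdist continuous_on_const)
  ultimately have F: "compact F" unfolding F_def by (rule compact_Int_closed)
  have "{x. cutoff \<epsilon> \<phi> x \<noteq> 0} \<subseteq> F"
  proof
    fix x assume "x \<in> {x. cutoff \<epsilon> \<phi> x \<noteq> 0}"
    then have x: "x \<in> \<Omega>" "\<phi> x \<noteq> 0" "step (bdist x / \<epsilon>) \<noteq> 0" by (auto simp: cutoff_def split: if_splits)
    have "bdist x \<le> d" using d(2)[OF x(1)] x(2) by force
    moreover have "\<not> bdist x / \<epsilon> \<le> 1/2" using x(3) step_zero(1) by blast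
    then have "\<epsilon> / 2 \<le> bdist x" using \<epsilon> by (simp add: field_simps)
    moreover have "x \<in> supp \<phi>" using x(2) supp_zero[of x \<phi>] by (cases "x \<in> supp \<phi>") simp_all
    ultimately show "x \<in> F" using x(1) closure_subset[of \<Omega>] by (auto simp: F_def)
  qed
  then have sub: "supp (cutoff \<epsilon> \<phi>) \<subseteq> F"
    unfolding supp_def by (rule closure_minimal[OF _ compact_imp_closed[OF F]])
  show "compact (supp (cutoff \<epsilon> \<phi>))"
    using compact_Int_closed[OF F, of "supp (cutoff \<epsilon> \<phi>)"] sub by (simp add: supp_def Int_absorb1)
  have "F \<subseteq> bdry_strip \<Omega> \<delta>"
  proof
    fix x assume "x \<in> F"
    then have x: "x \<in> \<Omega> \<union> \<Gamma>" "\<epsilon> / 2 \<le> bdist x" "bdist x \<le> d" by (auto simp: F_def closure_\<Omega>)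
    have "x \<in> \<Omega>" using x(1,2) \<epsilon> by auto
    moreover have "ereal (bdist x) < \<delta>" using d(1) x(3) by (metis ereal_less_eq(3) order_le_less_trans)
    ultimately show "x \<in> bdry_strip \<Omega> \<delta>" by (simp add: bdry_strip_def)
  qed
  with sub show "supp (cutoff \<epsilon> \<phi>) \<subseteq> bdry_strip \<Omega> \<delta>" by blast
qed

end

section \<open>Estimates in the boundary layer\<close>

text \<open>Along a compact exhaustion of \<open>D\<close> the function is the pointwise limit of
  integrable truncations.\<close>

lemma L1_loc_measurable:
  fixes f :: "'a::euclidean_space \<Rightarrow> 'b::euclidean_space"
  assumes D: "open D" and f: "L1_loc D f"
  shows "(\<lambda>x. indicator D x *\<^sub>R f x) \<in> borel_measurable lebesgue"
proof -
  obtain C where C: "\<And>n. compact (C n)" "\<And>n. C n \<subseteq> D" "\<And>n. C n \<subseteq> interior (C (Suc n))" "\<Union> (range C) = D"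
    "\<And>K. \<lbrakk>compact K; K \<subseteq> D\<rbrakk> \<Longrightarrow> \<exists>N. \<forall>n\<ge>N. K \<subseteq> (C n)"
    by (rule open_Union_compact_subsets[OF D]) (rule that)
  show ?thesis
  proof (rule borel_measurable_LIMSEQ_metric)
    show "(\<lambda>x. indicator (C n) x *\<^sub>R f x) \<in> borel_measurable lebesgue" for n
      using f C(1,2)[of n] unfolding L1_loc_def set_integrable_def by (simp add: borel_measurable_integrable)
    fix x
    show "(\<lambda>n. indicator (C n) x *\<^sub>R f x) \<longlonglongrightarrow> indicator D x *\<^sub>R f x"
    proof (cases "x \<in> D")
      case True
      then obtain N where "\<forall>n\<ge>N. {x} \<subseteq> C n" using C(5)[of "{x}"] by auto
      then have "eventually (\<lambda>n. indicator (C n) x *\<^sub>R f x = indicator D x *\<^sub>R f x) sequentially"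
        using True by (intro eventually_sequentiallyI[of N]) auto
      then show ?thesis by (rule tendsto_eventually)
    next
      case False
      then have "x \<notin> C n" for n using C(2)[of n] by blast
      then have "(\<lambda>n. indicator (C n) x *\<^sub>R f x) = (\<lambda>n. indicator D x *\<^sub>R f x)" using False by simp
      then show ?thesis by simp
    qed
  qed
qed

lemma abs_le_one_plus_powr: "1 \<le> p \<Longrightarrow> \<bar>t::real\<bar> \<le> 1 + \<bar>t\<bar> powr p"
proof (cases "\<bar>t\<bar> \<le> 1")
  case False
  assume "1 \<le> p"
  then have "\<bar>t\<bar> powr 1 \<le> \<bar>t\<bar> powr p" using False by (intro powr_mono) auto
  then show ?thesis using False by simp
qed (simp add: add_increasing2)

text \<open>Finitely many balls of radius \<open>r0\<close> cover the ball of radius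
  \<open>R\<close>, and on each the L1 norm is finite since
  \<open>\<bar>t\<bar> \<le> 1 + \<bar>t\<bar> powr p\<close>. Unlike local integrability, this
  reaches the boundary of \<open>D\<close>.\<close>

lemma Lp_ul_integrable:
  fixes f :: "'a::euclidean_space \<Rightarrow> real"
  assumes D: "open D" and f: "L1_loc D f" and fin: "Lp_ul_norm r0 p D f < top" and p: "1 \<le> p" and r0: "0 < r0"
  shows "integrable lebesgue (\<lambda>x. indicator (D \<inter> cball 0 R) x * f x)"
proof -
  have m: "(\<lambda>x. indicator D x *\<^sub>R f x) \<in> borel_measurable lebesgue" by (rule L1_loc_measurable[OF D f])
  have "(\<lambda>x. indicator (cball 0 R) x * (indicator D x *\<^sub>R f x)) \<in> borel_measurable lebesgue"
    by (intro borel_measurable_times borel_measurable_indicator m) simp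
  then have mR: "(\<lambda>x. indicator (D \<inter> cball 0 R) x * f x) \<in> borel_measurable lebesgue"
    by (simp add: indicator_inter_arith mult_ac)
  have loc: "(\<integral>\<^sup>+ x. ennreal \<bar>indicator D x * f x\<bar> * indicator (cball z r0) x \<partial>lebesgue) < top" for z
  proof -
    have "Lp_norm p (cball z r0 \<inter> D) f < top"
      using fin unfolding Lp_ul_norm_def by (rule order_le_less_trans[OF SUP_upper[OF UNIV_I]])
    then have I: "(\<integral>\<^sup>+ x\<in>cball z r0 \<inter> D. ennreal (\<bar>f x\<bar> powr p) \<partial>lebesgue) < top"
      unfolding Lp_norm_def Let_def by (auto simp: less_top[symmetric] split: if_splits)
    have mI: "(\<lambda>x. ennreal (\<bar>indicator D x *\<^sub>R f x\<bar> powr p) * indicator (cball z r0) x) \<in> borel_measurable lebesgue"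
    proof (rule borel_measurable_times_ennreal)
      have "(\<lambda>t::real. ennreal (\<bar>t\<bar> powr p)) \<in> borel_measurable borel" by measurable
      then show "(\<lambda>x. ennreal (\<bar>indicator D x *\<^sub>R f x\<bar> powr p)) \<in> borel_measurable lebesgue"
        by (rule measurable_compose[OF m])
    qed (rule borel_measurable_indicator, simp)
    have "(\<integral>\<^sup>+ x. ennreal \<bar>indicator D x * f x\<bar> * indicator (cball z r0) x \<partial>lebesgue)
       \<le> (\<integral>\<^sup>+ x. indicator (cball z r0) x + ennreal (\<bar>indicator D x *\<^sub>R f x\<bar> powr p) * indicator (cball z r0) x \<partial>lebesgue)"
    proof (rule nn_integral_mono)
      fix x
      have "ennreal \<bar>indicator D x * f x\<bar> \<le> ennreal (1 + \<bar>indicator D x * f x\<bar> powr p)"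
        by (rule ennreal_leI[OF abs_le_one_plus_powr[OF p]])
      then show "ennreal \<bar>indicator D x * f x\<bar> * indicator (cball z r0) x
        \<le> indicator (cball z r0) x + ennreal (\<bar>indicator D x *\<^sub>R f x\<bar> powr p) * indicator (cball z r0) x"
        by (cases "x \<in> cball z r0") (simp_all add: ennreal_plus)
    qed
    also have "\<dots> = (\<integral>\<^sup>+ x. indicator (cball z r0) x \<partial>lebesgue)
       + (\<integral>\<^sup>+ x. ennreal (\<bar>indicator D x *\<^sub>R f x\<bar> powr p) * indicator (cball z r0) x \<partial>lebesgue)"
      by (rule nn_integral_add[OF _ mI]) (rule borel_measurable_indicator, simp)
    also have "(\<integral>\<^sup>+ x. indicator (cball z r0) x \<partial>lebesgue) = emeasure lebesgue (cball z r0)"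
      by (rule nn_integral_indicator) simp
    also have "(\<integral>\<^sup>+ x. ennreal (\<bar>indicator D x *\<^sub>R f x\<bar> powr p) * indicator (cball z r0) x \<partial>lebesgue)
       = (\<integral>\<^sup>+ x\<in>cball z r0 \<inter> D. ennreal (\<bar>f x\<bar> powr p) \<partial>lebesgue)"
      using p by (intro nn_integral_cong) (auto simp: indicator_def)
    also have "emeasure lebesgue (cball z r0) + (\<integral>\<^sup>+ x\<in>cball z r0 \<inter> D. ennreal (\<bar>f x\<bar> powr p) \<partial>lebesgue) < top"
      using I r0 by (simp add: emeasure_cball less_top[symmetric])
    finally show ?thesis .
  qed
  have cov: "cball (0::'a) R \<subseteq> (\<Union>z\<in>UNIV. ball z r0)"
  proof
    fix x :: 'a
    have "x \<in> ball x r0" using r0 by simp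
    then show "x \<in> (\<Union>z\<in>UNIV. ball z r0)" by (rule UN_I[OF UNIV_I])
  qed
  obtain F where F: "F \<subseteq> UNIV" "finite F" "cball (0::'a) R \<subseteq> (\<Union>z\<in>F. ball z r0)"
    by (rule compactE_image[OF compact_cball open_ball cov]) (rule that)
  have "(\<integral>\<^sup>+ x. ennreal (norm (indicator (D \<inter> cball 0 R) x * f x)) \<partial>lebesgue)
     \<le> (\<integral>\<^sup>+ x. (\<Sum>z\<in>F. ennreal \<bar>indicator D x * f x\<bar> * indicator (cball z r0) x) \<partial>lebesgue)"
  proof (rule nn_integral_mono)
    fix x
    show "ennreal (norm (indicator (D \<inter> cball 0 R) x * f x)) \<le> (\<Sum>z\<in>F. ennreal \<bar>indicator D x * f x\<bar> * indicator (cball z r0) x)"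
    proof (cases "x \<in> D \<inter> cball 0 R")
      case True
      then obtain z where z: "z \<in> F" "x \<in> ball z r0" using F(3) by auto
      have "ennreal (norm (indicator (D \<inter> cball 0 R) x * f x)) = ennreal \<bar>indicator D x * f x\<bar> * indicator (cball z r0) x"
        using True z(2) by simp
      also have "\<dots> \<le> (\<Sum>z\<in>F. ennreal \<bar>indicator D x * f x\<bar> * indicator (cball z r0) x)"
        by (rule member_le_sum[OF z(1) _ F(2)]) simp
      finally show ?thesis .
    qed simp
  qed
  also have "\<dots> = (\<Sum>z\<in>F. \<integral>\<^sup>+ x. ennreal \<bar>indicator D x * f x\<bar> * indicator (cball z r0) x \<partial>lebesgue)"
    by (rule nn_integral_sum)
       (intro borel_measurable_times_ennreal borel_measurable_indicator measurable_compose[OF m[unfolded real_scaleR_def], of "\<lambda>t. ennreal \<bar>t\<bar>" borel], auto)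
  also have "\<dots> < top"
    using F(2) by (induction F rule: finite_induct) (use loc in \<open>auto simp: less_top[symmetric]\<close>)
  finally show ?thesis
    by (intro integrableI_bounded mR) (simp only: infinity_ennreal_def)
qed

lemma L1_loc_component: "L1_loc D (v :: 'a::euclidean_space \<Rightarrow> 'a) \<Longrightarrow> L1_loc D (\<lambda>x. v x \<bullet> i)"
  unfolding L1_loc_def set_integrable_def
proof (intro allI impI)
  fix K assume v: "\<forall>K. compact K \<and> K \<subseteq> D \<longrightarrow> integrable lebesgue (\<lambda>x. indicat_real K x *\<^sub>R v x)" and K: "compact K \<and> K \<subseteq> D"
  then have "integrable lebesgue (\<lambda>x. indicat_real K x *\<^sub>R v x)" by blast
  from integrable_inner_left[OF this, of i]
  show "integrable lebesgue (\<lambda>x. indicat_real K x *\<^sub>R (v x \<bullet> i))" by simp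
qed

lemma L1_loc_subset: "L1_loc D f \<Longrightarrow> E \<subseteq> D \<Longrightarrow> L1_loc E f"
  unfolding L1_loc_def using order_trans by blast

lemma Lp_ul_integrable_vector:
  fixes v :: "'a::euclidean_space \<Rightarrow> 'a"
  assumes D: "open D" and v: "L1_loc D v" and fin: "\<And>i. i \<in> Basis \<Longrightarrow> Lp_ul_norm r0 1 D (\<lambda>x. v x \<bullet> i) < top" and r0: "0 < r0"
  shows "integrable lebesgue (\<lambda>x. indicator (D \<inter> cball 0 R) x *\<^sub>R v x)"
proof -
  have "integrable lebesgue (\<lambda>x. \<Sum>i\<in>Basis. (indicator (D \<inter> cball 0 R) x * (v x \<bullet> i)) *\<^sub>R i)"
    by (intro Bochner_Integration.integrable_sum integrable_scaleR_left
        Lp_ul_integrable[OF D L1_loc_component[OF v] fin _ r0]) auto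
  moreover have "(\<Sum>i\<in>Basis. (indicator (D \<inter> cball 0 R) x * (v x \<bullet> i)) *\<^sub>R i) = indicator (D \<inter> cball 0 R) x *\<^sub>R v x" for x
  proof -
    have "(\<Sum>i\<in>Basis. (indicator (D \<inter> cball 0 R) x * (v x \<bullet> i)) *\<^sub>R i) = indicator (D \<inter> cball 0 R) x *\<^sub>R (\<Sum>i\<in>Basis. (v x \<bullet> i) *\<^sub>R i)"
      by (simp add: scaleR_sum_right)
    then show ?thesis by (simp add: euclidean_representation)
  qed
  ultimately show ?thesis by simp
qed

lemma open_bdry_strip:
  assumes "open \<Omega>"
  shows "open (bdry_strip \<Omega> \<delta>)"
proof -
  have "{x. ereal (infdist x (frontier \<Omega>)) < \<delta>} = (\<lambda>x. infdist x (frontier \<Omega>)) -` {t. ereal t < \<delta>}" by auto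
  moreover have "open {t. ereal t < \<delta>}"
    by (cases \<delta>) (auto simp: lessThan_def[symmetric])
  ultimately have "open {x. ereal (infdist x (frontier \<Omega>)) < \<delta>}"
    using open_vimage[of "{t. ereal t < \<delta>}" "\<lambda>x. infdist x (frontier \<Omega>)"] continuous_on_infdist[OF continuous_on_id] by auto
  moreover have "bdry_strip \<Omega> \<delta> = \<Omega> \<inter> {x. ereal (infdist x (frontier \<Omega>)) < \<delta>}" by (auto simp: bdry_strip_def)
  ultimately show ?thesis using assms by auto
qed

context graph_domain
begin

section \<open>The boundary measure\<close>

text \<open>Surface measure seen as a measure on the Borel sets of the whole space, so that Borel
  functions and balls there can be used directly.\<close>

definition bdry_measure :: "('m \<times> real) measure" where
  "bdry_measure = density (hausdorff_measure DIM('m)) (indicator \<Gamma>)"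

lemma sets_bdry_measure [simp, measurable_cong]: "sets bdry_measure = sets borel"
  by (simp add: bdry_measure_def)

lemma emeasure_bdry_measure:
  "A \<in> sets borel \<Longrightarrow> emeasure bdry_measure A = emeasure (hausdorff_measure DIM('m)) (\<Gamma> \<inter> A)"
  unfolding bdry_measure_def by (rule emeasure_restricted) (auto simp: closed)

lemma locally_finite:
  assumes \<delta>: "0 < \<delta>"
  shows "locally_finite_borel bdry_measure \<Gamma> {\<phi>. trace_test \<delta> \<Omega> \<phi>}"
proof
  show "sets bdry_measure = sets borel" by simp
  show "emeasure bdry_measure (cball 0 R) < top" for R
    using hausdorff_finite_cball by (simp add: emeasure_bdry_measure)
  show "closed \<Gamma>" by (rule closed)
  show "emeasure bdry_measure (- \<Gamma>) = 0"
    using closed by (subst emeasure_bdry_measure) auto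
  fix K U :: "('m \<times> real) set"
  assume K: "compact K" "open U" "K \<subseteq> \<Gamma>" "K \<subseteq> U"
  \<comment> \<open>A real number below \<open>\<delta>\<close>, which may be infinite; a bump
    supported at distances below \<open>d\<close> is an admissible test function.\<close>
  obtain d where d: "0 < d" "ereal d < \<delta>"
    using ereal_dense2[OF \<delta>] by (auto simp: zero_ereal_def)
  have U: "open (U \<inter> {x. bdist x < d})"
    by (intro open_Int K open_Collect_less continuous_bdist continuous_on_const)
  have KU: "K \<subseteq> U \<inter> {x. bdist x < d}" using K d(1) by auto
  obtain \<phi> where \<phi>: "Ck 1 \<phi>" "compact (supp \<phi>)" "supp \<phi> \<subseteq> U \<inter> {x. bdist x < d}"
    "\<And>x. 0 \<le> \<phi> x" "\<And>x. \<phi> x \<le> 1" "\<And>x. x \<in> K \<Longrightarrow> \<phi> x = 1"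
    by (rule C1_bump[OF K(1) U KU]) (rule that)
  have z: "\<phi> x = 0" if "x \<notin> U \<or> d \<le> bdist x" for x
  proof -
    have "x \<notin> supp \<phi>" using that subsetD[OF \<phi>(3), of x] by auto
    then show ?thesis by (rule supp_zero)
  qed
  have "trace_test \<delta> \<Omega> \<phi>"
    unfolding trace_test_def
  proof (intro conjI exI[of _ d])
    show "\<forall>x\<in>\<Omega> - bdry_strip \<Omega> (ereal d). \<phi> x = 0"
    proof
      fix x assume "x \<in> \<Omega> - bdry_strip \<Omega> (ereal d)"
      then have "d \<le> bdist x" by (simp add: bdry_strip_def not_less)
      then show "\<phi> x = 0" by (intro z) simp
    qed
  qed (use \<phi> d in auto)
  moreover have "\<phi> \<in> borel_measurable borel" by (rule borel_measurable_continuous_onI[OF Ck_1_continuous[OF \<phi>(1)]])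
  ultimately show "\<exists>\<phi>\<in>{\<phi>. trace_test \<delta> \<Omega> \<phi>}. \<phi> \<in> borel_measurable borel \<and> (\<forall>x. 0 \<le> \<phi> x \<and> \<phi> x \<le> 1) \<and>
      (\<forall>x\<in>K. \<phi> x = 1) \<and> (\<forall>x. x \<notin> U \<longrightarrow> \<phi> x = 0)"
    using \<phi>(4-6) z by (intro bexI[of _ \<phi>] conjI) simp_all
qed

text \<open>The factor \<open>1 + L\<close> comes from projecting the graph, the factor 2 from
  comparing Hausdorff with Lebesgue measure by covering balls.\<close>

definition density_const :: real where
  "density_const = unit_ball_vol (real DIM('m)) / (2 * (1 + L)) ^ DIM('m)"

lemma density_const_pos: "0 < density_const"
  unfolding density_const_def using pos by (simp add: unit_ball_vol_pos)

text \<open>The ball of radius \<open>2 * \<epsilon>\<close> about \<open>x\<close> contains the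
  ball of radius \<open>\<epsilon>\<close> about its nearest boundary point, where the lower density
  bound applies.\<close>

lemma bdry_measure_lower_density:
  assumes \<epsilon>: "0 < \<epsilon>" "\<epsilon> < r" and x: "bdist x < \<epsilon>"
    and fin: "emeasure bdry_measure (cball x (2 * \<epsilon>)) < top"
  shows "density_const * \<epsilon> ^ DIM('m) \<le> measure bdry_measure (cball x (2 * \<epsilon>))"
proof -
  let ?p = "near_point x" let ?m = "DIM('m)"
  have sub: "\<Gamma> \<inter> cball ?p \<epsilon> \<subseteq> \<Gamma> \<inter> cball x (2 * \<epsilon>)"
  proof
    fix y assume y: "y \<in> \<Gamma> \<inter> cball ?p \<epsilon>"
    have "dist x y \<le> dist x ?p + dist ?p y" by (rule dist_triangle)
    then show "y \<in> \<Gamma> \<inter> cball x (2 * \<epsilon>)" using y x near_point(2)[of x] by simp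
  qed
  have "ennreal (unit_ball_vol (real ?m) * (\<epsilon> / (1 + L)) ^ ?m) \<le> 2 ^ ?m * hausdorff_outer ?m (\<Gamma> \<inter> cball ?p \<epsilon>)"
    by (rule hausdorff_lower_density[OF near_point(1) \<epsilon>])
  also have "\<dots> \<le> 2 ^ ?m * hausdorff_outer ?m (\<Gamma> \<inter> cball x (2 * \<epsilon>))"
    by (intro mult_left_mono hausdorff_outer_mono sub) simp
  also have "hausdorff_outer ?m (\<Gamma> \<inter> cball x (2 * \<epsilon>)) = emeasure bdry_measure (cball x (2 * \<epsilon>))"
    using closed by (simp add: emeasure_bdry_measure emeasure_hausdorff_measure)
  also have "\<dots> = ennreal (measure bdry_measure (cball x (2 * \<epsilon>)))"
    using fin by (intro emeasure_eq_ennreal_measure) simp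
  also have "2 ^ ?m * \<dots> = ennreal (2 ^ ?m * measure bdry_measure (cball x (2 * \<epsilon>)))"
    by (subst ennreal_mult) (auto simp flip: ennreal_power ennreal_numeral)
  finally have "unit_ball_vol (real ?m) * (\<epsilon> / (1 + L)) ^ ?m \<le> 2 ^ ?m * measure bdry_measure (cball x (2 * \<epsilon>))"
    by (subst (asm) ennreal_le_iff) auto
  then have "unit_ball_vol (real ?m) * (\<epsilon> / (1 + L)) ^ ?m / 2 ^ ?m \<le> measure bdry_measure (cball x (2 * \<epsilon>))"
    by (simp add: pos_divide_le_eq mult.commute)
  also have "unit_ball_vol (real ?m) * (\<epsilon> / (1 + L)) ^ ?m / 2 ^ ?m = density_const * \<epsilon> ^ ?m"
    unfolding density_const_def power_divide power_mult_distrib[of 2 "1 + L"] by simp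
  finally show ?thesis .
qed

lemma norm_normal: "x \<in> \<Omega> \<Longrightarrow> norm (normal x) = 1"
  using bdist_pos[of x] near_point(2)[of x] by (simp add: normal_def dist_norm)

section \<open>The boundary layer\<close>

definition layer :: "real \<Rightarrow> ('m \<times> real) set" where
  "layer \<epsilon> = \<Omega> \<inter> {x. bdist x < \<epsilon>}"

lemma open_layer: "open (layer \<epsilon>)"
  unfolding layer_def by (intro open_Int open_\<Omega> open_Collect_less continuous_bdist continuous_on_const)

text \<open>The gradient of \<open>step (bdist x / \<epsilon>)\<close>. Restricting it to the layer
  makes it a Borel field on the whole space, as continuity of \<open>normal\<close> is known near
  the boundary only.\<close>

definition layer_field :: "real \<Rightarrow> 'm \<times> real \<Rightarrow> 'm \<times> real" where
  "layer_field \<epsilon> x = indicator (layer \<epsilon>) x *\<^sub>R ((step' (bdist x / \<epsilon>) / \<epsilon>) *\<^sub>R normal x)"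

lemma layer_field:
  assumes \<epsilon>: "0 < \<epsilon>" "\<epsilon> < reach"
  shows "(\<lambda>x. indicator (layer \<epsilon>) x *\<^sub>R normal x) \<in> borel_measurable borel"
    "layer_field \<epsilon> \<in> borel_measurable borel" "norm (layer_field \<epsilon> x) \<le> 8 / \<epsilon> * indicator (layer \<epsilon>) x"
proof -
  have q: "continuous_on (layer \<epsilon>) (\<lambda>x. bdist x / \<epsilon>)" using \<epsilon> by (intro continuous_intros) auto
  have nc: "continuous_on (layer \<epsilon>) normal"
    by (rule continuous_on_subset[OF normal_continuous]) (use \<Omega>_not_\<Gamma> \<epsilon> in \<open>auto simp: layer_def\<close>)
  show "(\<lambda>x. indicator (layer \<epsilon>) x *\<^sub>R normal x) \<in> borel_measurable borel"
    by (rule borel_measurable_continuous_on_indicator[OF _ nc]) (simp add: borel_open open_layer)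
  have "continuous_on (layer \<epsilon>) (\<lambda>x. (step' (bdist x / \<epsilon>) / \<epsilon>) *\<^sub>R normal x)"
    using \<epsilon> by (intro continuous_intros nc continuous_on_compose2[OF continuous_step'[of UNIV] q]) auto
  then have "(\<lambda>x. indicator (layer \<epsilon>) x *\<^sub>R ((step' (bdist x / \<epsilon>) / \<epsilon>) *\<^sub>R normal x)) \<in> borel_measurable borel"
    by (rule borel_measurable_continuous_on_indicator[rotated]) (simp add: borel_open open_layer)
  then show "layer_field \<epsilon> \<in> borel_measurable borel" by (simp add: layer_field_def[abs_def])
  show "norm (layer_field \<epsilon> x) \<le> 8 / \<epsilon> * indicator (layer \<epsilon>) x"
  proof (cases "x \<in> layer \<epsilon>")
    case True
    then have "norm (layer_field \<epsilon> x) = step' (bdist x / \<epsilon>) / \<epsilon>"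
      using norm_normal[of x] step'_range(1)[of "bdist x / \<epsilon>"] \<epsilon> by (simp add: layer_field_def layer_def)
    also have "\<dots> \<le> 8 / \<epsilon>" using step'_range(2) \<epsilon> by (intro divide_right_mono) auto
    finally show ?thesis using True by simp
  qed (simp add: layer_field_def)
qed

text \<open>The field is at most \<open>8 / \<epsilon>\<close>, the divisor at least of order
  \<open>\<epsilon> ^ DIM('m)\<close>, and the seminorm bounds the normal mass in the ball by
  \<open>(2 * \<epsilon>) ^ DIM('m \<times> real) * N\<close>.\<close>

lemma layer_bound:
  assumes \<epsilon>: "0 < \<epsilon>" "\<epsilon> < reach" "\<epsilon> < r" "ereal (2 * \<epsilon>) < \<nu>" and y: "y \<in> \<Gamma>"
    and v: "L1_loc \<Omega> v" and N: "0 \<le> N" "b_seminorm \<nu> \<Omega> (\<lambda>x. grad (\<lambda>y. bdist y) x \<bullet> v x) \<le> ennreal N"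
    and fin: "\<And>x. emeasure bdry_measure (cball x (2 * \<epsilon>)) < top"
  shows "(\<integral>\<^sup>+ x\<in>cball y (2 * \<epsilon>). ennreal \<bar>(layer_field \<epsilon> x \<bullet> v x) / measure bdry_measure (cball x (2 * \<epsilon>))\<bar> \<partial>lebesgue)
     \<le> ennreal (8 * 2 ^ DIM('m \<times> real) / density_const * N)"
proof -
  let ?m = "DIM('m)" let ?n = "DIM('m \<times> real)"
  \<comment> \<open>The bound on the layer field divided by the least surface measure of a ball of
    radius \<open>2 * \<epsilon>\<close> about a point of the layer.\<close>
  define c where "c = 8 / \<epsilon> / (density_const * \<epsilon> ^ ?m)"
  have c: "0 < c" using \<epsilon>(1) density_const_pos by (simp add: c_def)
  define h where "h = (\<lambda>x. ennreal \<bar>(indicator (layer \<epsilon>) x *\<^sub>R normal x) \<bullet> (indicator \<Omega> x *\<^sub>R v x)\<bar> * indicator (cball y (2 * \<epsilon>)) x)"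
  have "(\<lambda>x. indicator (layer \<epsilon>) x *\<^sub>R normal x) \<in> borel_measurable lebesgue"
    by (rule measurable_compose[OF measurable_ident_lebesgue_borel layer_field(1)[OF \<epsilon>(1,2)]])
  then have "(\<lambda>x. (indicator (layer \<epsilon>) x *\<^sub>R normal x) \<bullet> (indicator \<Omega> x *\<^sub>R v x)) \<in> borel_measurable lebesgue"
    by (rule borel_measurable_inner[OF _ L1_loc_measurable[OF open_\<Omega> v]])
  then have "(\<lambda>x. ennreal \<bar>(indicator (layer \<epsilon>) x *\<^sub>R normal x) \<bullet> (indicator \<Omega> x *\<^sub>R v x)\<bar>) \<in> borel_measurable lebesgue"
    by (rule measurable_compose) simp
  then have hm: "h \<in> borel_measurable lebesgue"
    unfolding h_def by (rule borel_measurable_times_ennreal) (rule borel_measurable_indicator, simp)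
  have pt: "ennreal \<bar>(layer_field \<epsilon> x \<bullet> v x) / measure bdry_measure (cball x (2 * \<epsilon>))\<bar> * indicator (cball y (2 * \<epsilon>)) x \<le> ennreal c * h x" for x
  proof (cases "x \<in> layer \<epsilon> \<and> x \<in> cball y (2 * \<epsilon>)")
    case True
    then have x: "x \<in> \<Omega>" "bdist x < \<epsilon>" by (auto simp: layer_def)
    have m: "density_const * \<epsilon> ^ ?m \<le> measure bdry_measure (cball x (2 * \<epsilon>))"
      by (rule bdry_measure_lower_density[OF \<epsilon>(1,3) x(2) fin])
    have p: "0 < density_const * \<epsilon> ^ ?m" using \<epsilon>(1) density_const_pos by simp
    have "\<bar>layer_field \<epsilon> x \<bullet> v x\<bar> = (step' (bdist x / \<epsilon>) / \<epsilon>) * \<bar>normal x \<bullet> v x\<bar>"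
      using True step'_range(1)[of "bdist x / \<epsilon>"] \<epsilon>(1) by (simp add: layer_field_def abs_mult)
    also have "\<dots> \<le> 8 / \<epsilon> * \<bar>normal x \<bullet> v x\<bar>"
      using step'_range(2)[of "bdist x / \<epsilon>"] \<epsilon>(1) by (intro mult_right_mono divide_right_mono) auto
    finally have "\<bar>(layer_field \<epsilon> x \<bullet> v x) / measure bdry_measure (cball x (2 * \<epsilon>))\<bar> \<le> (8 / \<epsilon> * \<bar>normal x \<bullet> v x\<bar>) / (density_const * \<epsilon> ^ ?m)"
      using m p \<epsilon>(1) by (simp only: abs_divide) (intro frac_le; auto)
    also have "\<dots> = c * \<bar>normal x \<bullet> v x\<bar>" by (simp add: c_def)
    finally have "ennreal \<bar>(layer_field \<epsilon> x \<bullet> v x) / measure bdry_measure (cball x (2 * \<epsilon>))\<bar> \<le> ennreal (c * \<bar>normal x \<bullet> v x\<bar>)"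
      by (rule ennreal_leI)
    also have "\<dots> = ennreal c * ennreal \<bar>normal x \<bullet> v x\<bar>" using c by (intro ennreal_mult) auto
    finally show ?thesis using True x(1) by (simp add: h_def)
  next
    case False
    then show ?thesis by (cases "x \<in> layer \<epsilon>") (auto simp: layer_field_def)
  qed
  have h: "(\<integral>\<^sup>+ x. h x \<partial>lebesgue) \<le> ennreal ((2 * \<epsilon>) ^ ?n * N)"
  proof -
    let ?I = "\<integral>\<^sup>+ x\<in>\<Omega> \<inter> cball y (2 * \<epsilon>). ennreal \<bar>grad (\<lambda>y. bdist y) x \<bullet> v x\<bar> \<partial>lebesgue"
    have "(\<integral>\<^sup>+ x. h x \<partial>lebesgue) \<le> ?I"
    proof (rule nn_integral_mono)
      fix x
      show "h x \<le> ennreal \<bar>grad (\<lambda>y. bdist y) x \<bullet> v x\<bar> * indicator (\<Omega> \<inter> cball y (2 * \<epsilon>)) x"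
      proof (cases "x \<in> layer \<epsilon> \<and> x \<in> cball y (2 * \<epsilon>)")
        case True
        then have x: "x \<in> \<Omega>" "bdist x < reach" using \<epsilon>(2) by (auto simp: layer_def)
        \<comment> \<open>Inside the layer the gradient in the seminorm exists at every point, so
          the two integrands agree there without exceptional sets.\<close>
        have "grad (\<lambda>y. bdist y) x = normal x"
          by (rule has_derivative_gradI(1)[OF infdist_has_derivative[OF x(2) \<Omega>_not_\<Gamma>[OF x(1)]]])
        then show ?thesis using True x(1) by (simp add: h_def)
      next
        case False
        then have "h x = 0" unfolding h_def by (cases "x \<in> layer \<epsilon>") auto
        then show ?thesis by simp
      qed
    qed
    moreover have "ennreal (1 / (2 * \<epsilon>) ^ ?n) * ?I \<le> ennreal N"
    proof -
      \<comment> \<open>The seminorm is used at the radius over which mass is spread; this explains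
        the condition \<open>2 * \<epsilon> < \<nu>\<close> and the power of 2 in the
        constant.\<close>
      have "(y, 2 * \<epsilon>) \<in> {(x, s). x \<in> \<Gamma> \<and> 0 < s \<and> ereal s < \<nu>}" using y \<epsilon> by simp
      from SUP_upper[OF this, of "\<lambda>(x, s). ennreal (1 / s ^ ?n) * (\<integral>\<^sup>+ z\<in>\<Omega> \<inter> cball x s. ennreal \<bar>grad (\<lambda>y. bdist y) z \<bullet> v z\<bar> \<partial>lebesgue)"]
      have "ennreal (1 / (2 * \<epsilon>) ^ ?n) * ?I \<le> b_seminorm \<nu> \<Omega> (\<lambda>x. grad (\<lambda>y. bdist y) x \<bullet> v x)"
        unfolding b_seminorm_def by simp
      then show ?thesis using N(2) by (rule order_trans)
    qed
    then have "ennreal ((2 * \<epsilon>) ^ ?n) * (ennreal (1 / (2 * \<epsilon>) ^ ?n) * ?I) \<le> ennreal ((2 * \<epsilon>) ^ ?n) * ennreal N"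
      by (rule mult_left_mono) simp
    moreover have "ennreal ((2 * \<epsilon>) ^ ?n) * (ennreal (1 / (2 * \<epsilon>) ^ ?n) * ?I) = ?I"
    proof -
      have "ennreal ((2 * \<epsilon>) ^ ?n) * ennreal (1 / (2 * \<epsilon>) ^ ?n) = ennreal ((2 * \<epsilon>) ^ ?n * (1 / (2 * \<epsilon>) ^ ?n))"
        by (rule ennreal_mult[symmetric]) (use \<epsilon>(1) in auto)
      also have "(2 * \<epsilon>) ^ ?n * (1 / (2 * \<epsilon>) ^ ?n) = 1" using \<epsilon>(1) by simp
      finally show ?thesis by (simp only: mult.assoc[symmetric]) simp
    qed
    moreover have "ennreal ((2 * \<epsilon>) ^ ?n) * ennreal N = ennreal ((2 * \<epsilon>) ^ ?n * N)"
      by (rule ennreal_mult[symmetric]) (use \<epsilon>(1) N(1) in auto)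
    ultimately show ?thesis by (simp only:)
  qed
  have "(\<integral>\<^sup>+ x\<in>cball y (2 * \<epsilon>). ennreal \<bar>(layer_field \<epsilon> x \<bullet> v x) / measure bdry_measure (cball x (2 * \<epsilon>))\<bar> \<partial>lebesgue)
      \<le> (\<integral>\<^sup>+ x. ennreal c * h x \<partial>lebesgue)"
    by (rule nn_integral_mono) (rule pt)
  also have "\<dots> = ennreal c * (\<integral>\<^sup>+ x. h x \<partial>lebesgue)" by (rule nn_integral_cmult[OF hm])
  also have "\<dots> \<le> ennreal c * ennreal ((2 * \<epsilon>) ^ ?n * N)" by (rule mult_left_mono[OF h]) simp
  also have "\<dots> = ennreal (c * ((2 * \<epsilon>) ^ ?n * N))"
    by (rule ennreal_mult[symmetric]) (use c \<epsilon>(1) N(1) in auto)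
  \<comment> \<open>All powers of \<epsilon> cancel, because the dimension \<open>?n\<close> of the
    space exceeds that of the boundary by one.\<close>
  also have "c * ((2 * \<epsilon>) ^ ?n * N) = 8 * 2 ^ ?n / density_const * N"
  proof -
    have n: "?n = Suc ?m" by simp
    show ?thesis unfolding n c_def power_mult_distrib using \<epsilon>(1) density_const_pos by (simp add: field_simps)
  qed
  finally show ?thesis .
qed

section \<open>The flux functional and its localisation\<close>

definition flux :: "('m \<times> real \<Rightarrow> 'm \<times> real) \<Rightarrow> ('m \<times> real \<Rightarrow> real) \<Rightarrow> ('m \<times> real \<Rightarrow> real) \<Rightarrow> real" where
  "flux v w \<phi> = (LINT x:\<Omega>|lebesgue. w x * \<phi> x) + (LINT x:\<Omega>|lebesgue. v x \<bullet> grad \<phi> x)"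

text \<open>The test function vanishes from some distance strictly below \<open>\<delta>\<close> on,
  so it is zero in a neighbourhood of each point of \<open>\<Omega>\<close> outside the strip, and
  the gradient vanishes with it.\<close>

lemma trace_test_vanishes:
  assumes \<phi>: "trace_test \<delta> \<Omega> \<phi>" and R: "supp \<phi> \<subseteq> cball 0 R" and x: "x \<in> \<Omega>" "x \<notin> bdry_strip \<Omega> \<delta> \<inter> cball 0 R"
  shows "\<phi> x = 0" "grad \<phi> x = 0"
proof -
  obtain d where d: "ereal d < \<delta>" "\<And>x. x \<in> \<Omega> \<Longrightarrow> d \<le> bdist x \<Longrightarrow> \<phi> x = 0"
    using \<phi> unfolding trace_test_def bdry_strip_def by (auto simp: not_less)
  have "\<phi> x = 0 \<and> grad \<phi> x = 0"
  proof (cases "x \<in> cball 0 R")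
    case False
    then have "x \<notin> supp \<phi>" using R by blast
    then show ?thesis using supp_zero[of x \<phi>] grad_zero_outside_supp[of x \<phi>] by blast
  next
    case True
    then have "\<delta> \<le> ereal (bdist x)" using x by (simp add: bdry_strip_def)
    then have dx: "d < bdist x" using d(1) by (metis ereal_less_eq(3) linorder_not_le order_le_less_trans order_less_irrefl)
    have op: "open (\<Omega> \<inter> {x. d < bdist x})"
      by (intro open_Int open_\<Omega> open_Collect_less continuous_bdist continuous_on_const)
    have "((\<lambda>y. 0::real) has_derivative (\<lambda>u. 0)) (at x)" by simp
    then have "(\<phi> has_derivative (\<lambda>u. 0)) (at x)"
      by (rule has_derivative_transform_within_open[OF _ op]) (use x(1) dx d(2) in auto)
    then have "grad \<phi> x = 0" using has_derivative_gradI(1)[of \<phi> 0 x] by simp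
    then show ?thesis using d(2)[OF x(1)] dx by simp
  qed
  then show "\<phi> x = 0" "grad \<phi> x = 0" by simp_all
qed

text \<open>The weak divergence annihilates the flux of the cutoff function. Subtracting it leaves
  the terms with \<open>1 - step\<close>, and the differentiated step survives as the layer
  integral.\<close>

lemma flux_identity:
  assumes \<epsilon>: "0 < \<epsilon>" "\<epsilon> < reach" and \<phi>: "trace_test \<delta> \<Omega> \<phi>" and R: "supp \<phi> \<subseteq> cball 0 R"
    and v: "L1_loc \<Omega> v" and w: "weak_divergence_on (bdry_strip \<Omega> \<delta>) v w"
    and iw: "integrable lebesgue (\<lambda>x. indicator (bdry_strip \<Omega> \<delta> \<inter> cball 0 R) x * w x)"
    and iv: "integrable lebesgue (\<lambda>x. indicator (bdry_strip \<Omega> \<delta> \<inter> cball 0 R) x *\<^sub>R v x)"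
  shows "flux v w \<phi> + (LINT x|lebesgue. \<phi> x * (layer_field \<epsilon> x \<bullet> v x)) =
    (LINT x|lebesgue. (indicator (bdry_strip \<Omega> \<delta> \<inter> cball 0 R) x * w x) * (\<phi> x * (1 - step (bdist x / \<epsilon>)))) +
    (LINT x|lebesgue. (indicator (bdry_strip \<Omega> \<delta> \<inter> cball 0 R) x *\<^sub>R v x) \<bullet> ((1 - step (bdist x / \<epsilon>)) *\<^sub>R grad \<phi> x))"
proof -
  let ?A = "bdry_strip \<Omega> \<delta> \<inter> cball 0 R"
  \<comment> \<open>Truncation to the part of the strip seen by \<open>\<phi>\<close> changes no
    integral below and makes each term integrable, so the terms may be split and recombined.\<close>
  define w1 where "w1 = (\<lambda>x. indicator ?A x * w x)"
  define v1 where "v1 = (\<lambda>x. indicator ?A x *\<^sub>R v x)"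
  define S where "S = (\<lambda>x. step (bdist x / \<epsilon>))"
  have iw1: "integrable lebesgue w1" and iv1: "integrable lebesgue v1" using iw iv by (simp_all add: w1_def v1_def)
  have C\<phi>: "Ck 1 \<phi>" and cpt: "compact (supp \<phi>)" using \<phi> by (simp_all add: trace_test_def)
  have c\<phi>: "continuous_on UNIV \<phi>" by (rule Ck_1_continuous[OF C\<phi>])
  have cg: "continuous_on UNIV (grad \<phi>)" by (rule conjunct2[OF C\<phi>[unfolded Ck_1_iff]])
  have cS: "continuous_on UNIV S" unfolding S_def
    using \<epsilon>(1) by (intro continuous_on_compose2[OF continuous_step[of UNIV]] continuous_intros) auto
  obtain b1 where b1: "0 \<le> b1" "\<forall>x. norm (\<phi> x) \<le> b1"
    using bounded_if_continuous_compact_support[OF c\<phi> cpt supp_zero[of _ \<phi>]] by auto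
  obtain b2 where b2: "0 \<le> b2" "\<forall>x. norm (grad \<phi> x) \<le> b2"
    using bounded_if_continuous_compact_support[OF cg cpt grad_zero_outside_supp[of _ \<phi>]] by auto
  have b1': "\<bar>\<phi> x\<bar> \<le> b1" and b2': "norm (grad \<phi> x) \<le> b2" for x
    using spec[OF b1(2), of x] spec[OF b2(2), of x] by simp_all
  have S01: "0 \<le> S x" "S x \<le> 1" for x using step_range by (simp_all add: S_def)
  have van: "\<phi> x = 0" "grad \<phi> x = 0" if "x \<in> \<Omega>" "x \<notin> ?A" for x
    using trace_test_vanishes[OF \<phi> R that] by simp_all
  have strip: "x \<in> bdry_strip \<Omega> \<delta> \<Longrightarrow> x \<in> \<Omega>" for x by (simp add: bdry_strip_def)
  have m\<phi>: "\<phi> \<in> borel_measurable lebesgue" and mg: "grad \<phi> \<in> borel_measurable lebesgue" and mS: "S \<in> borel_measurable lebesgue"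
    using c\<phi> cg cS by (simp_all add: continuous_borel_measurable_lebesgue)
  have mf: "layer_field \<epsilon> \<in> borel_measurable lebesgue"
    by (rule measurable_compose[OF measurable_ident_lebesgue_borel layer_field(2)[OF \<epsilon>]])
  have i1: "integrable lebesgue (\<lambda>x. w1 x * \<phi> x)"
    by (rule integrable_mult_bounded(1)[OF iw1 m\<phi> b1'])
  have i2: "integrable lebesgue (\<lambda>x. v1 x \<bullet> grad \<phi> x)"
    by (rule integrable_inner_bounded(1)[OF iv1 mg b2'])
  have i3: "integrable lebesgue (\<lambda>x. w1 x * (\<phi> x * S x))"
  proof (rule integrable_mult_bounded(1)[OF iw1 borel_measurable_times[OF m\<phi> mS]])
    show "\<bar>\<phi> x * S x\<bar> \<le> b1 * 1" for x
      unfolding abs_mult using b1(1) b1'[of x] S01[of x] by (intro mult_mono) auto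
  qed
  have i4: "integrable lebesgue (\<lambda>x. v1 x \<bullet> (S x *\<^sub>R grad \<phi> x))"
  proof (rule integrable_inner_bounded(1)[OF iv1 borel_measurable_scaleR[OF mS mg]])
    show "norm (S x *\<^sub>R grad \<phi> x) \<le> 1 * b2" for x
      unfolding norm_scaleR using b2(1) b2'[of x] S01[of x] by (intro mult_mono) auto
  qed
  have i5: "integrable lebesgue (\<lambda>x. v1 x \<bullet> (\<phi> x *\<^sub>R layer_field \<epsilon> x))"
  proof (rule integrable_inner_bounded(1)[OF iv1 borel_measurable_scaleR[OF m\<phi> mf]])
    fix x
    have "norm (layer_field \<epsilon> x) \<le> 8 / \<epsilon>"
      using layer_field(3)[OF \<epsilon>, of x] \<epsilon>(1) by (cases "x \<in> layer \<epsilon>") auto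
    then show "norm (\<phi> x *\<^sub>R layer_field \<epsilon> x) \<le> b1 * (8 / \<epsilon>)"
      unfolding norm_scaleR using b1(1) b1'[of x] by (intro mult_mono) auto
  qed
  have e1: "(LINT x:\<Omega>|lebesgue. w x * \<phi> x) = (LINT x|lebesgue. w1 x * \<phi> x)"
    unfolding set_lebesgue_integral_def
  proof (rule Bochner_Integration.integral_cong[OF refl])
    fix x show "indicator \<Omega> x *\<^sub>R (w x * \<phi> x) = w1 x * \<phi> x"
      using van(1)[of x] strip[of x] by (cases "x \<in> ?A"; cases "x \<in> \<Omega>") (auto simp: w1_def)
  qed
  have e2: "(LINT x:\<Omega>|lebesgue. v x \<bullet> grad \<phi> x) = (LINT x|lebesgue. v1 x \<bullet> grad \<phi> x)"
    unfolding set_lebesgue_integral_def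
  proof (rule Bochner_Integration.integral_cong[OF refl])
    fix x show "indicator \<Omega> x *\<^sub>R (v x \<bullet> grad \<phi> x) = v1 x \<bullet> grad \<phi> x"
      using van(2)[of x] strip[of x] by (cases "x \<in> ?A"; cases "x \<in> \<Omega>") (auto simp: v1_def)
  qed
  have e3: "(LINT x|lebesgue. \<phi> x * (layer_field \<epsilon> x \<bullet> v x)) = (LINT x|lebesgue. v1 x \<bullet> (\<phi> x *\<^sub>R layer_field \<epsilon> x))"
  proof (rule Bochner_Integration.integral_cong[OF refl])
    fix x show "\<phi> x * (layer_field \<epsilon> x \<bullet> v x) = v1 x \<bullet> (\<phi> x *\<^sub>R layer_field \<epsilon> x)"
      using van(1)[of x] by (cases "x \<in> ?A"; cases "x \<in> \<Omega>") (auto simp: v1_def inner_commute layer_field_def layer_def)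
  qed
  have e4: "(LINT x:bdry_strip \<Omega> \<delta>|lebesgue. w x * cutoff \<epsilon> \<phi> x) = (LINT x|lebesgue. w1 x * (\<phi> x * S x))"
    unfolding set_lebesgue_integral_def
  proof (rule Bochner_Integration.integral_cong[OF refl])
    fix x show "indicator (bdry_strip \<Omega> \<delta>) x *\<^sub>R (w x * cutoff \<epsilon> \<phi> x) = w1 x * (\<phi> x * S x)"
      using van(1)[of x] strip[of x] by (cases "x \<in> ?A"; cases "x \<in> bdry_strip \<Omega> \<delta>") (auto simp: w1_def S_def cutoff_def)
  qed
  have e5: "(LINT x:bdry_strip \<Omega> \<delta>|lebesgue. v x \<bullet> grad (cutoff \<epsilon> \<phi>) x)
      = (LINT x|lebesgue. v1 x \<bullet> (S x *\<^sub>R grad \<phi> x) + v1 x \<bullet> (\<phi> x *\<^sub>R layer_field \<epsilon> x))"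
    unfolding set_lebesgue_integral_def cutoff_C1(2)[OF \<epsilon> C\<phi>]
  proof (rule Bochner_Integration.integral_cong[OF refl])
    fix x
    have lf: "(\<phi> x * (step' (bdist x / \<epsilon>) / \<epsilon>)) *\<^sub>R normal x = \<phi> x *\<^sub>R layer_field \<epsilon> x" if "x \<in> \<Omega>"
    proof (cases "bdist x < \<epsilon>")
      case True
      then show ?thesis using that by (simp add: layer_field_def layer_def)
    next
      case False
      \<comment> \<open>From distance \<open>\<epsilon>\<close> on \<open>step'\<close> is 0, in
        agreement with the restriction to the layer.\<close>
      then have "1 \<le> bdist x / \<epsilon>" using \<epsilon>(1) by simp
      then show ?thesis using False by (simp add: step_one layer_field_def layer_def)
    qed
    show "indicator (bdry_strip \<Omega> \<delta>) x *\<^sub>R (v x \<bullet> cutoff_grad \<epsilon> \<phi> x)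
       = v1 x \<bullet> (S x *\<^sub>R grad \<phi> x) + v1 x \<bullet> (\<phi> x *\<^sub>R layer_field \<epsilon> x)"
    proof (cases "x \<in> bdry_strip \<Omega> \<delta>")
      case True
      then have "cutoff_grad \<epsilon> \<phi> x = S x *\<^sub>R grad \<phi> x + \<phi> x *\<^sub>R layer_field \<epsilon> x"
        using strip lf by (simp add: cutoff_grad_def S_def)
      then show ?thesis using True van[OF strip[OF True]] by (cases "x \<in> ?A") (simp_all add: v1_def inner_add_right)
    qed (simp add: v1_def)
  qed
  \<comment> \<open>The cutoff has compact support inside the strip; \<open>\<phi>\<close> itself
    may be nonzero on the boundary and is not admissible here.\<close>
  have "(LINT x:bdry_strip \<Omega> \<delta>|lebesgue. w x * cutoff \<epsilon> \<phi> x) = - (LINT x:bdry_strip \<Omega> \<delta>|lebesgue. v x \<bullet> grad (cutoff \<epsilon> \<phi>) x)"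
  proof (rule weak_divergence_C1[OF open_bdry_strip[OF open_\<Omega>] L1_loc_subset[OF v] w cutoff_C1(1)[OF \<epsilon> C\<phi>] cutoff_supp[OF \<epsilon>(1) \<phi>]])
    show "bdry_strip \<Omega> \<delta> \<subseteq> \<Omega>" using strip by blast
  qed
  then have key: "(LINT x|lebesgue. w1 x * (\<phi> x * S x)) = - ((LINT x|lebesgue. v1 x \<bullet> (S x *\<^sub>R grad \<phi> x)) + (LINT x|lebesgue. v1 x \<bullet> (\<phi> x *\<^sub>R layer_field \<epsilon> x)))"
    unfolding e4 e5 Bochner_Integration.integral_add[OF i4 i5] .
  have "(LINT x|lebesgue. w1 x * (\<phi> x * (1 - S x))) = (LINT x|lebesgue. w1 x * \<phi> x) - (LINT x|lebesgue. w1 x * (\<phi> x * S x))"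
    using Bochner_Integration.integral_diff[OF i1 i3] by (simp add: algebra_simps)
  moreover have "(LINT x|lebesgue. v1 x \<bullet> ((1 - S x) *\<^sub>R grad \<phi> x)) = (LINT x|lebesgue. v1 x \<bullet> grad \<phi> x) - (LINT x|lebesgue. v1 x \<bullet> (S x *\<^sub>R grad \<phi> x))"
    using Bochner_Integration.integral_diff[OF i2 i4] by (simp add: left_diff_distrib)
  ultimately show ?thesis
    using key unfolding flux_def e1 e2 e3 w1_def[symmetric] v1_def[symmetric] S_def[symmetric]
    by (simp add: w1_def v1_def S_def)
qed

end

section \<open>The normal trace\<close>

context graph_domain
begin

section \<open>From surface measure to the boundary measure\<close>

text \<open>Traces are defined over a measure on the subspace \<open>\<Gamma>\<close>, the weak
  limit lives over a measure on the whole space; integrals are translated here.\<close>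

lemma bdry_integral:
  fixes f :: "'m \<times> real \<Rightarrow> real"
  assumes f: "f \<in> borel_measurable borel"
  shows "(LINT x|surface_measure \<Omega>. f x) = (LINT x|bdry_measure. f x)"
    "integrable (surface_measure \<Omega>) f \<longleftrightarrow> integrable bdry_measure f"
proof -
  let ?H = "hausdorff_measure DIM('m) :: ('m \<times> real) measure"
  have S: "surface_measure \<Omega> = restrict_space ?H \<Gamma>" by (simp add: surface_measure_def)
  have G: "\<Gamma> \<inter> space ?H \<in> sets ?H" using closed by simp
  have T: "bdry_measure = density ?H (\<lambda>x. ennreal (indicator \<Gamma> x))"
    unfolding bdry_measure_def by (intro arg_cong[of _ _ "density ?H"]) (auto simp: ennreal_indicator)
  have i: "(indicator \<Gamma> :: _ \<Rightarrow> real) \<in> borel_measurable ?H" and fm: "f \<in> borel_measurable ?H"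
    using G f by (simp_all cong: measurable_cong_sets)
  show "(LINT x|surface_measure \<Omega>. f x) = (LINT x|bdry_measure. f x)"
    unfolding S T integral_restrict_space[OF G] by (rule integral_density[symmetric, OF fm i]) simp
  show "integrable (surface_measure \<Omega>) f \<longleftrightarrow> integrable bdry_measure f"
    unfolding S T integrable_restrict_space[OF G] by (rule integrable_density[symmetric, OF fm i]) simp
qed

lemma AE_surface_measure:
  "(AE x in surface_measure \<Omega>. P x) \<longleftrightarrow> (AE x in bdry_measure. P x)"
proof -
  let ?H = "hausdorff_measure DIM('m) :: ('m \<times> real) measure"
  have S: "surface_measure \<Omega> = restrict_space ?H \<Gamma>" by (simp add: surface_measure_def)
  have G: "\<Gamma> \<inter> space ?H \<in> sets ?H" using closed by simp
  have i: "(indicator \<Gamma> :: _ \<Rightarrow> ennreal) \<in> borel_measurable ?H"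
    using closed by (intro borel_measurable_indicator) simp
  have "(AE x in bdry_measure. P x) \<longleftrightarrow> (AE x in ?H. 0 < (indicator \<Gamma> x :: ennreal) \<longrightarrow> P x)"
    unfolding bdry_measure_def by (rule AE_density[OF i])
  also have "\<dots> \<longleftrightarrow> (AE x in ?H. x \<in> \<Gamma> \<longrightarrow> P x)"
    by (intro AE_cong) (auto simp: indicator_def)
  also have "\<dots> \<longleftrightarrow> (AE x in surface_measure \<Omega>. P x)"
    unfolding S by (rule AE_restrict_space_iff[symmetric, OF G])
  finally show ?thesis ..
qed

lemma measurable_surface_measure:
  "g \<in> borel_measurable (surface_measure \<Omega>) \<longleftrightarrow> (\<lambda>x. indicator \<Gamma> x *\<^sub>R (g x :: real)) \<in> borel_measurable borel"
proof -
  have "\<Gamma> \<inter> space (hausdorff_measure DIM('m)) \<in> sets (hausdorff_measure DIM('m))" using closed by simp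
  from borel_measurable_restrict_space_iff[OF this, of g]
  show ?thesis by (simp add: surface_measure_def cong: measurable_cong_sets)
qed

text \<open>Dominated convergence: integrability up to the boundary provides the majorant, and the
  factor \<open>1 - step\<close> has values between 0 and 1.\<close>

lemma remainder_tendsto_0:
  assumes \<phi>: "trace_test \<delta> \<Omega> \<phi>"
    and iw: "integrable lebesgue (\<lambda>x. indicator (bdry_strip \<Omega> \<delta> \<inter> cball 0 R) x * w x)"
    and iv: "integrable lebesgue (\<lambda>x. indicator (bdry_strip \<Omega> \<delta> \<inter> cball 0 R) x *\<^sub>R v x)"
    and \<epsilon>: "\<And>n. 0 < \<epsilon> n" "\<epsilon> \<longlonglongrightarrow> 0"
  shows "(\<lambda>n. (LINT x|lebesgue. (indicator (bdry_strip \<Omega> \<delta> \<inter> cball 0 R) x * w x) * (\<phi> x * (1 - step (bdist x / \<epsilon> n)))) +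
    (LINT x|lebesgue. (indicator (bdry_strip \<Omega> \<delta> \<inter> cball 0 R) x *\<^sub>R v x) \<bullet> ((1 - step (bdist x / \<epsilon> n)) *\<^sub>R grad \<phi> x))) \<longlonglongrightarrow> 0"
proof -
  let ?A = "bdry_strip \<Omega> \<delta> \<inter> cball 0 R"
  have C\<phi>: "Ck 1 \<phi>" and cpt: "compact (supp \<phi>)" using \<phi> by (simp_all add: trace_test_def)
  have c\<phi>: "continuous_on UNIV \<phi>" by (rule Ck_1_continuous[OF C\<phi>])
  have cg: "continuous_on UNIV (grad \<phi>)" by (rule conjunct2[OF C\<phi>[unfolded Ck_1_iff]])
  have cS: "continuous_on UNIV (\<lambda>x. step (bdist x / \<epsilon> n))" for n
    using \<epsilon>(1)[of n] by (intro continuous_on_compose2[OF continuous_step[of UNIV]] continuous_intros) auto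
  obtain b1 where b1: "0 \<le> b1" "\<forall>x. norm (\<phi> x) \<le> b1"
    using bounded_if_continuous_compact_support[OF c\<phi> cpt supp_zero[of _ \<phi>]] by auto
  obtain b2 where b2: "0 \<le> b2" "\<forall>x. norm (grad \<phi> x) \<le> b2"
    using bounded_if_continuous_compact_support[OF cg cpt grad_zero_outside_supp[of _ \<phi>]] by auto
  have b1': "\<bar>\<phi> x\<bar> \<le> b1" and b2': "norm (grad \<phi> x) \<le> b2" for x
    using spec[OF b1(2), of x] spec[OF b2(2), of x] by simp_all
  have m\<phi>: "\<phi> \<in> borel_measurable lebesgue" and mg: "grad \<phi> \<in> borel_measurable lebesgue"
    and mS: "(\<lambda>x. step (bdist x / \<epsilon> n)) \<in> borel_measurable lebesgue" for n
    using c\<phi> cg cS by (simp_all add: continuous_borel_measurable_lebesgue)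
  \<comment> \<open>Points of the open domain have positive distance to the boundary, so the
    shrinking transition zone eventually passes them.\<close>
  have ev: "eventually (\<lambda>n. step (bdist x / \<epsilon> n) = 1) sequentially" if "x \<in> ?A" for x
  proof -
    have "0 < bdist x" using that bdist_pos by (simp add: bdry_strip_def)
    from order_tendstoD(2)[OF \<epsilon>(2) this] show ?thesis
    proof (rule eventually_mono)
      fix n assume "\<epsilon> n < bdist x"
      then have "1 \<le> bdist x / \<epsilon> n" using \<epsilon>(1)[of n] by simp
      then show "step (bdist x / \<epsilon> n) = 1" by (rule step_one)
    qed
  qed
  have S01: "\<bar>1 - step t\<bar> \<le> 1" for t using step_range[of t] by simp
  have "(\<lambda>n. LINT x|lebesgue. (indicator ?A x * w x) * (\<phi> x * (1 - step (bdist x / \<epsilon> n)))) \<longlonglongrightarrow> (LINT x|(lebesgue :: ('m \<times> real) measure). 0)"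
  proof (rule integral_dominated_convergence[where w = "\<lambda>x. b1 * \<bar>indicator ?A x * w x\<bar>"])
    show "integrable lebesgue (\<lambda>x. b1 * \<bar>indicator ?A x * w x\<bar>)" by (intro integrable_mult_right integrable_abs iw)
    show "(\<lambda>x. (indicator ?A x * w x) * (\<phi> x * (1 - step (bdist x / \<epsilon> n)))) \<in> borel_measurable lebesgue" for n
      by (intro borel_measurable_times borel_measurable_diff borel_measurable_const m\<phi> mS borel_measurable_integrable[OF iw])
    show "AE x in lebesgue. norm ((indicator ?A x * w x) * (\<phi> x * (1 - step (bdist x / \<epsilon> n)))) \<le> b1 * \<bar>indicator ?A x * w x\<bar>" for n
    proof (rule AE_I2)
      fix x
      have "\<bar>\<phi> x * (1 - step (bdist x / \<epsilon> n))\<bar> \<le> b1 * 1"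
        unfolding abs_mult using b1(1) b1'[of x] S01 by (intro mult_mono) auto
      from mult_left_mono[OF this, of "\<bar>indicator ?A x * w x\<bar>"]
      show "norm ((indicator ?A x * w x) * (\<phi> x * (1 - step (bdist x / \<epsilon> n)))) \<le> b1 * \<bar>indicator ?A x * w x\<bar>"
        by (simp add: abs_mult mult_ac)
    qed
    show "AE x in lebesgue. (\<lambda>n. (indicator ?A x * w x) * (\<phi> x * (1 - step (bdist x / \<epsilon> n)))) \<longlonglongrightarrow> 0"
    proof (rule AE_I2)
      fix x
      show "(\<lambda>n. (indicator ?A x * w x) * (\<phi> x * (1 - step (bdist x / \<epsilon> n)))) \<longlonglongrightarrow> 0"
      proof (cases "x \<in> ?A")
        case True
        from ev[OF True] have "eventually (\<lambda>n. (indicator ?A x * w x) * (\<phi> x * (1 - step (bdist x / \<epsilon> n))) = 0) sequentially"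
          by (rule eventually_mono) simp
        then show ?thesis by (rule tendsto_eventually)
      qed simp
    qed
  qed simp
  moreover have "(\<lambda>n. LINT x|lebesgue. (indicator ?A x *\<^sub>R v x) \<bullet> ((1 - step (bdist x / \<epsilon> n)) *\<^sub>R grad \<phi> x)) \<longlonglongrightarrow> (LINT x|(lebesgue :: ('m \<times> real) measure). 0)"
  proof (rule integral_dominated_convergence[where w = "\<lambda>x. norm (indicator ?A x *\<^sub>R v x) * b2"])
    show "integrable lebesgue (\<lambda>x. norm (indicator ?A x *\<^sub>R v x) * b2)" by (intro integrable_mult_left integrable_norm iv)
    show "(\<lambda>x. (indicator ?A x *\<^sub>R v x) \<bullet> ((1 - step (bdist x / \<epsilon> n)) *\<^sub>R grad \<phi> x)) \<in> borel_measurable lebesgue" for n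
      by (intro borel_measurable_inner borel_measurable_scaleR[of "\<lambda>x. 1 - step (bdist x / \<epsilon> n)"] borel_measurable_diff borel_measurable_const mg mS borel_measurable_integrable[OF iv])
    show "AE x in lebesgue. norm ((indicator ?A x *\<^sub>R v x) \<bullet> ((1 - step (bdist x / \<epsilon> n)) *\<^sub>R grad \<phi> x)) \<le> norm (indicator ?A x *\<^sub>R v x) * b2" for n
    proof (rule AE_I2)
      fix x
      have "norm ((1 - step (bdist x / \<epsilon> n)) *\<^sub>R grad \<phi> x) \<le> 1 * b2"
        unfolding norm_scaleR using b2(1) b2'[of x] S01 by (intro mult_mono) auto
      then have "norm (indicator ?A x *\<^sub>R v x) * norm ((1 - step (bdist x / \<epsilon> n)) *\<^sub>R grad \<phi> x) \<le> norm (indicator ?A x *\<^sub>R v x) * b2"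
        by (intro mult_left_mono) auto
      then show "norm ((indicator ?A x *\<^sub>R v x) \<bullet> ((1 - step (bdist x / \<epsilon> n)) *\<^sub>R grad \<phi> x)) \<le> norm (indicator ?A x *\<^sub>R v x) * b2"
        using Cauchy_Schwarz_ineq2[of "indicator ?A x *\<^sub>R v x" "(1 - step (bdist x / \<epsilon> n)) *\<^sub>R grad \<phi> x"] unfolding real_norm_def by (rule order_trans[rotated])
    qed
    show "AE x in lebesgue. (\<lambda>n. (indicator ?A x *\<^sub>R v x) \<bullet> ((1 - step (bdist x / \<epsilon> n)) *\<^sub>R grad \<phi> x)) \<longlonglongrightarrow> 0"
    proof (rule AE_I2)
      fix x
      show "(\<lambda>n. (indicator ?A x *\<^sub>R v x) \<bullet> ((1 - step (bdist x / \<epsilon> n)) *\<^sub>R grad \<phi> x)) \<longlonglongrightarrow> 0"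
      proof (cases "x \<in> ?A")
        case True
        from ev[OF True] have "eventually (\<lambda>n. (indicator ?A x *\<^sub>R v x) \<bullet> ((1 - step (bdist x / \<epsilon> n)) *\<^sub>R grad \<phi> x) = 0) sequentially"
          by (rule eventually_mono) simp
        then show ?thesis by (rule tendsto_eventually)
      qed simp
    qed
  qed simp
  ultimately show ?thesis using tendsto_add by fastforce
qed

section \<open>Existence and uniqueness of the trace\<close>

lemma flux_density_exists:
  assumes \<delta>: "0 < \<delta>" and \<nu>: "0 < \<nu>"
    and v: "L1_loc \<Omega> v" and N: "0 \<le> N" "b_seminorm \<nu> \<Omega> (\<lambda>x. grad (\<lambda>y. bdist y) x \<bullet> v x) \<le> ennreal N"
    and w: "weak_divergence_on (bdry_strip \<Omega> \<delta>) v w"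
    and iw: "\<And>R. integrable lebesgue (\<lambda>x. indicator (bdry_strip \<Omega> \<delta> \<inter> cball 0 R) x * w x)"
    and iv: "\<And>R. integrable lebesgue (\<lambda>x. indicator (bdry_strip \<Omega> \<delta> \<inter> cball 0 R) x *\<^sub>R v x)"
  obtains u where "u \<in> borel_measurable borel" "\<And>x. \<bar>u x\<bar> \<le> 8 * 2 ^ DIM('m \<times> real) / density_const * N"
    "\<And>\<phi>. trace_test \<delta> \<Omega> \<phi> \<Longrightarrow> (LINT x|bdry_measure. \<phi> x * u x) = flux v w \<phi>"
proof -
  interpret lf: locally_finite_borel bdry_measure \<Gamma> "{\<phi>. trace_test \<delta> \<Omega> \<phi>}"
    by (rule locally_finite[OF \<delta>])
  let ?M = "8 * 2 ^ DIM('m \<times> real) / density_const * N"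
  have M: "0 \<le> ?M" using N(1) density_const_pos by simp
  obtain \<nu>' where \<nu>': "0 < \<nu>'" "ereal \<nu>' < \<nu>" using ereal_dense2[OF \<nu>] by (auto simp: zero_ereal_def)
  \<comment> \<open>Each bound serves one ingredient: \<open>reach\<close> the C1 cutoff,
    \<open>r\<close> the lower density, 1 the smearing, and the real number \<open>\<nu>'\<close>
    below \<open>\<nu>\<close> the seminorm at radius \<open>2 * \<epsilon>\<close>.\<close>
  define e0 where "e0 = min (min reach r) (min 1 \<nu>')"
  have e0: "0 < e0" "e0 \<le> reach" "e0 \<le> r" "e0 \<le> 1" "e0 \<le> \<nu>'" using reach_pos pos(1) \<nu>'(1) by (auto simp: e0_def)
  define a where "a = e0 / 2"
  define s where "s = (\<lambda>n::nat. a / (real n + 1))"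
  define \<epsilon> where "\<epsilon> = (\<lambda>n. s n / 2)"
  have half: "2 * \<epsilon> n \<le> e0 / 2" "0 < \<epsilon> n" for n
  proof -
    have "2 * \<epsilon> n = s n" by (simp add: \<epsilon>_def)
    also have "\<dots> = a / (real n + 1)" by (simp add: s_def)
    also have "\<dots> \<le> a / 1" using e0(1) by (intro divide_left_mono) (auto simp: a_def)
    finally show "2 * \<epsilon> n \<le> e0 / 2" by (simp add: a_def)
    have "0 < a" using e0(1) by (simp add: a_def)
    then show "0 < \<epsilon> n" by (simp add: \<epsilon>_def s_def)
  qed
  have \<epsilon>: "0 < \<epsilon> n" "\<epsilon> n < reach" "\<epsilon> n < r" "2 * \<epsilon> n \<le> 1" "0 < 2 * \<epsilon> n" for n
    using half[of n] e0 by linarith+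
  have \<epsilon>\<nu>: "ereal (2 * \<epsilon> n) < \<nu>" for n
  proof -
    have "ereal (2 * \<epsilon> n) \<le> ereal \<nu>'" using half[of n] e0 by simp
    then show ?thesis using \<nu>'(2) by (rule order_le_less_trans)
  qed
  have \<epsilon>0: "\<epsilon> \<longlonglongrightarrow> 0"
  proof -
    have "(\<lambda>n. a * inverse (real (Suc n)) / 2) \<longlonglongrightarrow> a * 0 / 2"
      by (intro tendsto_divide tendsto_mult tendsto_const LIMSEQ_inverse_real_of_nat) simp
    moreover have "s n = a * inverse (real (Suc n))" for n by (simp add: s_def divide_inverse add.commute)
    then have "\<epsilon> = (\<lambda>n. a * inverse (real (Suc n)) / 2)" by (simp add: \<epsilon>_def)
    ultimately show ?thesis by simp
  qed
  \<comment> \<open>By the flux identity the flux is the limit of the negative layer integrals; the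
    sign reflects that \<open>normal\<close> points inward.\<close>
  define k where "k = (\<lambda>n x. - (layer_field (\<epsilon> n) x \<bullet> v x))"
  have km: "k n \<in> borel_measurable lebesgue" for n
  proof -
    have "layer_field (\<epsilon> n) \<in> borel_measurable lebesgue"
      by (rule measurable_compose[OF measurable_ident_lebesgue_borel layer_field(2)[OF \<epsilon>(1,2)]])
    then have "(\<lambda>x. - (layer_field (\<epsilon> n) x \<bullet> (indicator \<Omega> x *\<^sub>R v x))) \<in> borel_measurable lebesgue"
      by (intro borel_measurable_uminus borel_measurable_inner L1_loc_measurable[OF open_\<Omega> v])
    also have "(\<lambda>x. - (layer_field (\<epsilon> n) x \<bullet> (indicator \<Omega> x *\<^sub>R v x))) = k n"
      by (simp add: k_def fun_eq_iff layer_field_def layer_def indicator_def)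
    finally show ?thesis .
  qed
  have fin: "emeasure bdry_measure (cball x s) < top" for x s by (rule lf.emeasure_bounded) simp
  have kpos: "0 < measure bdry_measure (cball x (2 * \<epsilon> n))" if "k n x \<noteq> 0" for n x
  proof -
    have "bdist x < \<epsilon> n" using that by (auto simp: k_def layer_field_def layer_def indicator_def split: if_splits)
    from bdry_measure_lower_density[OF \<epsilon>(1,3) this fin]
    have "density_const * \<epsilon> n ^ DIM('m) \<le> measure bdry_measure (cball x (2 * \<epsilon> n))" .
    moreover have "0 < density_const * \<epsilon> n ^ DIM('m)" using density_const_pos \<epsilon>(1)[of n] by simp
    ultimately show ?thesis by linarith
  qed
  have kM: "(\<integral>\<^sup>+ x\<in>cball y (2 * \<epsilon> n). ennreal \<bar>k n x / measure bdry_measure (cball x (2 * \<epsilon> n))\<bar> \<partial>lebesgue) \<le> ennreal ?M"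
    if "y \<in> \<Gamma>" for n y
    using layer_bound[OF \<epsilon>(1,2,3) \<epsilon>\<nu> that v N fin, of n] by (simp add: k_def)
  define g where "g = (\<lambda>n. lf.smear (2 * \<epsilon> n) (k n))"
  have gm: "g n \<in> borel_measurable borel" and gb: "\<bar>g n y\<bar> \<le> ?M" for n y
    unfolding g_def by (rule lf.smear_approximates[OF km \<epsilon>(5,4) kpos M kM]; assumption)+
  have lim: "(\<lambda>n. LINT x|bdry_measure. \<phi> x * g n x) \<longlonglongrightarrow> flux v w \<phi>" if \<phi>: "trace_test \<delta> \<Omega> \<phi>" for \<phi>
  proof -
    have C\<phi>: "Ck 1 \<phi>" and cpt: "compact (supp \<phi>)" using \<phi> by (simp_all add: trace_test_def)
    have c\<phi>: "continuous_on UNIV \<phi>" by (rule Ck_1_continuous[OF C\<phi>])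
    have "bounded (supp \<phi>)" by (rule compact_imp_bounded[OF cpt])
    then obtain R where "\<forall>x\<in>supp \<phi>. norm x \<le> R" unfolding bounded_iff ..
    then have R: "supp \<phi> \<subseteq> cball 0 R" by auto
    have R': "\<forall>x. \<phi> x \<noteq> 0 \<longrightarrow> norm x \<le> R"
    proof (intro allI impI)
      fix x assume "\<phi> x \<noteq> 0"
      then have "x \<in> supp \<phi>" using supp_zero[of x \<phi>] by blast
      then show "norm x \<le> R" using R by auto
    qed
    have a: "(\<lambda>n. LINT x|lebesgue. \<phi> x * k n x) \<longlonglongrightarrow> flux v w \<phi>"
    proof -
      have "(LINT x|lebesgue. \<phi> x * k n x) = flux v w \<phi> - (flux v w \<phi> + (LINT x|lebesgue. \<phi> x * (layer_field (\<epsilon> n) x \<bullet> v x)))" for n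
        by (simp add: k_def)
      moreover have "(\<lambda>n. flux v w \<phi> + (LINT x|lebesgue. \<phi> x * (layer_field (\<epsilon> n) x \<bullet> v x))) \<longlonglongrightarrow> 0"
        unfolding flux_identity[OF \<epsilon>(1,2) \<phi> R v w iw iv] by (rule remainder_tendsto_0[OF \<phi> iw iv \<epsilon>(1) \<epsilon>0])
      then have "(\<lambda>n. flux v w \<phi> - (flux v w \<phi> + (LINT x|lebesgue. \<phi> x * (layer_field (\<epsilon> n) x \<bullet> v x)))) \<longlonglongrightarrow> flux v w \<phi> - 0"
        by (intro tendsto_diff tendsto_const)
      ultimately show ?thesis by simp
    qed
    let ?T = "measure bdry_measure (cball 0 (R + 1))"
    have b: "(\<lambda>n. (LINT x|bdry_measure. \<phi> x * g n x) - (LINT x|lebesgue. \<phi> x * k n x)) \<longlonglongrightarrow> 0"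
    proof (rule LIMSEQ_I)
      fix e :: real assume e: "0 < e"
      \<comment> \<open>The \<open>+ 1\<close> covers the case that \<open>?M * ?T\<close> is
        0.\<close>
      define e' where "e' = e / (?M * ?T + 1)"
      have MT: "0 \<le> ?M * ?T" by (rule mult_nonneg_nonneg[OF M measure_nonneg])
      then have e': "0 < e'" using e by (simp add: e'_def)
      have "bounded {x. \<phi> x \<noteq> 0}" using cpt by (simp add: bounded_supp_iff)
      from uniform_continuity_compact_support[OF c\<phi> this e'] obtain d
        where d: "0 < d" "\<And>x y. norm y < d \<Longrightarrow> norm (\<phi> (x - y) - \<phi> x) < e'" by blast
      have "(\<lambda>n. 2 * \<epsilon> n) \<longlonglongrightarrow> 2 * 0" by (intro tendsto_mult tendsto_const \<epsilon>0)
      then have "eventually (\<lambda>n. 2 * \<epsilon> n < d) sequentially" by (intro order_tendstoD(2)) (use d in simp_all)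
      then obtain n0 where n0: "\<And>n. n \<ge> n0 \<Longrightarrow> 2 * \<epsilon> n < d" by (auto simp: eventually_sequentially)
      have "norm ((LINT x|bdry_measure. \<phi> x * g n x) - (LINT x|lebesgue. \<phi> x * k n x) - 0) < e" if n: "n \<ge> n0" for n
      proof -
        have osc: "\<forall>x y. dist x y \<le> 2 * \<epsilon> n \<longrightarrow> \<bar>\<phi> x - \<phi> y\<bar> \<le> e'"
        proof (intro allI impI)
          fix x y :: "'m \<times> real" assume "dist x y \<le> 2 * \<epsilon> n"
          then have "norm (y - x) < d" using n0[OF n] by (simp add: dist_norm norm_minus_commute)
          from d(2)[OF this, of y] show "\<bar>\<phi> x - \<phi> y\<bar> \<le> e'" by simp
        qed
        have "\<bar>(LINT x|bdry_measure. \<phi> x * g n x) - (LINT x|lebesgue. \<phi> x * k n x)\<bar> \<le> e' * ?M * ?T"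
          unfolding g_def
          by (rule lf.smear_approximates(3)[OF km \<epsilon>(5,4) kpos M kM c\<phi> R' less_imp_le[OF e'] osc])
        also have "\<dots> = e' * (?M * ?T)" by simp
        also have "\<dots> < e' * (?M * ?T + 1)" using e' by (intro mult_strict_left_mono) auto
        also have "\<dots> = e" using MT by (simp add: e'_def)
        finally show ?thesis by simp
      qed
      then show "\<exists>no. \<forall>n\<ge>no. norm ((LINT x|bdry_measure. \<phi> x * g n x) - (LINT x|lebesgue. \<phi> x * k n x) - 0) < e" by blast
    qed
    from tendsto_add[OF b a] show ?thesis by simp
  qed
  have cv: "convergent (\<lambda>n. LINT x|bdry_measure. \<phi> x * g n x)" if "\<phi> \<in> {\<phi>. trace_test \<delta> \<Omega> \<phi>}" for \<phi>
    using lim[of \<phi>] that by (auto simp: convergent_def)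
  obtain u where u: "u \<in> borel_measurable borel" "\<And>x. \<bar>u x\<bar> \<le> ?M"
    "\<And>f b R. f \<in> borel_measurable borel \<Longrightarrow> (\<forall>x. \<bar>f x\<bar> \<le> b * indicator (cball 0 R) x) \<Longrightarrow>
      (\<lambda>n. LINT x|bdry_measure. f x * g n x) \<longlonglongrightarrow> (LINT x|bdry_measure. f x * u x)"
    by (rule lf.weak_limit_exists_locally[OF gm gb cv]) (assumption, rule that)
  show thesis
  proof (rule that[OF u(1,2)])
    fix \<phi> assume \<phi>: "trace_test \<delta> \<Omega> \<phi>"
    then have c\<phi>: "continuous_on UNIV \<phi>" and cpt: "compact (supp \<phi>)" by (simp_all add: trace_test_def Ck_1_continuous del: Ck.simps One_nat_def)
    obtain b where b: "0 \<le> b" "\<forall>x. norm (\<phi> x) \<le> b"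
      using bounded_if_continuous_compact_support[OF c\<phi> cpt supp_zero[of _ \<phi>]] by auto
    obtain R where R: "\<forall>x\<in>supp \<phi>. norm x \<le> R" using compact_imp_bounded[OF cpt] unfolding bounded_iff ..
    have bR: "\<forall>x. \<bar>\<phi> x\<bar> \<le> b * indicator (cball 0 R) x"
    proof
      fix x show "\<bar>\<phi> x\<bar> \<le> b * indicator (cball 0 R) x"
      proof (cases "x \<in> supp \<phi>")
        case True
        then show ?thesis using R spec[OF b(2), of x] by simp
      next
        case False
        then show ?thesis using b(1) by (simp add: supp_zero)
      qed
    qed
    show "(LINT x|bdry_measure. \<phi> x * u x) = flux v w \<phi>"
      by (rule LIMSEQ_unique[OF u(3)[OF borel_measurable_continuous_onI[OF c\<phi>] bR] lim[OF \<phi>]])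
  qed
qed

text \<open>A trace \<open>g\<close> and the density \<open>u\<close> have equal integrals against
  every admissible test function, so they agree almost everywhere on the boundary, and the pointwise
  bound on \<open>u\<close> becomes an essential bound on \<open>g\<close>.\<close>

lemma normal_trace_of_density:
  assumes \<delta>: "0 < \<delta>" and u: "u \<in> borel_measurable borel" "\<And>x. \<bar>u x\<bar> \<le> M"
    and flux: "\<And>\<phi>. trace_test \<delta> \<Omega> \<phi> \<Longrightarrow> (LINT x|bdry_measure. \<phi> x * u x) = flux v w \<phi>"
  shows "normal_trace \<delta> \<Omega> v w u" "normal_trace \<delta> \<Omega> v w g \<Longrightarrow> Linf_bdry_norm \<Omega> g \<le> ennreal M"
proof -
  interpret lf: locally_finite_borel bdry_measure \<Gamma> "{\<phi>. trace_test \<delta> \<Omega> \<phi>}"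
    by (rule locally_finite[OF \<delta>])
  have \<Gamma>b: "\<Gamma> \<in> sets borel" using closed by simp
  have \<phi>b: "\<phi> \<in> borel_measurable borel" if "trace_test \<delta> \<Omega> \<phi>" for \<phi>
    using that by (intro borel_measurable_continuous_onI Ck_1_continuous) (simp add: trace_test_def)
  have uT: "u \<in> borel_measurable bdry_measure" using u(1) by simp
  have iu: "integrable bdry_measure (\<lambda>x. indicator A x * u x)" if "A \<in> sets borel" "bounded A" for A
    by (rule integrable_mult_bounded(1)[OF lf.integrable_indicator_bounded[OF that] uT u(2)])
  show "normal_trace \<delta> \<Omega> v w u"
    unfolding normal_trace_def
  proof (intro conjI allI impI)
    show "u \<in> borel_measurable (surface_measure \<Omega>)"
      unfolding measurable_surface_measure using u(1) \<Gamma>b by measurable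
    fix K :: "('m \<times> real) set" assume K: "compact K"
    have A: "K \<inter> \<Gamma> \<in> sets borel" "bounded (K \<inter> \<Gamma>)"
      using K \<Gamma>b by (auto intro: borel_compact bounded_Int compact_imp_bounded)
    have m: "(\<lambda>x. indicator (K \<inter> \<Gamma>) x *\<^sub>R u x) \<in> borel_measurable borel"
      using A(1) u(1) by measurable
    show "set_integrable (surface_measure \<Omega>) (K \<inter> \<Gamma>) u"
      unfolding set_integrable_def bdry_integral(2)[OF m] using iu[OF A] by simp
  next
    fix \<phi> assume \<phi>: "trace_test \<delta> \<Omega> \<phi>"
    have m: "(\<lambda>x. u x * \<phi> x) \<in> borel_measurable borel" using u(1) \<phi>b[OF \<phi>] by measurable
    show "(LINT x|surface_measure \<Omega>. u x * \<phi> x) = (LINT x:\<Omega>|lebesgue. w x * \<phi> x) + (LINT x:\<Omega>|lebesgue. v x \<bullet> grad \<phi> x)"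
      unfolding bdry_integral(1)[OF m] using flux[OF \<phi>] by (simp add: flux_def mult.commute)
  qed
  assume g: "normal_trace \<delta> \<Omega> v w g"
  have gm: "g \<in> borel_measurable (surface_measure \<Omega>)" using g by (simp add: normal_trace_def)
  \<comment> \<open>\<open>g\<close> is measurable on the boundary only; extended by zero it is a
    Borel function on the whole space.\<close>
  define g0 where "g0 = (\<lambda>x. indicator \<Gamma> x *\<^sub>R g x)"
  have g0m: "g0 \<in> borel_measurable borel" using gm unfolding measurable_surface_measure g0_def .
  have sp: "x \<in> \<Gamma>" if "x \<in> space (surface_measure \<Omega>)" for x
    using that by (simp add: surface_measure_def space_restrict_space)
  have ig: "integrable bdry_measure (\<lambda>x. indicator (cball 0 R) x * g0 x)" for R
  proof -
    have "integrable (surface_measure \<Omega>) (\<lambda>x. indicator (cball 0 R \<inter> \<Gamma>) x *\<^sub>R g x)"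
      using g compact_cball[of 0 R] unfolding normal_trace_def set_integrable_def by blast
    then have "integrable (surface_measure \<Omega>) (\<lambda>x. indicator (cball 0 R) x * g0 x)"
      by (simp add: g0_def indicator_inter_arith mult.assoc)
    moreover have "(\<lambda>x. indicator (cball 0 R) x * g0 x) \<in> borel_measurable borel"
      by (intro borel_measurable_times borel_measurable_indicator g0m) simp
    ultimately show ?thesis using bdry_integral(2) by blast
  qed
  have gflux: "(LINT x|bdry_measure. g0 x * \<phi> x) = flux v w \<phi>" if \<phi>: "trace_test \<delta> \<Omega> \<phi>" for \<phi>
  proof -
    have m: "(\<lambda>x. g0 x * \<phi> x) \<in> borel_measurable borel" using g0m \<phi>b[OF \<phi>] by measurable
    have "(LINT x|bdry_measure. g0 x * \<phi> x) = (LINT x|surface_measure \<Omega>. g x * \<phi> x)"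
      unfolding bdry_integral(1)[OF m, symmetric]
      by (rule Bochner_Integration.integral_cong[OF refl]) (use sp in \<open>auto simp: g0_def\<close>)
    then show ?thesis using g \<phi> by (simp add: normal_trace_def flux_def)
  qed
  have "AE x in bdry_measure. g0 x - u x = 0"
  proof (rule lf.AE_zero_if_orthogonal)
    show "(\<lambda>x. g0 x - u x) \<in> borel_measurable borel" using g0m u(1) by measurable
    show "integrable bdry_measure (\<lambda>x. indicator (cball 0 R) x * (g0 x - u x))" for R
      using Bochner_Integration.integrable_diff[OF ig iu[of "cball 0 R"], of R] by (simp add: right_diff_distrib)
    fix \<phi> assume "\<phi> \<in> {\<phi>. trace_test \<delta> \<Omega> \<phi>}"
    then have \<phi>: "trace_test \<delta> \<Omega> \<phi>" by simp
    then have c\<phi>: "continuous_on UNIV \<phi>" and cpt: "compact (supp \<phi>)" by (simp_all add: trace_test_def Ck_1_continuous del: Ck.simps One_nat_def)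
    obtain b where b: "0 \<le> b" "\<forall>x. norm (\<phi> x) \<le> b"
      using bounded_if_continuous_compact_support[OF c\<phi> cpt supp_zero[of _ \<phi>]] by auto
    have b': "\<bar>\<phi> x\<bar> \<le> b" for x using spec[OF b(2), of x] by simp
    obtain R where R: "\<forall>x\<in>supp \<phi>. norm x \<le> R" using compact_imp_bounded[OF cpt] unfolding bounded_iff ..
    have loc: "integrable bdry_measure (\<lambda>x. f x * \<phi> x)" if "integrable bdry_measure (\<lambda>x. indicator (cball 0 R) x * f x)" for f
    proof -
      have "integrable bdry_measure (\<lambda>x. (indicator (cball 0 R) x * f x) * \<phi> x)"
        by (rule integrable_mult_bounded(1)[OF that _ b']) (use \<phi>b[OF \<phi>] in simp)
      also have "(\<lambda>x. (indicator (cball 0 R) x * f x) * \<phi> x) = (\<lambda>x. f x * \<phi> x)"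
      proof
        fix x show "(indicator (cball 0 R) x * f x) * \<phi> x = f x * \<phi> x"
          using R supp_zero[of x \<phi>] by (cases "x \<in> supp \<phi>") auto
      qed
      finally show ?thesis .
    qed
    have iu': "integrable bdry_measure (\<lambda>x. indicator (cball 0 R) x * u x)" by (rule iu) auto
    have "(LINT x|bdry_measure. (g0 x - u x) * \<phi> x) = (LINT x|bdry_measure. g0 x * \<phi> x) - (LINT x|bdry_measure. u x * \<phi> x)"
      using Bochner_Integration.integral_diff[OF loc[OF ig] loc[OF iu']] by (simp add: left_diff_distrib)
    then show "(LINT x|bdry_measure. (g0 x - u x) * \<phi> x) = 0"
      using gflux[OF \<phi>] flux[OF \<phi>] by (simp add: mult.commute)
  qed
  then have "AE x in bdry_measure. ennreal \<bar>g0 x\<bar> \<le> ennreal M"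
  proof (rule eventually_mono)
    fix x assume "g0 x - u x = 0"
    then have "g0 x = u x" by simp
    then show "ennreal \<bar>g0 x\<bar> \<le> ennreal M" using u(2)[of x] by (simp add: ennreal_leI)
  qed
  then have "AE x in surface_measure \<Omega>. ennreal \<bar>g0 x\<bar> \<le> ennreal M" by (simp add: AE_surface_measure)
  moreover have "AE x in surface_measure \<Omega>. ennreal \<bar>g x\<bar> = ennreal \<bar>g0 x\<bar>"
    by (rule AE_I2) (use sp in \<open>simp add: g0_def\<close>)
  ultimately have "AE x in surface_measure \<Omega>. ennreal \<bar>g x\<bar> \<le> ennreal M"
    by (rule AE_mp[OF AE_conjI]) (rule AE_I2, simp)
  then show "Linf_bdry_norm \<Omega> g \<le> ennreal M"
    unfolding Linf_bdry_norm_def using gm by (intro esssup_I) measurable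
qed

end

section \<open>The case of the whole space, and the estimate\<close>

text \<open>A nonempty connected open set without frontier is the whole space. Every test function
  is then admissible for the weak divergence, so the flux is 0, and the surface measure lives on an
  empty space.\<close>

lemma normal_trace_empty_frontier:
  fixes \<Omega> :: "'a::euclidean_space set"
  assumes \<Omega>: "open \<Omega>" "connected \<Omega>" "\<Omega> \<noteq> {}" "frontier \<Omega> = {}" and \<delta>: "0 < \<delta>"
    and v: "L1_loc \<Omega> v" and w: "weak_divergence_on (bdry_strip \<Omega> \<delta>) v w"
  shows "normal_trace \<delta> \<Omega> v w (\<lambda>_. 0)" "Linf_bdry_norm \<Omega> g = 0"
proof -
  have U: "\<Omega> = UNIV" using \<Omega> frontier_eq_empty by blast
  \<comment> \<open>\<open>infdist\<close> to the empty set is 0, so every point belongs to the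
    strip.\<close>
  have strip: "bdry_strip \<Omega> \<delta> = UNIV"
    using \<delta> \<Omega>(4) by (simp add: bdry_strip_def U infdist_def zero_ereal_def[symmetric])
  have sp: "space (surface_measure \<Omega>) = {}"
    unfolding surface_measure_def by (simp add: space_restrict_space \<Omega>(4))
  have "(LINT x:\<Omega>|lebesgue. w x * \<phi> x) + (LINT x:\<Omega>|lebesgue. v x \<bullet> grad \<phi> x) = 0" if "trace_test \<delta> \<Omega> \<phi>" for \<phi>
  proof -
    have "Ck 1 \<phi>" "compact (supp \<phi>)" using that by (simp_all add: trace_test_def)
    from weak_divergence_C1[OF open_UNIV v[unfolded U] w[unfolded strip] this] show ?thesis by (simp add: U)
  qed
  then show "normal_trace \<delta> \<Omega> v w (\<lambda>_. 0)"
    unfolding normal_trace_def set_integrable_def by simp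
  have "g \<in> borel_measurable (surface_measure \<Omega>)" by (rule measurableI) (simp_all add: sp)
  then have "(\<lambda>x. ennreal \<bar>g x\<bar>) \<in> borel_measurable (surface_measure \<Omega>)" by measurable
  moreover have "AE x in surface_measure \<Omega>. ennreal \<bar>g x\<bar> \<le> 0" by (rule AE_I2) (simp add: sp)
  ultimately have "Linf_bdry_norm \<Omega> g \<le> 0" unfolding Linf_bdry_norm_def by (rule esssup_I)
  then show "Linf_bdry_norm \<Omega> g = 0" by simp
qed

theorem theorem22:
  fixes \<Omega> :: "('m::euclidean_space \<times> real) set"
    and \<beta> r0 :: real and \<mu> \<nu> \<delta> :: ereal
  assumes "0 < \<beta>" "\<beta> < 1"
    and "uniformly_C2_holder_domain \<beta> \<Omega>"
    and "0 < r0" "0 < \<mu>" "0 < \<nu>" "0 < \<delta>"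
  shows "\<exists>C::real. 0 < C \<and>
    (\<forall>v w. vbmo r0 \<mu> \<nu> \<delta> \<Omega> v \<and>
           weak_divergence_on (bdry_strip \<Omega> \<delta>) v w \<and>
           Lp_ul r0 (real DIM('m \<times> real)) (bdry_strip \<Omega> \<delta>) w \<longrightarrow>
       (\<exists>g. normal_trace \<delta> \<Omega> v w g) \<and>
       (\<forall>g. normal_trace \<delta> \<Omega> v w g \<longrightarrow>
          Linf_bdry_norm \<Omega> g \<le> ennreal C *
            (vbmo_norm r0 \<mu> \<nu> \<delta> \<Omega> v +
             Lp_ul_norm r0 (real DIM('m \<times> real)) (bdry_strip \<Omega> \<delta>) w)))"
proof -
  have \<Omega>: "open \<Omega>" "connected \<Omega>" "\<Omega> \<noteq> {}"
    using assms(3) unfolding uniformly_C2_holder_domain_def by simp_all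
  show ?thesis
  \<comment> \<open>Nearest boundary points exist only if there is a boundary.\<close>
  proof (cases "frontier \<Omega> = {}")
    case True
    show ?thesis
    proof (intro exI[of _ "1::real"] conjI allI impI)
      fix v w
      assume "vbmo r0 \<mu> \<nu> \<delta> \<Omega> v \<and> weak_divergence_on (bdry_strip \<Omega> \<delta>) v w \<and>
        Lp_ul r0 (real DIM('m \<times> real)) (bdry_strip \<Omega> \<delta>) w"
      then have v: "L1_loc \<Omega> v" and w: "weak_divergence_on (bdry_strip \<Omega> \<delta>) v w" by (simp_all add: vbmo_def)
      note E = normal_trace_empty_frontier[OF \<Omega> True assms(7) v w]
      show "\<exists>g. normal_trace \<delta> \<Omega> v w g" by (rule exI[of _ "\<lambda>_. 0"]) (rule E(1))
      show "Linf_bdry_norm \<Omega> g \<le> ennreal 1 * (vbmo_norm r0 \<mu> \<nu> \<delta> \<Omega> v +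
        Lp_ul_norm r0 (real DIM('m \<times> real)) (bdry_strip \<Omega> \<delta>) w)" for g
        unfolding E(2) by simp
    qed simp
  next
    case False
    obtain r \<rho> L where c: "0 < r" "0 < \<rho>" "0 < L"
      and ch: "\<And>z. z \<in> frontier \<Omega> \<Longrightarrow> \<exists>T h. graph_chart r \<rho> L (frontier \<Omega>) z T h"
      by (rule uniformly_C2_holder_domain_chart[OF assms(3)]) (rule that)
    interpret graph_domain \<Omega> r \<rho> L
      by unfold_locales (use c False ch \<Omega> in \<open>simp_all\<close>)
    \<comment> \<open>Origin of the factors: 8 bounds \<open>step'\<close>, the power of 2 stems
      from the radius \<open>2 * \<epsilon>\<close>, and \<open>density_const\<close> from the lower
      density of the boundary.\<close>
    define C where "C = 8 * 2 ^ DIM('m \<times> real) / density_const"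
    have C: "0 < C" using density_const_pos by (simp add: C_def)
    show ?thesis
    proof (rule exI[of _ C], intro conjI C allI impI)
      fix v w
      assume A: "vbmo r0 \<mu> \<nu> \<delta> \<Omega> v \<and> weak_divergence_on (bdry_strip \<Omega> \<delta>) v w \<and>
        Lp_ul r0 (real DIM('m \<times> real)) (bdry_strip \<Omega> \<delta>) w"
      let ?D = "bdry_strip \<Omega> \<delta>" let ?b = "b_seminorm \<nu> \<Omega> (\<lambda>x. grad (\<lambda>y. bdist y) x \<bullet> v x)"
      have v: "L1_loc \<Omega> v" and fin: "vbmo_norm r0 \<mu> \<nu> \<delta> \<Omega> v < top"
        and w: "weak_divergence_on ?D v w" and wn: "Lp_ul_norm r0 (real DIM('m \<times> real)) ?D w < top"
        using A by (simp_all add: vbmo_def Lp_ul_def)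
      have D: "open ?D" "?D \<subseteq> \<Omega>" using open_bdry_strip[OF \<Omega>(1)] by (auto simp: bdry_strip_def)
      have b: "?b \<le> vbmo_norm r0 \<mu> \<nu> \<delta> \<Omega> v" unfolding vbmo_norm_def by simp
      \<comment> \<open>The seminorm is a summand of a finite norm, so it has a real value to work
        with.\<close>
      define N where "N = enn2real ?b"
      have N: "?b = ennreal N" "0 \<le> N"
        using order_le_less_trans[OF b fin] by (simp_all add: N_def)
      have vn: "Lp_ul_norm r0 1 ?D (\<lambda>x. v x \<bullet> i) < top" if "i \<in> Basis" for i
      proof -
        have "Lp_ul_norm r0 1 ?D (\<lambda>x. v x \<bullet> i) \<le> (\<Sum>i\<in>Basis. Lp_ul_norm r0 1 ?D (\<lambda>x. v x \<bullet> i))"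
          by (rule member_le_sum[OF that]) simp_all
        also have "\<dots> \<le> vbmo_norm r0 \<mu> \<nu> \<delta> \<Omega> v"
          unfolding vbmo_norm_def by (intro add_increasing2 add_increasing) auto
        finally show ?thesis using fin by (rule order_le_less_trans)
      qed
      have iv: "integrable lebesgue (\<lambda>x. indicator (?D \<inter> cball 0 R) x *\<^sub>R v x)" for R
        by (rule Lp_ul_integrable_vector[OF D(1) L1_loc_subset[OF v D(2)] vn assms(4)])
      have iw: "integrable lebesgue (\<lambda>x. indicator (?D \<inter> cball 0 R) x * w x)" for R
        by (rule Lp_ul_integrable[OF D(1) _ wn _ assms(4)]) (use w in \<open>simp_all add: weak_divergence_on_def\<close>)
      obtain u where u: "u \<in> borel_measurable borel" "\<And>x. \<bar>u x\<bar> \<le> C * N"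
        "\<And>\<phi>. trace_test \<delta> \<Omega> \<phi> \<Longrightarrow> (LINT x|bdry_measure. \<phi> x * u x) = flux v w \<phi>"
        by (rule flux_density_exists[OF assms(7,6) v N(2) eq_refl[OF N(1)] w iw iv, folded C_def]) (rule that)
      show "\<exists>g. normal_trace \<delta> \<Omega> v w g"
        by (rule exI[of _ u]) (rule normal_trace_of_density(1)[OF assms(7) u(1,2)], rule u(3))
      show "Linf_bdry_norm \<Omega> g \<le> ennreal C * (vbmo_norm r0 \<mu> \<nu> \<delta> \<Omega> v +
        Lp_ul_norm r0 (real DIM('m \<times> real)) ?D w)" if "normal_trace \<delta> \<Omega> v w g" for g
      proof -
        have "Linf_bdry_norm \<Omega> g \<le> ennreal (C * N)"
          by (rule normal_trace_of_density(2)[OF assms(7) u(1,2) _ that]) (rule u(3))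
        also have "\<dots> = ennreal C * ?b" unfolding N(1) using C N(2) by (intro ennreal_mult) auto
        also have "\<dots> \<le> ennreal C * (vbmo_norm r0 \<mu> \<nu> \<delta> \<Omega> v + Lp_ul_norm r0 (real DIM('m \<times> real)) ?D w)"
          by (intro mult_left_mono add_increasing2 b) auto
        finally show ?thesis .
      qed
    qed
  qed
qed

end
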